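(* If $T$ is a complete, decidable, non-$\aleph_0$-categorical theory with infinite models, then the set $\mathsf{V}(T)$ of validities of $T$ is $\Pi_1$-complete.
   Context: Languages. $S$ is a fixed first-order language with effective syntax, without identity, without constant or function symbols, and with countably many relation symbols $X^n_i$ of arity $n$ for each $n\ge 0$. $L$ denotes an effective first-order language with vocabulary disjoint from that of $S$; it may contain identity, function symbols, and constants. Formulas are identified with natural numbers via an effective coding. Theories. A theory is a set $T$ of sentences of such a language $L$ (an $L$-theory) that is closed under logical consequence; all theories are assumed consistent. $T$ is decidable if it is a computable set. $T$ is $\aleph_0$-categorical if all its models of cardinality $\aleph_0$ are isomorphic. Validities. Let $\varphi(X^1_1,\ldots,X^1_k,\ldots,X^n_1,\ldots,X^n_k)$ be a sentence of $S$ all of whose predicate symbols are among those exhibited. Given $L$-formulas $\psi^j_i(y_1,\ldots,y_j)$, for $1\le i\le k$ and $1\le j\le n$, in which the displayed variables all appear free, the corresponding substitution instance of $\varphi$ is the formula of $L$ obtained by replacing each $X^j_i(t_1,\ldots,t_j)$ in $\varphi$ with $\psi^j_i(t_1,\ldots,t_j)$. The sentence $\varphi$ is a validity of the $L$-theory $T$ if and only if, for all such choices of $L$-formulas $\psi^j_i$, the corresponding substitution instance of $\varphi$ is a member of $T$. $\mathsf{V}(T)$ is the set of all $S$-sentences that are validities of $T$. $\Pi_1$ refers to the arithmetical hierarchy of sets of natural numbers.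
   Formalization: If L lacks identity, ℵ0-categoricity is taken modulo indiscernible elements; with literal isomorphism the claim fails, e.g. for the identity-free theory of ∃xPx and ∃x¬Px, whose validities are decidable. With identity the statement is unchanged. *)

theory Defs
  imports Main "HOL-Library.Nat_Bijection" "HOL-Library.Countable_Set"
begin

section \<open>Computability and the class \<open>\<Pi>\<^sub>1\<close>\<close>

text \<open>
  \<open>recursive n f\<close>: on argument lists of length \<open>n\<close>, \<open>f\<close> is a total recursive function
  of \<open>n\<close> arguments (its values on lists of other lengths are irrelevant).  The total recursive
  functions are generated by composition, primitive recursion, and minimization restricted
  to regular functions.
\<close>

inductive recursive :: "nat \<Rightarrow> (nat list \<Rightarrow> nat) \<Rightarrow> bool" where
  zero: "recursive n (\<lambda>xs. 0)"
| succ: "recursive 1 (\<lambda>xs. Suc (xs ! 0))"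
| proj: "i < n \<Longrightarrow> recursive n (\<lambda>xs. xs ! i)"
| comp: "recursive (length hs) g \<Longrightarrow> (\<forall>h\<in>set hs. recursive n h) \<Longrightarrow>
    recursive n (\<lambda>xs. g (map (\<lambda>h. h xs) hs))"
| prim_rec: "recursive n g \<Longrightarrow> recursive (Suc (Suc n)) h \<Longrightarrow>
    recursive (Suc n) (\<lambda>xs. rec_nat (g (tl xs)) (\<lambda>y r. h (y # r # tl xs)) (hd xs))"
| mu: "recursive (Suc n) f \<Longrightarrow> (\<forall>xs. length xs = n \<longrightarrow> (\<exists>y. f (y # xs) = 0)) \<Longrightarrow>
    recursive n (\<lambda>xs. LEAST y. f (y # xs) = 0)"

definition computable_fun :: "(nat \<Rightarrow> nat) \<Rightarrow> bool" where
  "computable_fun f \<longleftrightarrow> (\<exists>g. recursive 1 g \<and> (\<forall>x. f x = g [x]))"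

definition computable_set :: "nat set \<Rightarrow> bool" where
  "computable_set A \<longleftrightarrow> computable_fun (\<lambda>x. if x \<in> A then 1 else 0)"

definition computable_rel :: "(nat \<Rightarrow> nat \<Rightarrow> bool) \<Rightarrow> bool" where
  "computable_rel R \<longleftrightarrow>
     (\<exists>g. recursive 2 g \<and> (\<forall>x y. g [x, y] = (if R x y then 1 else 0)))"

definition Pi1 :: "nat set \<Rightarrow> bool" where
  "Pi1 A \<longleftrightarrow> (\<exists>R. computable_rel R \<and> A = {x. \<forall>y. R x y})"

definition many_one_reducible :: "nat set \<Rightarrow> nat set \<Rightarrow> bool" where
  "many_one_reducible A B \<longleftrightarrow> (\<exists>f. computable_fun f \<and> (\<forall>x. x \<in> A \<longleftrightarrow> f x \<in> B))"

definition Pi1_complete :: "nat set \<Rightarrow> bool" where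
  "Pi1_complete A \<longleftrightarrow> Pi1 A \<and> (\<forall>B. Pi1 B \<longrightarrow> many_one_reducible B A)"


section \<open>The languages \<open>L\<close>\<close>

text \<open>
  A symbol is a pair (arity, index); constants are function symbols of arity \<open>0\<close>.
  Up to renaming of symbols, every effectively given vocabulary has this form.
  In terms and formulas the arity of a symbol is the length of its argument list.
  Variables are de Bruijn indices: \<open>All p\<close> binds index \<open>0\<close> of \<open>p\<close>.
\<close>

record language =
  identity :: bool
  funs :: "(nat \<times> nat) set"
  rels :: "(nat \<times> nat) set"

definition effective :: "language \<Rightarrow> bool" where
  "effective L \<longleftrightarrow> computable_set (prod_encode ` funs L) \<and> computable_set (prod_encode ` rels L)"

datatype tm = Var nat | Fn nat "tm list"

datatype fm = Bot | Eq tm tm | Rel nat "tm list" | Imp fm fm | All fm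

abbreviation Neg :: "fm \<Rightarrow> fm" where
  "Neg p \<equiv> Imp p Bot"

primrec wf_tm :: "language \<Rightarrow> tm \<Rightarrow> bool" where
  "wf_tm L (Var n) \<longleftrightarrow> True"
| "wf_tm L (Fn f ts) \<longleftrightarrow> (length ts, f) \<in> funs L \<and> list_all (wf_tm L) ts"

primrec wf_fm :: "language \<Rightarrow> fm \<Rightarrow> bool" where
  "wf_fm L Bot \<longleftrightarrow> True"
| "wf_fm L (Eq s t) \<longleftrightarrow> identity L \<and> wf_tm L s \<and> wf_tm L t"
| "wf_fm L (Rel R ts) \<longleftrightarrow> (length ts, R) \<in> rels L \<and> list_all (wf_tm L) ts"
| "wf_fm L (Imp p q) \<longleftrightarrow> wf_fm L p \<and> wf_fm L q"
| "wf_fm L (All p) \<longleftrightarrow> wf_fm L p"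

primrec fv_tm :: "tm \<Rightarrow> nat set" where
  "fv_tm (Var n) = {n}"
| "fv_tm (Fn f ts) = \<Union> (set (map fv_tm ts))"

primrec fv :: "fm \<Rightarrow> nat set" where
  "fv Bot = {}"
| "fv (Eq s t) = fv_tm s \<union> fv_tm t"
| "fv (Rel R ts) = \<Union> (set (map fv_tm ts))"
| "fv (Imp p q) = fv p \<union> fv q"
| "fv (All p) = {n. Suc n \<in> fv p}"

definition sentences :: "language \<Rightarrow> fm set" where
  "sentences L = {p. wf_fm L p \<and> fv p = {}}"

primrec code_tm :: "tm \<Rightarrow> nat" where
  "code_tm (Var n) = prod_encode (0, n)"
| "code_tm (Fn f ts) = prod_encode (1, prod_encode (f, list_encode (map code_tm ts)))"

primrec code_fm :: "fm \<Rightarrow> nat" where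
  "code_fm Bot = prod_encode (0, 0)"
| "code_fm (Eq s t) = prod_encode (1, prod_encode (code_tm s, code_tm t))"
| "code_fm (Rel R ts) = prod_encode (2, prod_encode (R, list_encode (map code_tm ts)))"
| "code_fm (Imp p q) = prod_encode (3, prod_encode (code_fm p, code_fm q))"
| "code_fm (All p) = prod_encode (4, code_fm p)"

lemma code_tm_inject: "code_tm s = code_tm t \<longleftrightarrow> s = t"
proof (induction s arbitrary: t)
  case (Var n)
  then show ?case by (cases t) auto
next
  case (Fn f ts)
  show ?case
  proof (cases t)
    case (Fn g us)
    have "map code_tm ts = map code_tm us \<longleftrightarrow> ts = us"
      using Fn.IH by (auto simp: list_eq_iff_nth_eq)
    with Fn show ?thesis by (auto simp: list_encode_eq)
  qed simp
qed

lemma inj_code_tm: "inj code_tm"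
  by (simp add: inj_def code_tm_inject)

lemma inj_code_fm: "inj code_fm"
proof -
  have "code_fm p = code_fm q \<longleftrightarrow> p = q" for p q
  proof (induction p arbitrary: q)
    case Bot
    then show ?case by (cases q) auto
  next
    case (Eq s t)
    then show ?case by (cases q) (auto simp: code_tm_inject)
  next
    case (Rel R ts)
    then show ?case by (cases q) (auto simp: list_encode_eq inj_code_tm)
  next
    case (Imp p1 p2)
    then show ?case by (cases q) auto
  next
    case (All p)
    then show ?case by (cases q) auto
  qed
  then show ?thesis by (simp add: inj_def)
qed


section \<open>Structures and logical consequence\<close>

record 'a struct =
  carrier :: "'a set"
  fun_int :: "nat \<Rightarrow> 'a list \<Rightarrow> 'a"
  rel_int :: "nat \<Rightarrow> 'a list \<Rightarrow> bool"

definition wf_struct :: "language \<Rightarrow> 'a struct \<Rightarrow> bool" where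
  "wf_struct L M \<longleftrightarrow> carrier M \<noteq> {} \<and>
     (\<forall>(n, f) \<in> funs L. \<forall>xs \<in> lists (carrier M). length xs = n \<longrightarrow> fun_int M f xs \<in> carrier M)"

primrec val :: "'a struct \<Rightarrow> (nat \<Rightarrow> 'a) \<Rightarrow> tm \<Rightarrow> 'a" where
  "val M e (Var n) = e n"
| "val M e (Fn f ts) = fun_int M f (map (val M e) ts)"

primrec sat :: "'a struct \<Rightarrow> (nat \<Rightarrow> 'a) \<Rightarrow> fm \<Rightarrow> bool" where
  "sat M e Bot \<longleftrightarrow> False"
| "sat M e (Eq s t) \<longleftrightarrow> val M e s = val M e t"
| "sat M e (Rel R ts) \<longleftrightarrow> rel_int M R (map (val M e) ts)"
| "sat M e (Imp p q) \<longleftrightarrow> (sat M e p \<longrightarrow> sat M e q)"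
| "sat M e (All p) \<longleftrightarrow> (\<forall>x \<in> carrier M. sat M (case_nat x e) p)"

definition satisfies :: "'a struct \<Rightarrow> fm \<Rightarrow> bool" where
  "satisfies M p \<longleftrightarrow> (\<forall>e. range e \<subseteq> carrier M \<longrightarrow> sat M e p)"

definition model :: "language \<Rightarrow> fm set \<Rightarrow> 'a struct \<Rightarrow> bool" where
  "model L T M \<longleftrightarrow> wf_struct L M \<and> (\<forall>p \<in> T. satisfies M p)"

text \<open>
  Every vocabulary considered is countable, so by the downward Loewenheim-Skolem theorem it
  suffices to let structures with carrier a (finite or infinite) set of natural numbers range
  over the definitions below; see \<open>entails_imp_satisfies\<close> and
  \<open>has_infinite_modelsI\<close> for the passage to structures over an arbitrary type.
\<close>

definition entails :: "language \<Rightarrow> fm set \<Rightarrow> fm \<Rightarrow> bool" where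
  "entails L T p \<longleftrightarrow> (\<forall>M :: nat struct. model L T M \<longrightarrow> satisfies M p)"

definition has_infinite_models :: "language \<Rightarrow> fm set \<Rightarrow> bool" where
  "has_infinite_models L T \<longleftrightarrow> (\<exists>M :: nat struct. model L T M \<and> infinite (carrier M))"


section \<open>Theories\<close>

text \<open>Theories are consistent by definition; for a set closed under consequence this means
  that \<open>Bot\<close> is not a member.\<close>

definition is_theory :: "language \<Rightarrow> fm set \<Rightarrow> bool" where
  "is_theory L T \<longleftrightarrow> T \<subseteq> sentences L \<and> (\<forall>p \<in> sentences L. entails L T p \<longrightarrow> p \<in> T) \<and> Bot \<notin> T"

definition complete_theory :: "language \<Rightarrow> fm set \<Rightarrow> bool" where
  "complete_theory L T \<longleftrightarrow> (\<forall>p \<in> sentences L. p \<in> T \<or> Neg p \<in> T)"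

definition decidable_theory :: "fm set \<Rightarrow> bool" where
  "decidable_theory T \<longleftrightarrow> computable_set (code_fm ` T)"

definition isomorphism :: "language \<Rightarrow> 'a struct \<Rightarrow> 'b struct \<Rightarrow> ('a \<Rightarrow> 'b) \<Rightarrow> bool" where
  "isomorphism L M N h \<longleftrightarrow> bij_betw h (carrier M) (carrier N) \<and>
     (\<forall>(n, f) \<in> funs L. \<forall>xs \<in> lists (carrier M). length xs = n \<longrightarrow>
        h (fun_int M f xs) = fun_int N f (map h xs)) \<and>
     (\<forall>(n, R) \<in> rels L. \<forall>xs \<in> lists (carrier M). length xs = n \<longrightarrow>
        rel_int M R xs = rel_int N R (map h xs))"

text \<open>
  The analogue of an isomorphism for languages without identity, in which a model may contain
  any number of copies of an element that no formula can tell apart: a total and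
  surjective relation preserving functions, and preserving relations in both directions.
  Such a relation exists iff the quotients of the two structures by indiscernibility
  (Leibniz equality) are isomorphic in the usual sense.
\<close>

definition correspondence ::
    "language \<Rightarrow> 'a struct \<Rightarrow> 'b struct \<Rightarrow> ('a \<Rightarrow> 'b \<Rightarrow> bool) \<Rightarrow> bool" where
  "correspondence L M N C \<longleftrightarrow>
     (\<forall>x y. C x y \<longrightarrow> x \<in> carrier M \<and> y \<in> carrier N) \<and>
     (\<forall>x \<in> carrier M. \<exists>y. C x y) \<and> (\<forall>y \<in> carrier N. \<exists>x. C x y) \<and>
     (\<forall>(n, f) \<in> funs L. \<forall>xs ys. length xs = n \<longrightarrow> list_all2 C xs ys \<longrightarrow>
        C (fun_int M f xs) (fun_int N f ys)) \<and>
     (\<forall>(n, R) \<in> rels L. \<forall>xs ys. length xs = n \<longrightarrow> list_all2 C xs ys \<longrightarrow>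
        rel_int M R xs = rel_int N R ys)"

text \<open>
  With identity in the language, \<open>isomorphic\<close> is isomorphism in the ordinary sense.  Without
  identity, ordinary isomorphism would be too fine for the study of categoricity: the complete
  theory of \<open>\<exists>x. P x\<close> and \<open>\<exists>x. \<not> P x\<close> in the identity-free language of one unary predicate
  has countably infinite models with one, or with two, elements satisfying \<open>P\<close>, although
  modulo indiscernibility all its models are a two-element structure, and its validities (the \<open>S\<close>-sentences
  true in all two-element structures) form a decidable set.
\<close>

definition isomorphic :: "language \<Rightarrow> 'a struct \<Rightarrow> 'b struct \<Rightarrow> bool" where
  "isomorphic L M N \<longleftrightarrow>
     (if identity L then \<exists>h. isomorphism L M N h else \<exists>C. correspondence L M N C)"

text \<open>Infinite sets of natural numbers are exactly the carriers of cardinality \<open>\<aleph>\<^sub>0\<close>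
  available in type \<open>nat\<close>, and up to isomorphism all structures of that cardinality have
  such a carrier.\<close>

definition aleph0_categorical :: "language \<Rightarrow> fm set \<Rightarrow> bool" where
  "aleph0_categorical L T \<longleftrightarrow>
     (\<forall>(M :: nat struct) (N :: nat struct). model L T M \<longrightarrow> infinite (carrier M) \<longrightarrow>
        model L T N \<longrightarrow> infinite (carrier N) \<longrightarrow> isomorphic L M N)"


section \<open>The language \<open>S\<close> and validities\<close>

text \<open>
  \<open>SRel i [v\<^sub>1, \<dots>, v\<^sub>n]\<close> is \<open>X\<^sup>n\<^sub>i(v\<^sub>1, \<dots>, v\<^sub>n)\<close>; the only terms of \<open>S\<close> are variables
  (again de Bruijn indices).
\<close>

datatype sfm = SBot | SRel nat "nat list" | SImp sfm sfm | SAll sfm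

primrec sfv :: "sfm \<Rightarrow> nat set" where
  "sfv SBot = {}"
| "sfv (SRel i vs) = set vs"
| "sfv (SImp p q) = sfv p \<union> sfv q"
| "sfv (SAll p) = {n. Suc n \<in> sfv p}"

primrec ssyms :: "sfm \<Rightarrow> (nat \<times> nat) set" where
  "ssyms SBot = {}"
| "ssyms (SRel i vs) = {(length vs, i)}"
| "ssyms (SImp p q) = ssyms p \<union> ssyms q"
| "ssyms (SAll p) = ssyms p"

primrec code_sfm :: "sfm \<Rightarrow> nat" where
  "code_sfm SBot = prod_encode (0, 0)"
| "code_sfm (SRel i vs) = prod_encode (1, prod_encode (i, list_encode vs))"
| "code_sfm (SImp p q) = prod_encode (2, prod_encode (code_sfm p, code_sfm q))"
| "code_sfm (SAll p) = prod_encode (3, code_sfm p)"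

lemma inj_code_sfm: "inj code_sfm"
proof -
  have "code_sfm p = code_sfm q \<longleftrightarrow> p = q" for p q
  proof (induction p arbitrary: q)
    case SBot
    then show ?case by (cases q) auto
  next
    case (SRel i vs)
    then show ?case by (cases q) (auto simp: list_encode_eq)
  next
    case (SImp p1 p2)
    then show ?case by (cases q) auto
  next
    case (SAll p)
    then show ?case by (cases q) auto
  qed
  then show ?thesis by (simp add: inj_def)
qed

primrec rename_tm :: "(nat \<Rightarrow> nat) \<Rightarrow> tm \<Rightarrow> tm" where
  "rename_tm r (Var n) = Var (r n)"
| "rename_tm r (Fn f ts) = Fn f (map (rename_tm r) ts)"

text \<open>Capture-avoiding replacement of each free variable \<open>n\<close> by the variable \<open>r n\<close>.\<close>

primrec rename :: "(nat \<Rightarrow> nat) \<Rightarrow> fm \<Rightarrow> fm" where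
  "rename r Bot = Bot"
| "rename r (Eq s t) = Eq (rename_tm r s) (rename_tm r t)"
| "rename r (Rel R ts) = Rel R (map (rename_tm r) ts)"
| "rename r (Imp p q) = Imp (rename r p) (rename r q)"
| "rename r (All p) = All (rename (case_nat 0 (\<lambda>n. Suc (r n))) p)"

text \<open>
  \<open>\<psi> j i\<close> is the formula \<open>\<psi>\<^sup>j\<^sub>i(y\<^sub>1, \<dots>, y\<^sub>j)\<close> to be substituted for \<open>X\<^sup>j\<^sub>i\<close>, with the variables
  \<open>0, \<dots>, j - 1\<close> in the role of \<open>y\<^sub>1, \<dots>, y\<^sub>j\<close>.
\<close>

primrec instance_of :: "(nat \<Rightarrow> nat \<Rightarrow> fm) \<Rightarrow> sfm \<Rightarrow> fm" where
  "instance_of \<psi> SBot = Bot"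
| "instance_of \<psi> (SRel i vs) = rename (\<lambda>m. vs ! m) (\<psi> (length vs) i)"
| "instance_of \<psi> (SImp p q) = Imp (instance_of \<psi> p) (instance_of \<psi> q)"
| "instance_of \<psi> (SAll p) = All (instance_of \<psi> p)"

definition validities :: "language \<Rightarrow> fm set \<Rightarrow> sfm set" where
  "validities L T = {\<phi>. sfv \<phi> = {} \<and>
     (\<forall>\<psi>. (\<forall>(j, i) \<in> ssyms \<phi>. wf_fm L (\<psi> j i) \<and> fv (\<psi> j i) = {..<j}) \<longrightarrow>
        instance_of \<psi> \<phi> \<in> T)}"


section \<open>Independence of the carrier type\<close>

lemma val_cong: "(\<And>n. n \<in> fv_tm t \<Longrightarrow> e n = e' n) \<Longrightarrow> val M e t = val M e' t"
proof (induction t)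
  case (Fn f ts)
  have "map (val M e) ts = map (val M e') ts"
    using Fn by (intro map_cong) auto
  then show ?case by (simp del: map_eq_conv)
qed simp

lemma sat_cong: "(\<And>n. n \<in> fv p \<Longrightarrow> e n = e' n) \<Longrightarrow> sat M e p = sat M e' p"
proof (induction p arbitrary: e e')
  case (Eq s t)
  then have "val M e s = val M e' s" "val M e t = val M e' t"
    by (auto intro!: val_cong)
  then show ?case by simp
next
  case (Rel R ts)
  then have "map (val M e) ts = map (val M e') ts"
    by (intro map_cong val_cong) auto
  then show ?case by (simp del: map_eq_conv)
next
  case (Imp p q)
  then have "sat M e p = sat M e' p" "sat M e q = sat M e' q"
    by (metis UnCI fv.simps(4))+
  then show ?case by simp
next
  case (All p)
  have "sat M (case_nat x e) p = sat M (case_nat x e') p" for x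
    using All.prems by (intro All.IH) (auto split: nat.split)
  then show ?case by simp
qed simp

lemma finite_fv_tm: "finite (fv_tm t)"
  by (induction t) auto

lemma finite_fv: "finite (fv p)"
proof (induction p)
  case (All p)
  have "fv (All p) = Suc -` fv p" by auto
  with All show ?case by (simp add: finite_vimageI)
qed (auto simp: finite_fv_tm)

lemma wf_structD:
  "wf_struct L M \<Longrightarrow> (length xs, f) \<in> funs L \<Longrightarrow> set xs \<subseteq> carrier M \<Longrightarrow>
    fun_int M f xs \<in> carrier M"
  unfolding wf_struct_def by blast

lemma val_in_carrier:
  assumes "wf_struct L M" "wf_tm L t" "range e \<subseteq> carrier M"
  shows "val M e t \<in> carrier M"
  using assms(2)
proof (induction t)
  case (Var n)
  then show ?case using assms(3) by auto
next
  case (Fn f ts)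
  then show ?case using assms(1) by (auto simp: list_all_iff intro!: wf_structD)
qed

lemma countable_UNIV_fm: "countable (UNIV :: fm set)"
  using inj_code_fm by (rule countableI)

lemma sat_restrict:
  assumes H: "H \<subseteq> carrier M"
    and wit: "\<And>p e x. range e \<subseteq> H \<Longrightarrow> x \<in> carrier M \<Longrightarrow> \<not> sat M (case_nat x e) p \<Longrightarrow>
                \<exists>y\<in>H. \<not> sat M (case_nat y e) p"
    and e: "range e \<subseteq> H"
  shows "sat (M\<lparr>carrier := H\<rparr>) e p = sat M e p"
proof -
  have val: "val (M\<lparr>carrier := H\<rparr>) e t = val M e t" for e t
  proof (induction t)
    case (Fn f ts)
    then have "map (val (M\<lparr>carrier := H\<rparr>) e) ts = map (val M e) ts" by simp
    then show ?case by (simp del: map_eq_conv)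
  qed simp
  then have val': "val (M\<lparr>carrier := H\<rparr>) e = val M e" for e by auto
  show ?thesis using e
  proof (induction p arbitrary: e)
    case (All p)
    have "sat (M\<lparr>carrier := H\<rparr>) (case_nat x e) p = sat M (case_nat x e) p" if "x \<in> H" for x
      using All.prems that by (intro All.IH) (auto split: nat.splits simp: range_subsetD)
    then show ?case using H wit[OF All.prems] by simp blast
  qed (auto simp: val')
qed

lemma sat_transport:
  assumes wf: "wf_struct L M" and g: "inj_on g (carrier M)"
    and N: "N = \<lparr>carrier = g ` carrier M,
                 fun_int = \<lambda>f xs. g (fun_int M f (map (inv_into (carrier M) g) xs)),
                 rel_int = \<lambda>R xs. rel_int M R (map (inv_into (carrier M) g) xs)\<rparr>"
    and p: "wf_fm L p" and e: "range e \<subseteq> carrier M"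
  shows "sat N (g \<circ> e) p = sat M e p"
proof -
  have N_fun: "fun_int N f xs = g (fun_int M f (map (inv_into (carrier M) g) xs))" for f xs
    by (simp add: N)
  have N_rel: "rel_int N R xs = rel_int M R (map (inv_into (carrier M) g) xs)" for R xs
    by (simp add: N)
  have val: "val N (g \<circ> e) t = g (val M e t)" if "range e \<subseteq> carrier M" "wf_tm L t" for e t
    using that(2)
  proof (induction t)
    case (Fn f ts)
    then have "val N (g \<circ> e) t = g (val M e t) \<and> val M e t \<in> carrier M" if "t \<in> set ts" for t
      using that val_in_carrier[OF wf _ \<open>range e \<subseteq> carrier M\<close>]
      by (simp add: list_all_iff del: comp_apply)
    then have "map (inv_into (carrier M) g) (map (val N (g \<circ> e)) ts) = map (val M e) ts"
      using g by (simp del: map_eq_conv add: map_eq_conv)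
    then show ?case by (simp only: val.simps N_fun)
  qed simp
  have inv: "map (inv_into (carrier M) g) (map (val N (g \<circ> e)) ts) = map (val M e) ts"
    if "range e \<subseteq> carrier M" "list_all (wf_tm L) ts" for e ts
    using that(2) val[OF that(1)] val_in_carrier[OF wf _ that(1)] g
    by (simp add: list_all_iff)
  show ?thesis using p e
  proof (induction p arbitrary: e)
    case (Eq s t)
    then show ?case using val[of e] val_in_carrier[OF wf _ Eq.prems(2)] g
      by (simp add: inj_on_eq_iff del: comp_apply)
  next
    case (Rel R ts)
    then show ?case using inv[OF Rel.prems(2), of ts] by (simp only: wf_fm.simps sat.simps N_rel)
  next
    case (All p)
    have "sat N (g \<circ> (case_nat x e)) p = sat M (case_nat x e) p" if "x \<in> carrier M" for x
      using All.prems that by (intro All.IH) (auto split: nat.splits simp: range_subsetD)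
    moreover have "g \<circ> (case_nat x e) = case_nat (g x) (g \<circ> e)" for x
      by (auto split: nat.splits)
    moreover have "carrier N = g ` carrier M" by (simp add: N)
    ultimately show ?case by (simp del: comp_apply)
  qed auto
qed

theorem downward_Loewenheim_Skolem:
  fixes M :: "'a struct"
  assumes wf: "wf_struct L M"
  obtains N :: "nat struct" where "wf_struct L N"
    and "\<And>p. p \<in> sentences L \<Longrightarrow> satisfies N p \<longleftrightarrow> satisfies M p"
    and "infinite (carrier M) \<Longrightarrow> infinite (carrier N)"
proof -
  obtain a0 where a0: "a0 \<in> carrier M" using wf by (auto simp: wf_struct_def)
  obtain X where X: "X \<subseteq> carrier M" "countable X" "infinite (carrier M) \<Longrightarrow> infinite X"
  proof (cases "infinite (carrier M)")
    case True
    then obtain X where "X \<subseteq> carrier M" "infinite X" "countable X"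
      using infinite_countable_subset'[of "carrier M"] by blast
    then show thesis using that by blast
  next
    case False
    then show thesis using that[of "{}"] by simp
  qed
  define env where "env es n = (if n < length es then es ! n else a0)" for es and n :: nat
  define w where "w p es = (SOME x. x \<in> carrier M \<and> \<not> sat M (case_nat x (env es)) p)" for p es
  define step where "step A = A \<union> (\<lambda>(f, xs). fun_int M f xs) ` (UNIV \<times> lists A)
      \<union> (\<lambda>(p, es). w p es) ` (UNIV \<times> lists A)" for A
  define H where "H = (\<Union>k. (step ^^ k) (insert a0 X)) \<inter> carrier M"
  have cnt_step: "countable (step A)" if "countable A" for A
    unfolding step_def using that countable_UNIV_fm
    by (intro countable_Un countable_image countable_SIGMA) auto
  have cnt: "countable ((step ^^ k) (insert a0 X))" for k
    by (induction k) (auto intro: X(2) cnt_step)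
  then have cH: "countable H" unfolding H_def by (intro countable_Int1 countable_UN) auto
  have mono: "(step ^^ k) (insert a0 X) \<subseteq> (step ^^ l) (insert a0 X)" if "k \<le> l" for k l
    using that by (induction l rule: dec_induct) (auto simp: step_def)
  have HM: "H \<subseteq> carrier M" and a0H: "a0 \<in> H" and XH: "X \<subseteq> H"
    using a0 X(1) mono[of 0] unfolding H_def by auto
  have fin: "\<exists>k. set xs \<subseteq> (step ^^ k) (insert a0 X)" if "set xs \<subseteq> H" for xs
    using that
  proof (induction xs)
    case (Cons x xs)
    then obtain k l where "x \<in> (step ^^ k) (insert a0 X)" "set xs \<subseteq> (step ^^ l) (insert a0 X)"
      by (auto simp: H_def)
    then have "set (x # xs) \<subseteq> (step ^^ (max k l)) (insert a0 X)"
      using mono[of k "max k l"] mono[of l "max k l"] by auto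
    then show ?case by blast
  qed simp
  have Hfun: "fun_int M f xs \<in> H" if xs: "set xs \<subseteq> H" "fun_int M f xs \<in> carrier M" for f xs
  proof -
    obtain k where "set xs \<subseteq> (step ^^ k) (insert a0 X)" using fin[OF xs(1)] by blast
    then have "fun_int M f xs \<in> (step ^^ Suc k) (insert a0 X)"
      by (force simp: step_def)
    then show ?thesis using xs(2) unfolding H_def by blast
  qed
  have Hw: "w p xs \<in> H" if xs: "set xs \<subseteq> H" "w p xs \<in> carrier M" for p xs
  proof -
    obtain k where "set xs \<subseteq> (step ^^ k) (insert a0 X)" using fin[OF xs(1)] by blast
    then have "w p xs \<in> (step ^^ Suc k) (insert a0 X)"
      by (force simp: step_def)
    then show ?thesis using xs(2) unfolding H_def by blast
  qed
  have wit: "\<exists>y\<in>H. \<not> sat M (case_nat y e) p"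
    if e: "range e \<subseteq> H" and x: "x \<in> carrier M" "\<not> sat M (case_nat x e) p" for p e x
  proof -
    obtain k where k: "fv p \<subseteq> {..<k}"
      using finite_fv[of p] finite_nat_iff_bounded by auto
    define es where "es = map e [0..<k]"
    have eq: "sat M (case_nat y e) p = sat M (case_nat y (env es)) p" for y
      using k by (intro sat_cong) (auto simp: env_def es_def split: nat.split)
    have *: "w p es \<in> carrier M \<and> \<not> sat M (case_nat (w p es) (env es)) p"
      unfolding w_def by (rule someI[of _ x]) (use x eq in simp)
    moreover have "set es \<subseteq> H" using e by (auto simp: es_def)
    ultimately show ?thesis using Hw eq by blast
  qed
  define M' where "M' = M\<lparr>carrier := H\<rparr>"
  have wf': "wf_struct L M'"
    unfolding wf_struct_def
  proof (intro conjI ballI, goal_cases)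
    case 1
    then show ?case using a0H by (auto simp: M'_def)
  next
    case (2 nf)
    obtain n f where nf: "nf = (n, f)" by (cases nf)
    have "fun_int M f xs \<in> H" if xs: "xs \<in> lists H" "length xs = n" for xs
    proof (rule Hfun)
      show "set xs \<subseteq> H" using xs(1) by auto
      then show "fun_int M f xs \<in> carrier M"
        using wf 2 xs(2) HM unfolding nf by (intro wf_structD) auto
    qed
    then show ?case by (auto simp: nf M'_def)
  qed
  have sat': "sat M' e p = sat M e p" if "range e \<subseteq> H" for e p
    unfolding M'_def using HM wit that by (rule sat_restrict)
  define g where "g = to_nat_on H"
  have g: "inj_on g (carrier M')" using cH by (simp add: g_def M'_def inj_on_to_nat_on)
  define N where "N = \<lparr>carrier = g ` carrier M',
                 fun_int = \<lambda>f xs. g (fun_int M' f (map (inv_into (carrier M') g) xs)),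
                 rel_int = \<lambda>R xs. rel_int M' R (map (inv_into (carrier M') g) xs)\<rparr>"
  have wfN: "wf_struct L N"
    unfolding wf_struct_def
  proof (intro conjI ballI, goal_cases)
    case 1
    then show ?case using a0H by (auto simp: N_def M'_def)
  next
    case (2 nf)
    obtain n f where nf: "nf = (n, f)" by (cases nf)
    have "fun_int N f xs \<in> carrier N" if xs: "xs \<in> lists (carrier N)" "length xs = n" for xs
    proof -
      have "set (map (inv_into (carrier M') g) xs) \<subseteq> carrier M'"
        using xs(1) by (auto simp: N_def inv_into_into)
      then have "fun_int M' f (map (inv_into (carrier M') g) xs) \<in> carrier M'"
        using wf' 2 xs(2) unfolding nf by (intro wf_structD) auto
      then show ?thesis by (simp add: N_def)
    qed
    then show ?case by (auto simp: nf)
  qed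
  have satN: "satisfies N p \<longleftrightarrow> satisfies M p" if p: "p \<in> sentences L" for p
  proof -
    have "satisfies N p \<longleftrightarrow> sat N (g \<circ> (\<lambda>_. a0)) p"
    proof -
      have "sat N e p = sat N (g \<circ> (\<lambda>_. a0)) p" for e
        using p by (intro sat_cong) (auto simp: sentences_def)
      moreover have "range (g \<circ> (\<lambda>_. a0)) \<subseteq> carrier N" using a0H by (auto simp: N_def M'_def)
      ultimately show ?thesis unfolding satisfies_def by blast
    qed
    also have "\<dots> \<longleftrightarrow> sat M' (\<lambda>_. a0) p"
      using p a0H by (intro sat_transport[OF wf' g N_def]) (auto simp: sentences_def M'_def)
    also have "\<dots> \<longleftrightarrow> sat M (\<lambda>_. a0) p" using a0H by (intro sat') auto
    also have "\<dots> \<longleftrightarrow> satisfies M p"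
    proof -
      have "sat M e p = sat M (\<lambda>_. a0) p" for e
        using p by (intro sat_cong) (auto simp: sentences_def)
      moreover have "range (\<lambda>_. a0) \<subseteq> carrier M" using a0 by auto
      ultimately show ?thesis unfolding satisfies_def by blast
    qed
    finally show ?thesis .
  qed
  have "infinite (carrier N)" if "infinite (carrier M)"
  proof -
    have "infinite H" using X(3)[OF that] XH finite_subset by blast
    then show ?thesis using g finite_image_iff by (auto simp: N_def M'_def)
  qed
  with wfN satN show thesis using that by blast
qed

lemma entails_imp_satisfies:
  fixes M :: "'a struct"
  assumes "entails L T p" "T \<subseteq> sentences L" "p \<in> sentences L" "model L T M"
  shows "satisfies M p"
proof -
  have "wf_struct L M" using assms(4) by (simp add: model_def)
  then obtain N :: "nat struct" where N: "wf_struct L N"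
    "\<And>p. p \<in> sentences L \<Longrightarrow> satisfies N p \<longleftrightarrow> satisfies M p"
    using downward_Loewenheim_Skolem by metis
  then have "model L T N" using assms(2,4) by (auto simp: model_def)
  then show ?thesis using assms(1,3) N(2) by (auto simp: entails_def)
qed

lemma has_infinite_modelsI:
  fixes M :: "'a struct"
  assumes "T \<subseteq> sentences L" "model L T M" "infinite (carrier M)"
  shows "has_infinite_models L T"
proof -
  have "wf_struct L M" using assms(2) by (simp add: model_def)
  then obtain N :: "nat struct" where N: "wf_struct L N"
    "\<And>p. p \<in> sentences L \<Longrightarrow> satisfies N p \<longleftrightarrow> satisfies M p" "infinite (carrier N)"
    using downward_Loewenheim_Skolem assms(3) by metis
  then have "model L T N" using assms(1,2) by (auto simp: model_def)
  then show ?thesis using N(3) by (auto simp: has_infinite_models_def)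
qed

end

theory Submission
  imports Defs
begin

text \<open>
  To see that the validities form a \<open>\<Pi>\<^sub>1\<close> set, observe that a decision procedure for \<open>T\<close> also
  decides which numbers are codes of formulas, so every number \<open>y\<close> can be read as an
  assignment of formulas to the symbols of \<open>S\<close>, and every finite assignment arises in this way.  The code of the resulting instance of \<open>\<phi>\<close> is computed
  from \<open>y\<close> and the code of \<open>\<phi>\<close> by course-of-values recursion.  Being a validity is then the
  statement that for all \<open>y\<close> this instance belongs to the decidable set \<open>T\<close>
  (\<open>Pi1_validities\<close>).

  Hardness is proved by a variant of Trakhtenbrot's theorem.  Let \<open>B = {x. \<forall>y. R x y}\<close> with a decidable
  relation \<open>R\<close>.  For each \<open>x\<close> there is a sentence \<open>reduction d t x\<close> of \<open>S\<close> that is false in a structure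
  iff the structure is an ordered initial piece of arithmetic, carrying the graphs of finitely many
  recursive functions, in which according to these graphs \<open>\<not> R x y\<close> for some \<open>y\<close>.

  If \<open>x \<notin> B\<close>, such a piece exists on \<open>{..N}\<close> for some \<open>N\<close> (\<open>reduction_refuted_finite\<close>).  As \<open>T\<close> is not
  \<open>\<aleph>\<^sub>0\<close>-categorical, there are a model and an \<open>n\<close> for which the formulas in \<open>n\<close> variables partition the
  \<open>n\<close>-tuples into arbitrarily many classes (\<open>not_categorical_unbounded\<close>, the Ryll-Nardzewski
  theorem).  Hence every finite structure is, up to indiscernibility, definable on the \<open>n\<close>-tuples
  (\<open>interpret_finite\<close>), and the reduction, with each variable replaced by \<open>n\<close> variables, has an
  instance outside \<open>T\<close>.

  If \<open>x \<in> B\<close>, the element \<open>y\<close> in a structure refuting the sentence cannot be a standard number.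
  Therefore all standard numbers exist in the structure, and on them all the recursive
  functions are represented correctly (\<open>graph_sound\<close>, \<open>graph_complete\<close>).  No such structure is
  definable in a model of \<open>T\<close>, by the argument for Tarski's theorem: membership in \<open>T\<close> decides what
  is true in it, and \<open>d\<close> is a recursive function, represented in it, that diagonalizes against
  these decisions (\<open>diagonal\<close>).  So no instance can lie outside \<open>T\<close>.
\<close>

section \<open>Recursive functions of several arguments\<close>

text \<open>
  Membership in \<open>recursive n\<close> is sensitive to values on lists of the wrong length; closing it
  under agreement on lists of length \<open>n\<close> makes it invariant under rewriting of the function.
\<close>

definition recfn :: "nat \<Rightarrow> (nat list \<Rightarrow> nat) \<Rightarrow> bool" where
  "recfn n f \<longleftrightarrow> (\<exists>g. recursive n g \<and> (\<forall>xs. length xs = n \<longrightarrow> f xs = g xs))"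

definition recpred :: "nat \<Rightarrow> (nat list \<Rightarrow> bool) \<Rightarrow> bool" where
  "recpred n P \<longleftrightarrow> recfn n (\<lambda>xs. if P xs then 1 else 0)"

named_theorems rec_intro

lemma recfn_cong: "(\<And>xs. length xs = n \<Longrightarrow> f xs = g xs) \<Longrightarrow> recfn n f \<longleftrightarrow> recfn n g"
  unfolding recfn_def by auto

lemma recfn_comp:
  assumes "recfn (length hs) g" "\<forall>h\<in>set hs. recfn n h"
  shows "recfn n (\<lambda>xs. g (map (\<lambda>h. h xs) hs))"
proof -
  obtain g' where g': "recursive (length hs) g'" "\<And>xs. length xs = length hs \<Longrightarrow> g xs = g' xs"
    using assms(1) unfolding recfn_def by blast
  have "\<forall>h\<in>set hs. \<exists>h'. recursive n h' \<and> (\<forall>xs. length xs = n \<longrightarrow> h xs = h' xs)"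
    using assms(2) unfolding recfn_def by blast
  then obtain r where r: "\<And>h. h \<in> set hs \<Longrightarrow> recursive n (r h)"
    "\<And>h xs. h \<in> set hs \<Longrightarrow> length xs = n \<Longrightarrow> h xs = r h xs"
    by metis
  have "recursive n (\<lambda>xs. g' (map (\<lambda>h. h xs) (map r hs)))"
    by (rule recursive.comp) (use g'(1) r(1) in auto)
  moreover have "g (map (\<lambda>h. h xs) hs) = g' (map (\<lambda>h. h xs) (map r hs))" if "length xs = n" for xs
  proof -
    have "map (\<lambda>h. h xs) hs = map (\<lambda>h. h xs) (map r hs)" using r(2) that by auto
    then show ?thesis using g'(2) by (metis length_map)
  qed
  ultimately show ?thesis unfolding recfn_def by blast
qed

lemma recfn_proj [rec_intro]: "i < n \<Longrightarrow> recfn n (\<lambda>xs. xs ! i)"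
  unfolding recfn_def using recursive.proj by blast

lemma recfn_nth_drop [rec_intro]: "k + i < n \<Longrightarrow> recfn n (\<lambda>xs. drop k xs ! i)"
  using recfn_proj[of "k + i" n] recfn_cong[of n "\<lambda>xs. drop k xs ! i" "\<lambda>xs. xs ! (k + i)"] by simp

lemma recfn_app1:
  assumes "recfn 1 (\<lambda>xs. f (xs ! 0))" "recfn n F"
  shows "recfn n (\<lambda>xs. f (F xs))"
  using recfn_comp[of "[F]" "\<lambda>xs. f (xs ! 0)" n] assms by simp

lemma recfn_app2:
  assumes "recfn 2 (\<lambda>xs. f (xs ! 0) (xs ! 1))" "recfn n F" "recfn n G"
  shows "recfn n (\<lambda>xs. f (F xs) (G xs))"
  using recfn_comp[of "[F, G]" "\<lambda>xs. f (xs ! 0) (xs ! 1)" n] assms by (simp add: numeral_2_eq_2)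

lemma recfn_Suc [rec_intro]: "recfn n F \<Longrightarrow> recfn n (\<lambda>xs. Suc (F xs))"
proof (rule recfn_app1[where f = Suc])
  show "recfn 1 (\<lambda>xs. Suc (xs ! 0))" unfolding recfn_def using recursive.succ by blast
qed

lemma recfn_const [rec_intro]: "recfn n (\<lambda>xs. c)"
proof (induction c)
  case 0
  show ?case unfolding recfn_def using recursive.zero by blast
qed (rule recfn_Suc)

text \<open>
  Unlike in the basic scheme, the number of steps may be any recursive function of the arguments
  and the step may use all of them; a composition that repeats the arguments achieves this.
\<close>

lemma recfn_rec_nat [rec_intro]:
  assumes G: "recfn n G" and H: "recfn (Suc (Suc n)) (\<lambda>zs. H (zs ! 0) (zs ! 1) (drop 2 zs))"
    and U: "recfn n U"
  shows "recfn n (\<lambda>xs. rec_nat (G xs) (\<lambda>y r. H y r xs) (U xs))"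
proof -
  obtain g where g: "recursive n g" "\<And>xs. length xs = n \<Longrightarrow> G xs = g xs"
    using G unfolding recfn_def by blast
  obtain h where h: "recursive (Suc (Suc n)) h"
    "\<And>zs. length zs = Suc (Suc n) \<Longrightarrow> H (zs ! 0) (zs ! 1) (drop 2 zs) = h zs"
    using H unfolding recfn_def by blast
  define F where "F = (\<lambda>xs. rec_nat (g (tl xs)) (\<lambda>y r. h (y # r # tl xs)) (hd xs))"
  have F: "recfn (Suc n) F"
    unfolding recfn_def F_def using recursive.prim_rec[OF g(1) h(1)] by blast
  define ps where "ps = U # map (\<lambda>i xs. xs ! i) [0..<n]"
  have "recfn n (\<lambda>xs. F (map (\<lambda>h. h xs) ps))"
    by (rule recfn_comp) (use F U in \<open>auto simp: ps_def intro: recfn_proj\<close>)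
  moreover have "F (map (\<lambda>h. h xs) ps) = rec_nat (G xs) (\<lambda>y r. H y r xs) (U xs)"
    if "length xs = n" for xs
  proof -
    have "map (\<lambda>h. h xs) ps = U xs # xs"
      using that by (auto simp: ps_def comp_def map_nth)
    moreover have "h (y # r # xs) = H y r xs" for y r
      using h(2)[of "y # r # xs"] that by simp
    ultimately show ?thesis using g(2)[OF that] by (simp add: F_def)
  qed
  ultimately show ?thesis using recfn_cong by (metis (no_types, lifting))
qed

lemma recfn_Least:
  assumes f: "recfn (Suc n) (\<lambda>zs. f (zs ! 0) (drop 1 zs))"
    and ex: "\<And>xs. length xs = n \<Longrightarrow> \<exists>y. f y xs = 0"
  shows "recfn n (\<lambda>xs. LEAST y. f y xs = 0)"
proof -
  obtain g where g: "recursive (Suc n) g"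
    "\<And>zs. length zs = Suc n \<Longrightarrow> f (zs ! 0) (drop 1 zs) = g zs"
    using f unfolding recfn_def by blast
  have eq: "f y xs = g (y # xs)" if "length xs = n" for y xs
    using g(2)[of "y # xs"] that by simp
  have "recursive n (\<lambda>xs. LEAST y. g (y # xs) = 0)"
    by (rule recursive.mu) (use g(1) ex eq in auto)
  then show ?thesis unfolding recfn_def using eq by (intro exI conjI) auto
qed

lemma recfn_if0 [rec_intro]:
  assumes "recfn n F" "recfn n G" "recfn n H"
  shows "recfn n (\<lambda>xs. if F xs = 0 then G xs else H xs)"
proof -
  have "recfn (Suc (Suc (Suc 0))) (\<lambda>ys. rec_nat (ys ! 1) (\<lambda>_ _. ys ! 2) (ys ! 0))"
    by (intro rec_intro) auto
  then have "recfn n (\<lambda>xs. rec_nat (G xs) (\<lambda>_ _. H xs) (F xs))"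
    using recfn_comp[of "[F, G, H]" "\<lambda>ys. rec_nat (ys ! 1) (\<lambda>_ _. ys ! 2) (ys ! 0)" n] assms
    by (simp add: numeral_2_eq_2)
  moreover have "rec_nat (G xs) (\<lambda>_ _. H xs) (F xs) = (if F xs = 0 then G xs else H xs)" for xs
    by (cases "F xs") auto
  ultimately show ?thesis by simp
qed

lemma recfn_If [rec_intro]:
  assumes "recpred n P" "recfn n G" "recfn n H"
  shows "recfn n (\<lambda>xs. if P xs then G xs else H xs)"
proof -
  have "(\<lambda>xs. if P xs then G xs else H xs) =
      (\<lambda>xs. if (if P xs then 1 else 0 :: nat) = 0 then H xs else G xs)" by auto
  then show ?thesis using assms unfolding recpred_def by (auto intro: recfn_if0)
qed

lemma recpred_eq0: "recfn n F \<Longrightarrow> recpred n (\<lambda>xs. F xs = 0)"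
  unfolding recpred_def by (intro rec_intro)

lemma recfn_add [rec_intro]:
  assumes "recfn n F" "recfn n G"
  shows "recfn n (\<lambda>xs. F xs + G xs)"
proof (rule recfn_app2[where f = "(+)"])
  have "rec_nat a (\<lambda>_. Suc) b = a + b" for a b by (induction b) auto
  moreover have "recfn 2 (\<lambda>xs. rec_nat (xs ! 0) (\<lambda>y r. Suc r) (xs ! 1))"
    by (intro rec_intro) auto
  ultimately show "recfn 2 (\<lambda>xs. xs ! 0 + xs ! 1)" by simp
qed (use assms in auto)

lemma recfn_diff [rec_intro]:
  assumes "recfn n F" "recfn n G"
  shows "recfn n (\<lambda>xs. F xs - G xs)"
proof (rule recfn_app2[where f = "(-)"])
  have "recfn 1 (\<lambda>xs. rec_nat 0 (\<lambda>y r. y) (xs ! 0))"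
    by (intro rec_intro) auto
  moreover have "rec_nat 0 (\<lambda>y r. y) a = a - 1" for a :: nat by (cases a) auto
  ultimately have pred: "recfn 1 (\<lambda>xs. xs ! 0 - 1)" by simp
  have "rec_nat a (\<lambda>_ r. r - 1) b = a - b" for a b :: nat by (induction b) auto
  moreover have "recfn 2 (\<lambda>xs. rec_nat (xs ! 0) (\<lambda>y r. r - 1) (xs ! 1))"
    by (intro rec_intro recfn_app1[OF pred]) auto
  ultimately show "recfn 2 (\<lambda>xs. xs ! 0 - xs ! 1)" by simp
qed (use assms in auto)

lemma recpred_le [rec_intro]:
  assumes "recfn n F" "recfn n G"
  shows "recpred n (\<lambda>xs. F xs \<le> G xs)"
  using recpred_eq0[OF recfn_diff[OF assms]] by simp

lemma recpred_not [rec_intro]: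
  assumes "recpred n P"
  shows "recpred n (\<lambda>xs. \<not> P xs)"
proof -
  have "recfn n (\<lambda>xs. if P xs then 0 else 1)" by (intro rec_intro assms)
  moreover have "(\<lambda>xs. if P xs then 0 else 1) = (\<lambda>xs. if \<not> P xs then 1 else (0::nat))" by auto
  ultimately show ?thesis unfolding recpred_def by simp
qed

lemma recpred_conj [rec_intro]:
  assumes "recpred n P" "recpred n Q"
  shows "recpred n (\<lambda>xs. P xs \<and> Q xs)"
proof -
  have "recfn n (\<lambda>xs. if P xs then (if Q xs then 1 else 0) else 0)" by (intro rec_intro assms)
  moreover have "(\<lambda>xs. if P xs then (if Q xs then 1 else 0) else 0) =
      (\<lambda>xs. if P xs \<and> Q xs then 1 else (0::nat))" by auto
  ultimately show ?thesis unfolding recpred_def by simp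
qed

lemma recpred_less [rec_intro]:
  assumes "recfn n F" "recfn n G"
  shows "recpred n (\<lambda>xs. F xs < G xs)"
  using recpred_not[OF recpred_le[OF assms(2,1)]] by (simp add: not_le)

lemma recpred_eq [rec_intro]:
  assumes "recfn n F" "recfn n G"
  shows "recpred n (\<lambda>xs. F xs = G xs)"
  using recpred_conj[OF recpred_le[OF assms] recpred_le[OF assms(2,1)]]
  by (simp add: eq_iff)

lemma recfn_computable_fun:
  "computable_fun f \<longleftrightarrow> recfn 1 (\<lambda>xs. f (xs ! 0))"
proof
  assume "computable_fun f"
  then obtain g where "recursive 1 g" "\<And>x. f x = g [x]" unfolding computable_fun_def by blast
  then show "recfn 1 (\<lambda>xs. f (xs ! 0))"
    unfolding recfn_def by (intro exI[of _ g]) (auto simp: length_Suc_conv)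
next
  assume "recfn 1 (\<lambda>xs. f (xs ! 0))"
  then obtain g where "recursive 1 g" "\<And>xs. length xs = 1 \<Longrightarrow> f (xs ! 0) = g xs"
    unfolding recfn_def by blast
  then show "computable_fun f"
    unfolding computable_fun_def by (intro exI[of _ g]) (metis length_Cons list.size(3) nth_Cons_0 One_nat_def)
qed

lemma computable_rel_iff:
  "computable_rel R \<longleftrightarrow> recpred 2 (\<lambda>xs. R (xs ! 0) (xs ! 1))"
proof
  assume "computable_rel R"
  then obtain g where "recursive 2 g" "\<And>x y. g [x, y] = (if R x y then 1 else 0)"
    unfolding computable_rel_def by blast
  then show "recpred 2 (\<lambda>xs. R (xs ! 0) (xs ! 1))"
    unfolding recpred_def recfn_def by (intro exI[of _ g]) (auto simp: length_Suc_conv numeral_2_eq_2)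
next
  assume "recpred 2 (\<lambda>xs. R (xs ! 0) (xs ! 1))"
  then obtain g where g: "recursive 2 g"
    "\<And>xs. length xs = 2 \<Longrightarrow> (if R (xs ! 0) (xs ! 1) then 1 else 0) = g xs"
    unfolding recpred_def recfn_def by blast
  have "g [x, y] = (if R x y then 1 else 0)" for x y
    using g(2)[of "[x, y]"] by simp
  then show "computable_rel R" unfolding computable_rel_def using g(1) by blast
qed

lemma recpred_computable_set:
  assumes "computable_set A" "recfn n F"
  shows "recpred n (\<lambda>xs. F xs \<in> A)"
  using recfn_app1[OF _ assms(2), of "\<lambda>x. if x \<in> A then 1 else 0"] assms(1)
  unfolding recpred_def computable_set_def recfn_computable_fun by simp

subsection \<open>Pairs and lists\<close>

abbreviation pe :: "nat \<Rightarrow> nat \<Rightarrow> nat" where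
  "pe x y \<equiv> prod_encode (x, y)"

abbreviation pfst :: "nat \<Rightarrow> nat" where
  "pfst z \<equiv> fst (prod_decode z)"

abbreviation psnd :: "nat \<Rightarrow> nat" where
  "psnd z \<equiv> snd (prod_decode z)"

lemma recfn_triangle: "recfn n F \<Longrightarrow> recfn n (\<lambda>xs. triangle (F xs))"
proof (rule recfn_app1[where f = triangle])
  have "rec_nat 0 (\<lambda>y r. r + Suc y) a = triangle a" for a by (induction a) auto
  moreover have "recfn 1 (\<lambda>xs. rec_nat 0 (\<lambda>y r. r + Suc y) (xs ! 0))"
    by (intro rec_intro) auto
  ultimately show "recfn 1 (\<lambda>xs. triangle (xs ! 0))" by simp
qed

lemma recfn_pe [rec_intro]: "recfn n F \<Longrightarrow> recfn n G \<Longrightarrow> recfn n (\<lambda>xs. pe (F xs) (G xs))"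
  unfolding prod_encode_def by (simp add: rec_intro recfn_triangle)

lemma triangle_mono: "m \<le> n \<Longrightarrow> triangle m \<le> triangle n"
  by (simp add: lift_Suc_mono_le)

text \<open>
  A pair code lies in the block of its diagonal, which starts at a triangular number; hence the
  diagonal, and with it both components, are found by a search.
\<close>

lemma triangle_diagonal: "triangle (pfst z + psnd z) + pfst z = z"
proof -
  have "triangle (pfst z + psnd z) + pfst z = pe (pfst z) (psnd z)"
    by (simp add: prod_encode_def del: prod_decode_inverse prod.collapse)
  then show ?thesis by simp
qed

lemma diagonal_Least:
  "(LEAST s. z < triangle (Suc s)) = pfst z + psnd z"
proof -
  obtain m n where mn: "prod_decode z = (m, n)" by fastforce
  then have z: "z = triangle (m + n) + m" using triangle_diagonal[of z] by simp
  have "(LEAST s. z < triangle (Suc s)) = m + n"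
  proof (rule Least_equality)
    fix s assume s: "z < triangle (Suc s)"
    show "m + n \<le> s"
    proof (rule ccontr)
      assume "\<not> m + n \<le> s"
      then have "triangle (Suc s) \<le> triangle (m + n)" by (intro triangle_mono) simp
      then show False using s z by simp
    qed
  qed (simp add: z)
  then show ?thesis by (simp add: mn)
qed

lemma recfn_diagonal: "recfn 1 (\<lambda>xs. pfst (xs ! 0) + psnd (xs ! 0))"
proof -
  have "recfn 1 (\<lambda>xs. LEAST s. (if xs ! 0 < triangle (Suc s) then 0 else 1::nat) = 0)"
  proof (rule recfn_Least)
    show "recfn (Suc 1) (\<lambda>zs. if drop 1 zs ! 0 < triangle (Suc (zs ! 0)) then 0 else 1)"
      by (intro rec_intro recfn_triangle) simp_all
    fix xs :: "nat list"
    have "xs ! 0 < triangle (Suc (xs ! 0))" by simp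
    then show "\<exists>y. (if xs ! 0 < triangle (Suc y) then 0 else 1::nat) = 0" by metis
  qed
  moreover have "(LEAST s. (if z < triangle (Suc s) then 0 else 1::nat) = 0) = pfst z + psnd z" for z
    using diagonal_Least[of z] by (simp del: triangle_Suc)
  ultimately show ?thesis by (simp del: triangle_Suc)
qed

lemma recfn_pfst [rec_intro]: "recfn n F \<Longrightarrow> recfn n (\<lambda>xs. pfst (F xs))"
proof (rule recfn_app1[where f = pfst])
  have "recfn 1 (\<lambda>xs. xs ! 0 - triangle (pfst (xs ! 0) + psnd (xs ! 0)))"
    by (intro recfn_diff recfn_triangle recfn_diagonal recfn_proj) simp
  moreover have "z - triangle (pfst z + psnd z) = pfst z" for z
    using triangle_diagonal[of z] by linarith
  ultimately show "recfn 1 (\<lambda>xs. pfst (xs ! 0))" by simp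
qed

lemma recfn_psnd [rec_intro]: "recfn n F \<Longrightarrow> recfn n (\<lambda>xs. psnd (F xs))"
proof (rule recfn_app1[where f = psnd])
  have "recfn 1 (\<lambda>xs. pfst (xs ! 0) + psnd (xs ! 0) - pfst (xs ! 0))"
    by (intro recfn_diff recfn_diagonal rec_intro) simp
  then show "recfn 1 (\<lambda>xs. psnd (xs ! 0))" by simp
qed

lemma prod_decode_0 [simp]: "prod_decode 0 = (0, 0)"
  by (simp add: prod_decode_def prod_decode_aux.simps)

lemma pe_less: "m + n < m' + n' \<Longrightarrow> pe m n < pe m' n'"
proof -
  assume "m + n < m' + n'"
  then have "triangle (Suc (m + n)) \<le> triangle (m' + n')" by (intro triangle_mono) simp
  then show ?thesis by (simp add: prod_encode_def)
qed

text \<open>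
  Past the end of a list the tail and the entries are \<open>0\<close>, because \<open>0\<close> decodes to the pair of zeros.
\<close>

definition ltl :: "nat \<Rightarrow> nat" where "ltl c = psnd (c - 1)"

definition lnth :: "nat \<Rightarrow> nat \<Rightarrow> nat" where "lnth c i = pfst ((ltl ^^ i) c - 1)"

definition llen :: "nat \<Rightarrow> nat" where "llen c = (LEAST i. (ltl ^^ i) c = 0)"

lemma recfn_iterate_ltl:
  assumes "recfn n F" "recfn n G"
  shows "recfn n (\<lambda>xs. (ltl ^^ F xs) (G xs))"
proof -
  have "rec_nat c (\<lambda>y r. psnd (r - 1)) i = (ltl ^^ i) c" for c i
    by (induction i) (auto simp: ltl_def)
  moreover have "recfn n (\<lambda>xs. rec_nat (G xs) (\<lambda>y r. psnd (r - 1)) (F xs))"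
    by (intro rec_intro assms) auto
  ultimately show ?thesis by simp
qed

lemma recfn_lnth [rec_intro]:
  assumes "recfn n F" "recfn n G"
  shows "recfn n (\<lambda>xs. lnth (F xs) (G xs))"
  unfolding lnth_def by (intro rec_intro recfn_iterate_ltl assms)

lemma ltl_Cons [simp]: "ltl (Suc (pe x c)) = c"
  by (simp add: ltl_def)

lemma iterate_ltl_0 [simp]: "(ltl ^^ i) 0 = 0"
  by (induction i) (auto simp: ltl_def)

lemma lnth_Suc: "lnth c (Suc i) = lnth (ltl c) i"
  by (simp add: lnth_def funpow_swap1)

lemma lnth_Cons_0 [simp]: "lnth (Suc (pe x c)) 0 = x"
  by (simp add: lnth_def)

lemma lnth_list_encode: "lnth (list_encode xs) i = (if i < length xs then xs ! i else 0)"
proof (induction xs arbitrary: i)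
  case Nil
  show ?case by (simp add: lnth_def)
next
  case (Cons x xs)
  then show ?case by (cases i) (auto simp: lnth_Suc)
qed

lemma iterate_ltl_list_encode: "(ltl ^^ i) (list_encode xs) = list_encode (drop i xs)"
proof (induction xs arbitrary: i)
  case (Cons x xs)
  then show ?case by (cases i) (auto simp: funpow_swap1)
qed simp

lemma list_encode_eq_0 [simp]: "list_encode xs = 0 \<longleftrightarrow> xs = []"
  by (cases xs) auto

lemma llen_list_encode [simp]: "llen (list_encode xs) = length xs"
  unfolding llen_def by (auto simp: iterate_ltl_list_encode intro!: Least_equality)

lemma recfn_llen [rec_intro]:
  assumes "recfn n F"
  shows "recfn n (\<lambda>xs. llen (F xs))"
proof (rule recfn_app1[OF _ assms])
  show "recfn 1 (\<lambda>xs. llen (xs ! 0))"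
    unfolding llen_def
  proof (rule recfn_Least)
    show "recfn (Suc 1) (\<lambda>zs. (ltl ^^ zs ! 0) (drop 1 zs ! 0))"
      by (intro recfn_iterate_ltl rec_intro) simp_all
    fix xs :: "nat list"
    show "\<exists>y. (ltl ^^ y) (xs ! 0) = 0"
      by (metis iterate_ltl_list_encode drop_all list_decode_inverse order_refl list_encode_eq_0)
  qed
qed

text \<open>
  Course-of-values recursion: \<open>cov H z\<close> applies \<open>H\<close> to \<open>z\<close> and the code of the list of all the
  previous values, latest first.
\<close>

definition cov_history :: "(nat \<Rightarrow> nat \<Rightarrow> nat) \<Rightarrow> nat \<Rightarrow> nat" where
  "cov_history H = rec_nat 0 (\<lambda>z r. Suc (pe (H z r) r))"

definition cov :: "(nat \<Rightarrow> nat \<Rightarrow> nat) \<Rightarrow> nat \<Rightarrow> nat" where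
  "cov H z = H z (cov_history H z)"

lemma lnth_cov_history: "w < z \<Longrightarrow> lnth (cov_history H z) (z - Suc w) = cov H w"
proof (induction z)
  case (Suc z)
  show ?case
  proof (cases "w = z")
    case False
    then have "Suc z - Suc w = Suc (z - Suc w)" using Suc.prems by simp
    then show ?thesis using Suc False by (simp add: cov_history_def lnth_Suc)
  qed (simp add: cov_history_def cov_def)
qed simp

lemma recfn_cov:
  assumes H: "recfn (Suc (Suc n)) (\<lambda>zs. H (drop 2 zs) (zs ! 0) (zs ! 1))" and U: "recfn n U"
  shows "recfn n (\<lambda>xs. cov (H xs) (U xs))"
proof -
  have hist: "recfn n (\<lambda>xs. cov_history (H xs) (U xs))"
    unfolding cov_history_def
    by (intro recfn_rec_nat[where H = "\<lambda>z r xs. Suc (pe (H xs z r) r)"] rec_intro H U) simp_all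
  define ps where "ps = U # (\<lambda>xs. cov_history (H xs) (U xs)) # map (\<lambda>i xs. xs ! i) [0..<n]"
  have "recfn n (\<lambda>xs. (\<lambda>zs. H (drop 2 zs) (zs ! 0) (zs ! 1)) (map (\<lambda>h. h xs) ps))"
    by (rule recfn_comp) (use H U hist in \<open>auto simp: ps_def intro: recfn_proj\<close>)
  moreover have "map (\<lambda>h. h xs) ps = U xs # cov_history (H xs) (U xs) # xs" if "length xs = n" for xs
    using that by (auto simp: ps_def comp_def map_nth)
  ultimately show ?thesis
    unfolding cov_def by (subst recfn_cong[of n _ "\<lambda>xs. H (drop 2 (map (\<lambda>h. h xs) ps))
      (map (\<lambda>h. h xs) ps ! 0) (map (\<lambda>h. h xs) ps ! 1)"]) auto
qed

section \<open>Unary recursive functions on codes of pairs\<close>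

text \<open>
  Recursive functions of any number of arguments reduce to unary ones on codes of pairs.  As the
  graph of a unary function is a binary relation, the defining equation of each operation
  becomes a first-order sentence with a fixed number of variables.
\<close>

datatype rterm = RZero | RSucc | RFst | RSnd | RPair rterm rterm | RComp rterm rterm
  | RRec rterm rterm | RMin rterm

instance rterm :: countable by countable_datatype

primrec reval :: "rterm \<Rightarrow> nat \<Rightarrow> nat" where
  "reval RZero x = 0"
| "reval RSucc x = Suc x"
| "reval RFst x = pfst x"
| "reval RSnd x = psnd x"
| "reval (RPair f g) x = pe (reval f x) (reval g x)"
| "reval (RComp f g) x = reval f (reval g x)"
| "reval (RRec g h) x =
     rec_nat (reval g (psnd x)) (\<lambda>v r. reval h (pe v (pe r (psnd x)))) (pfst x)"
| "reval (RMin g) x = (LEAST y. reval g (pe y x) = 0)"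

primrec regular :: "rterm \<Rightarrow> bool" where
  "regular RZero \<longleftrightarrow> True"
| "regular RSucc \<longleftrightarrow> True"
| "regular RFst \<longleftrightarrow> True"
| "regular RSnd \<longleftrightarrow> True"
| "regular (RPair f g) \<longleftrightarrow> regular f \<and> regular g"
| "regular (RComp f g) \<longleftrightarrow> regular f \<and> regular g"
| "regular (RRec g h) \<longleftrightarrow> regular g \<and> regular h"
| "regular (RMin g) \<longleftrightarrow> regular g \<and> (\<forall>x. \<exists>y. reval g (pe y x) = 0)"

text \<open>
  Every number is read as a list of arguments of length \<open>n\<close>, ignoring the last component.  So a
  search that succeeds for all lists of this length succeeds for all numbers, as \<open>regular\<close>
  demands.
\<close>

primrec args_of :: "nat \<Rightarrow> nat \<Rightarrow> nat list" where
  "args_of 0 x = []"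
| "args_of (Suc n) x = pfst x # args_of n (psnd x)"

lemma length_args_of [simp]: "length (args_of n x) = n"
  by (induction n arbitrary: x) auto

lemma rterm_proj: "i < n \<Longrightarrow> \<exists>t. regular t \<and> (\<forall>x. reval t x = args_of n x ! i)"
proof (induction n arbitrary: i)
  case (Suc n)
  show ?case
  proof (cases i)
    case 0
    then show ?thesis by (intro exI[of _ RFst]) simp
  next
    case (Suc j)
    then obtain t where "regular t" "\<forall>x. reval t x = args_of n x ! j" using Suc.IH Suc.prems by auto
    then show ?thesis using Suc by (intro exI[of _ "RComp t RSnd"]) simp
  qed
qed simp

lemma recursive_imp_rterm:
  "recursive n f \<Longrightarrow> \<exists>t. regular t \<and> (\<forall>x. reval t x = f (args_of n x))"
proof (induction rule: recursive.induct)
  case (zero n)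
  show ?case by (intro exI[of _ RZero]) simp
next
  case succ
  show ?case by (intro exI[of _ "RComp RSucc RFst"]) simp
next
  case (proj i n)
  then show ?case by (rule rterm_proj)
next
  case (comp hs g n)
  obtain t where t: "regular t" "\<forall>x. reval t x = g (args_of (length hs) x)" using comp by blast
  have "\<exists>s. regular s \<and> (\<forall>x. args_of (length hs) (reval s x) = map (\<lambda>h. h (args_of n x)) hs)"
    using comp(3)
  proof (induction hs)
    case Nil
    show ?case by (intro exI[of _ RZero]) simp
  next
    case (Cons h hs)
    then obtain s u where "regular s" "\<forall>x. args_of (length hs) (reval s x) = map (\<lambda>h. h (args_of n x)) hs"
      "regular u" "\<forall>x. reval u x = h (args_of n x)" by auto
    then show ?case by (intro exI[of _ "RPair u s"]) simp
  qed
  then obtain s where "regular s" "\<forall>x. args_of (length hs) (reval s x) = map (\<lambda>h. h (args_of n x)) hs"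
    by blast
  then show ?case using t by (intro exI[of _ "RComp t s"]) simp
next
  case (prim_rec n g h)
  then obtain s t where "regular s" "\<forall>x. reval s x = g (args_of n x)"
    "regular t" "\<forall>x. reval t x = h (args_of (Suc (Suc n)) x)" by blast
  then show ?case by (intro exI[of _ "RRec s t"]) simp
next
  case (mu n f)
  then obtain s where "regular s" "\<forall>x. reval s x = f (args_of (Suc n) x)" by blast
  moreover have "\<exists>y. f (y # args_of n x) = 0" for x using mu(2) by simp
  ultimately show ?case by (intro exI[of _ "RMin s"]) simp
qed

lemma recfn_imp_rterm:
  assumes "recfn 1 (\<lambda>xs. f (xs ! 0))"
  obtains t where "regular t" "\<And>x. reval t x = f x"
proof -
  obtain g where "recursive 1 g" "\<And>x. f x = g [x]"
    using assms recfn_computable_fun unfolding computable_fun_def by blast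
  moreover from this obtain t where "regular t" "\<And>x. reval t x = g (args_of 1 x)"
    using recursive_imp_rterm by blast
  ultimately have "regular (RComp t (RPair (RPair RFst RSnd) RZero))"
    "reval (RComp t (RPair (RPair RFst RSnd) RZero)) x = f x" for x
    by simp_all
  then show thesis using that by blast
qed

section \<open>Semantics of the language \<open>S\<close>\<close>

primrec ssat :: "'a set \<Rightarrow> (nat \<Rightarrow> 'a list \<Rightarrow> bool) \<Rightarrow> (nat \<Rightarrow> 'a) \<Rightarrow> sfm \<Rightarrow> bool" where
  "ssat D I e SBot \<longleftrightarrow> False"
| "ssat D I e (SRel i vs) \<longleftrightarrow> I i (map e vs)"
| "ssat D I e (SImp p q) \<longleftrightarrow> (ssat D I e p \<longrightarrow> ssat D I e q)"
| "ssat D I e (SAll p) \<longleftrightarrow> (\<forall>x\<in>D. ssat D I (case_nat x e) p)"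

lemma ssat_cong: "(\<And>n. n \<in> sfv p \<Longrightarrow> e n = e' n) \<Longrightarrow> ssat D I e p = ssat D I e' p"
proof (induction p arbitrary: e e')
  case (SRel i vs)
  then have "map e vs = map e' vs" by auto
  then show ?case by (simp del: map_eq_conv)
next
  case (SImp p q)
  then have "ssat D I e p = ssat D I e' p" "ssat D I e q = ssat D I e' q"
    by (metis UnCI sfv.simps(3))+
  then show ?case by simp
next
  case (SAll p)
  have "ssat D I (case_nat x e) p = ssat D I (case_nat x e') p" for x
    using SAll.prems by (intro SAll.IH) (auto split: nat.split)
  then show ?case by simp
qed simp

text \<open>
  \<open>S\<close> has no identity, so truth is preserved under preimages along any surjective map.
\<close>

lemma ssat_surj:
  assumes "h ` D = D'" "\<And>i xs. set xs \<subseteq> D \<Longrightarrow> I i xs \<longleftrightarrow> I' i (map h xs)" "range e \<subseteq> D"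
  shows "ssat D I e p \<longleftrightarrow> ssat D' I' (h \<circ> e) p"
  using assms(3)
proof (induction p arbitrary: e)
  case (SRel i vs)
  then have "set (map e vs) \<subseteq> D" by auto
  from assms(2)[OF this] show ?case by (simp add: comp_def)
next
  case (SAll p)
  have "h \<circ> case_nat x e = case_nat (h x) (h \<circ> e)" for x
    by (auto split: nat.split)
  moreover have "ssat D I (case_nat x e) p = ssat D' I' (h \<circ> case_nat x e) p" if "x \<in> D" for x
    using SAll.prems that by (intro SAll.IH) (auto split: nat.splits simp: range_subsetD)
  ultimately show ?case unfolding ssat.simps assms(1)[symmetric] by simp
qed auto

abbreviation SNeg :: "sfm \<Rightarrow> sfm" where "SNeg p \<equiv> SImp p SBot"
definition SAnd :: "sfm \<Rightarrow> sfm \<Rightarrow> sfm" where "SAnd p q = SNeg (SImp p (SNeg q))"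
definition SOr :: "sfm \<Rightarrow> sfm \<Rightarrow> sfm" where "SOr p q = SImp (SNeg p) q"
definition SIff :: "sfm \<Rightarrow> sfm \<Rightarrow> sfm" where "SIff p q = SAnd (SImp p q) (SImp q p)"
definition SEx :: "sfm \<Rightarrow> sfm" where "SEx p = SNeg (SAll (SNeg p))"

lemma ssat_connectives [simp]:
  "ssat D I e (SAnd p q) \<longleftrightarrow> ssat D I e p \<and> ssat D I e q"
  "ssat D I e (SOr p q) \<longleftrightarrow> ssat D I e p \<or> ssat D I e q"
  "ssat D I e (SIff p q) \<longleftrightarrow> (ssat D I e p \<longleftrightarrow> ssat D I e q)"
  "ssat D I e (SEx p) \<longleftrightarrow> (\<exists>x\<in>D. ssat D I (case_nat x e) p)"
  by (auto simp: SAnd_def SOr_def SIff_def SEx_def)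

lemma sfv_connectives [simp]:
  "sfv (SAnd p q) = sfv p \<union> sfv q"
  "sfv (SOr p q) = sfv p \<union> sfv q"
  "sfv (SIff p q) = sfv p \<union> sfv q"
  "sfv (SEx p) = {n. Suc n \<in> sfv p}"
  by (auto simp: SAnd_def SOr_def SIff_def SEx_def)


section \<open>Arithmetic on a weak order\<close>

text \<open>
  The symbols are those of a strict weak order \<open>sLt\<close>, whose incomparability takes the place of the
  missing identity; the graph \<open>sP\<close> of the pairing function, value last; the graph \<open>sG t\<close> of
  the recursive function denoted by \<open>t\<close>; and a unary predicate \<open>sU\<close>.
\<close>

definition sLt :: "nat \<Rightarrow> nat \<Rightarrow> sfm" where "sLt x y = SRel 0 [x, y]"
definition sP :: "nat \<Rightarrow> nat \<Rightarrow> nat \<Rightarrow> sfm" where "sP x y z = SRel 0 [x, y, z]"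
definition sU :: "nat \<Rightarrow> sfm" where "sU x = SRel 0 [x]"
definition sG :: "rterm \<Rightarrow> nat \<Rightarrow> nat \<Rightarrow> sfm" where "sG t x y = SRel (Suc (to_nat t)) [x, y]"

definition sZero :: "nat \<Rightarrow> sfm" where "sZero x = SAll (SNeg (sLt 0 (Suc x)))"

definition sSucc :: "nat \<Rightarrow> nat \<Rightarrow> sfm" where
  "sSucc x y = SAnd (sLt x y) (SAll (SImp (sLt (Suc x) 0) (SNeg (sLt 0 (Suc y)))))"

text \<open>
  Finite initial segments have to satisfy the axioms, so a successor is demanded only for elements
  that are not maximal.
\<close>

definition order_axioms :: "sfm list" where
  "order_axioms =
   [SAll (SNeg (sLt 0 0)),
    SAll (SAll (SAll (SImp (sLt 0 1) (SImp (sLt 1 2) (sLt 0 2))))),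
    SAll (SAll (SAll (SImp (sLt 0 2) (SOr (sLt 0 1) (sLt 1 2))))),
    SEx (sZero 0),
    SAll (SAll (SImp (sLt 1 0) (SEx (sSucc 2 0))))]"

text \<open>
  The first two axioms determine the pairs coded by standard numbers by recursion on the code.
  They say nothing about a nonstandard number that might also code a pair of standard ones; the
  last axiom excludes it by making codes unique.
\<close>

definition pairing_axioms :: "sfm list" where
  "pairing_axioms =
   [SAll (SAll (SAll (SImp (sZero 0) (SIff (sP 2 1 0) (SAnd (sZero 2) (sZero 1)))))),
    SAll (SAll (SAll (SAll (SImp (sSucc 1 0) (SIff (sP 3 2 0)
      (SEx (SEx (SAnd (sP 1 0 3)
        (SOr (SAnd (sZero 0) (SAnd (sZero 5) (sSucc 1 4)))
          (SAnd (SNeg (sZero 0)) (SAnd (sSucc 1 5) (sSucc 4 0)))))))))))),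
    SAll (SAll (SAll (SAll (SAll (SAll (SImp (sP 5 4 3) (SImp (sP 2 1 0) (SImp (sLt 3 0)
      (SOr (SOr (sLt 5 2) (sLt 2 5)) (SOr (sLt 4 1) (sLt 1 4)))))))))))]"

text \<open>
  The defining equations with the argument at index \<open>1\<close> and the value at index \<open>0\<close>.  All intermediate
  values are required to exist; hence an equivalence with the graph can hold in finite structures
  too, where some computations are cut off.
\<close>

primrec graph_clause :: "rterm \<Rightarrow> sfm" where
  "graph_clause RZero = sZero 0"
| "graph_clause RSucc = sSucc 1 0"
| "graph_clause RFst = SEx (sP 1 0 2)"
| "graph_clause RSnd = SEx (sP 0 1 2)"
| "graph_clause (RPair f g) = SEx (SEx (SAnd (sG f 3 1) (SAnd (sG g 3 0) (sP 1 0 2))))"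
| "graph_clause (RComp f g) = SEx (SAnd (sG g 2 0) (sG f 0 1))"
| "graph_clause (RRec g h) = SEx (SEx (SAnd (sP 1 0 3) (SOr (SAnd (sZero 1) (sG g 0 2))
    (SEx (SEx (SEx (SEx (SEx (SAnd (sSucc 4 6) (SAnd (sP 4 5 3) (SAnd (sG (RRec g h) 3 2)
      (SAnd (sP 2 5 1) (SAnd (sP 4 1 0) (sG h 0 7))))))))))))))"
| "graph_clause (RMin g) = SAnd (SEx (SEx (SAnd (sP 2 3 1) (SAnd (sZero 0) (sG g 1 0)))))
    (SAll (SImp (sLt 0 1) (SEx (SEx (SAnd (sP 2 4 1) (SAnd (SNeg (sZero 0)) (sG g 1 0)))))))"

definition graph_axiom :: "rterm \<Rightarrow> sfm" where
  "graph_axiom t = SAll (SAll (SIff (sG t 1 0) (graph_clause t)))"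

primrec subterms :: "rterm \<Rightarrow> rterm list" where
  "subterms RZero = [RZero]"
| "subterms RSucc = [RSucc]"
| "subterms RFst = [RFst]"
| "subterms RSnd = [RSnd]"
| "subterms (RPair f g) = RPair f g # subterms f @ subterms g"
| "subterms (RComp f g) = RComp f g # subterms f @ subterms g"
| "subterms (RRec g h) = RRec g h # subterms g @ subterms h"
| "subterms (RMin g) = RMin g # subterms g"

text \<open>
  The pairing axioms follow the enumeration of the pairs by diagonals: the code \<open>z + 1\<close> belongs to
  the pair after the one with code \<open>z\<close>.
\<close>

lemma prod_decode_Suc: "prod_decode (Suc z) =
    (if psnd z = 0 then (0, Suc (pfst z)) else (Suc (pfst z), psnd z - 1))"
proof -
  have "pe (if psnd z = 0 then 0 else Suc (pfst z)) (if psnd z = 0 then Suc (pfst z) else psnd z - 1)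
      = Suc (pe (pfst z) (psnd z))"
    by (simp add: prod_encode_def del: prod_decode_inverse prod.collapse)
  then have "Suc z = pe (if psnd z = 0 then 0 else Suc (pfst z)) (if psnd z = 0 then Suc (pfst z) else psnd z - 1)"
    by simp
  then show ?thesis by simp
qed

lemma components_le: "pfst z \<le> z" "psnd z \<le> z"
  using le_prod_encode_1[of "pfst z" "psnd z"] le_prod_encode_2[of "psnd z" "pfst z"]
  by (simp_all only: prod.collapse prod_decode_inverse)

locale arith =
  fixes D :: "'a set" and I :: "nat \<Rightarrow> 'a list \<Rightarrow> bool"
begin

definition lt :: "'a \<Rightarrow> 'a \<Rightarrow> bool" where "lt a b \<longleftrightarrow> I 0 [a, b]"
definition P :: "'a \<Rightarrow> 'a \<Rightarrow> 'a \<Rightarrow> bool" where "P a b c \<longleftrightarrow> I 0 [a, b, c]"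
definition G :: "rterm \<Rightarrow> 'a \<Rightarrow> 'a \<Rightarrow> bool" where "G t a b \<longleftrightarrow> I (Suc (to_nat t)) [a, b]"
definition zero :: "'a \<Rightarrow> bool" where "zero a \<longleftrightarrow> (\<forall>z\<in>D. \<not> lt z a)"
definition succ :: "'a \<Rightarrow> 'a \<Rightarrow> bool" where
  "succ a b \<longleftrightarrow> lt a b \<and> (\<forall>z\<in>D. lt a z \<longrightarrow> \<not> lt z b)"

lemma ssat_symbols [simp]:
  "ssat D I e (sLt x y) \<longleftrightarrow> lt (e x) (e y)"
  "ssat D I e (sP x y z) \<longleftrightarrow> P (e x) (e y) (e z)"
  "ssat D I e (sG t x y) \<longleftrightarrow> G t (e x) (e y)"
  "ssat D I e (sU x) \<longleftrightarrow> I 0 [e x]"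
  "ssat D I e (sZero x) \<longleftrightarrow> zero (e x)"
  "ssat D I e (sSucc x y) \<longleftrightarrow> succ (e x) (e y)"
  by (auto simp: sLt_def sP_def sG_def sU_def sZero_def sSucc_def lt_def P_def G_def
      zero_def succ_def)

primrec clause :: "rterm \<Rightarrow> 'a \<Rightarrow> 'a \<Rightarrow> bool" where
  "clause RZero a b \<longleftrightarrow> zero b"
| "clause RSucc a b \<longleftrightarrow> succ a b"
| "clause RFst a b \<longleftrightarrow> (\<exists>c\<in>D. P b c a)"
| "clause RSnd a b \<longleftrightarrow> (\<exists>c\<in>D. P c b a)"
| "clause (RPair f g) a b \<longleftrightarrow> (\<exists>c\<in>D. \<exists>d\<in>D. G f a c \<and> G g a d \<and> P c d b)"
| "clause (RComp f g) a b \<longleftrightarrow> (\<exists>c\<in>D. G g a c \<and> G f c b)"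
| "clause (RRec g h) a b \<longleftrightarrow> (\<exists>u\<in>D. \<exists>p\<in>D. P u p a \<and> (zero u \<and> G g p b \<or>
    (\<exists>v\<in>D. \<exists>a'\<in>D. \<exists>r\<in>D. \<exists>w\<in>D. \<exists>w'\<in>D. succ v u \<and> P v p a' \<and> G (RRec g h) a' r \<and>
      P r p w \<and> P v w w' \<and> G h w' b)))"
| "clause (RMin g) a b \<longleftrightarrow> (\<exists>w\<in>D. \<exists>z\<in>D. P b a w \<and> zero z \<and> G g w z) \<and>
    (\<forall>c\<in>D. lt c b \<longrightarrow> (\<exists>w\<in>D. \<exists>v\<in>D. P c a w \<and> \<not> zero v \<and> G g w v))"

lemma ssat_graph_axiom:
  "ssat D I e (graph_axiom t) \<longleftrightarrow> (\<forall>a\<in>D. \<forall>b\<in>D. G t a b \<longleftrightarrow> clause t a b)"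
  unfolding graph_axiom_def
  by (cases t) (simp_all add: eval_nat_numeral)

lemma ssat_order_axioms:
  "list_all (ssat D I e) order_axioms \<longleftrightarrow>
   (\<forall>a\<in>D. \<not> lt a a) \<and>
   (\<forall>c\<in>D. \<forall>b\<in>D. \<forall>a\<in>D. lt a b \<longrightarrow> lt b c \<longrightarrow> lt a c) \<and>
   (\<forall>c\<in>D. \<forall>b\<in>D. \<forall>a\<in>D. lt a c \<longrightarrow> lt a b \<or> lt b c) \<and>
   (\<exists>z\<in>D. zero z) \<and>
   (\<forall>a\<in>D. \<forall>b\<in>D. lt a b \<longrightarrow> (\<exists>c\<in>D. succ a c))"
  by (simp add: order_axioms_def eval_nat_numeral)

lemma ssat_pairing_axioms:
  "list_all (ssat D I e) pairing_axioms \<longleftrightarrow>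
   (\<forall>a\<in>D. \<forall>b\<in>D. \<forall>c\<in>D. zero c \<longrightarrow> P a b c = (zero a \<and> zero b)) \<and>
   (\<forall>a\<in>D. \<forall>b\<in>D. \<forall>c\<in>D. \<forall>d\<in>D. succ c d \<longrightarrow> P a b d =
      (\<exists>m\<in>D. \<exists>n\<in>D. P m n c \<and> (zero n \<and> zero a \<and> succ m b \<or> \<not> zero n \<and> succ m a \<and> succ b n))) \<and>
   (\<forall>a\<in>D. \<forall>b\<in>D. \<forall>c\<in>D. \<forall>a'\<in>D. \<forall>b'\<in>D. \<forall>c'\<in>D.
      P a b c \<longrightarrow> P a' b' c' \<longrightarrow> lt c c' \<longrightarrow> (lt a a' \<or> lt a' a) \<or> (lt b b' \<or> lt b' b))"
  by (simp add: pairing_axioms_def eval_nat_numeral)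

text \<open>
  The elements that stand for the number \<open>k\<close>.  There may be several, incomparable in the order, or
  none if the order is too short.
\<close>

definition std :: "nat \<Rightarrow> 'a \<Rightarrow> bool" where
  "std k a \<longleftrightarrow> a \<in> D \<and> (\<exists>z\<in>D. zero z \<and> ((\<lambda>a b. a \<in> D \<and> b \<in> D \<and> succ a b) ^^ k) z a)"

lemma std_0: "std 0 a \<longleftrightarrow> a \<in> D \<and> zero a"
  by (auto simp: std_def)

lemma std_Suc: "std (Suc k) a \<longleftrightarrow> a \<in> D \<and> (\<exists>b\<in>D. std k b \<and> succ b a)"
  by (auto simp: std_def)

lemma std_D: "std k a \<Longrightarrow> a \<in> D"
  by (simp add: std_def)

end

locale weak_order_arith = arith +
  fixes e :: "nat \<Rightarrow> 'a"
  assumes order_axioms: "list_all (ssat D I e) order_axioms"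
    and pairing_axioms: "list_all (ssat D I e) pairing_axioms"
begin

lemma
  shows lt_irrefl: "a \<in> D \<Longrightarrow> \<not> lt a a"
    and lt_trans: "a \<in> D \<Longrightarrow> b \<in> D \<Longrightarrow> c \<in> D \<Longrightarrow> lt a b \<Longrightarrow> lt b c \<Longrightarrow> lt a c"
    and lt_split: "a \<in> D \<Longrightarrow> b \<in> D \<Longrightarrow> c \<in> D \<Longrightarrow> lt a c \<Longrightarrow> lt a b \<or> lt b c"
    and zero_ex: "\<exists>z\<in>D. zero z"
    and succ_ex: "a \<in> D \<Longrightarrow> b \<in> D \<Longrightarrow> lt a b \<Longrightarrow> \<exists>c\<in>D. succ a c"
proof -
  note order_axioms_iff = order_axioms[unfolded ssat_order_axioms]
  note ax = order_axioms_iff[THEN conjunct1]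
    order_axioms_iff[THEN conjunct2, THEN conjunct1]
    order_axioms_iff[THEN conjunct2, THEN conjunct2, THEN conjunct1]
    order_axioms_iff[THEN conjunct2, THEN conjunct2, THEN conjunct2]
  show "a \<in> D \<Longrightarrow> \<not> lt a a" using ax(1) by blast
  show "a \<in> D \<Longrightarrow> b \<in> D \<Longrightarrow> c \<in> D \<Longrightarrow> lt a b \<Longrightarrow> lt b c \<Longrightarrow> lt a c" using ax(2) by blast
  show "a \<in> D \<Longrightarrow> b \<in> D \<Longrightarrow> c \<in> D \<Longrightarrow> lt a c \<Longrightarrow> lt a b \<or> lt b c" using ax(3) by blast
  show "\<exists>z\<in>D. zero z" using ax(4) by blast
  show "a \<in> D \<Longrightarrow> b \<in> D \<Longrightarrow> lt a b \<Longrightarrow> \<exists>c\<in>D. succ a c" using ax(4) by blast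
qed

lemma
  shows P_zero: "a \<in> D \<Longrightarrow> b \<in> D \<Longrightarrow> c \<in> D \<Longrightarrow> zero c \<Longrightarrow> P a b c \<longleftrightarrow> zero a \<and> zero b"
    and P_succ: "a \<in> D \<Longrightarrow> b \<in> D \<Longrightarrow> c \<in> D \<Longrightarrow> d \<in> D \<Longrightarrow> succ c d \<Longrightarrow> P a b d \<longleftrightarrow>
      (\<exists>m\<in>D. \<exists>n\<in>D. P m n c \<and> (zero n \<and> zero a \<and> succ m b \<or> \<not> zero n \<and> succ m a \<and> succ b n))"
    and P_unique: "a \<in> D \<Longrightarrow> b \<in> D \<Longrightarrow> c \<in> D \<Longrightarrow> a' \<in> D \<Longrightarrow> b' \<in> D \<Longrightarrow> c' \<in> D \<Longrightarrow>
      P a b c \<Longrightarrow> P a' b' c' \<Longrightarrow> lt c c' \<Longrightarrow> (lt a a' \<or> lt a' a) \<or> (lt b b' \<or> lt b' b)"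
proof -
  note pairing_axioms_iff = pairing_axioms[unfolded ssat_pairing_axioms]
  note ax = pairing_axioms_iff[THEN conjunct1]
    pairing_axioms_iff[THEN conjunct2, THEN conjunct1]
    pairing_axioms_iff[THEN conjunct2, THEN conjunct2]
  show "a \<in> D \<Longrightarrow> b \<in> D \<Longrightarrow> c \<in> D \<Longrightarrow> zero c \<Longrightarrow> P a b c \<longleftrightarrow> zero a \<and> zero b"
    by (rule ax(1)[rule_format])
  show "a \<in> D \<Longrightarrow> b \<in> D \<Longrightarrow> c \<in> D \<Longrightarrow> d \<in> D \<Longrightarrow> succ c d \<Longrightarrow> P a b d \<longleftrightarrow>
      (\<exists>m\<in>D. \<exists>n\<in>D. P m n c \<and> (zero n \<and> zero a \<and> succ m b \<or> \<not> zero n \<and> succ m a \<and> succ b n))"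
    by (rule ax(2)[rule_format])
  show "a \<in> D \<Longrightarrow> b \<in> D \<Longrightarrow> c \<in> D \<Longrightarrow> a' \<in> D \<Longrightarrow> b' \<in> D \<Longrightarrow> c' \<in> D \<Longrightarrow>
      P a b c \<Longrightarrow> P a' b' c' \<Longrightarrow> lt c c' \<Longrightarrow> (lt a a' \<or> lt a' a) \<or> (lt b b' \<or> lt b' b)"
    by (rule ax(3)[rule_format])
qed

lemma zero_indisc: "a \<in> D \<Longrightarrow> b \<in> D \<Longrightarrow> \<not> lt a b \<Longrightarrow> zero a \<Longrightarrow> zero b"
  by (meson lt_split zero_def)

lemma succ_not_lt: "a \<in> D \<Longrightarrow> b \<in> D \<Longrightarrow> a' \<in> D \<Longrightarrow> b' \<in> D \<Longrightarrow> \<not> lt a' a \<Longrightarrow> succ a b \<Longrightarrow>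
    succ a' b' \<Longrightarrow> \<not> lt b' b"
  by (metis lt_split succ_def)

lemma std_not_lt: "std k a \<Longrightarrow> std k b \<Longrightarrow> \<not> lt a b"
proof (induction k arbitrary: a b)
  case 0
  then show ?case by (auto simp: std_0 zero_def)
next
  case (Suc k)
  then show ?case using succ_not_lt unfolding std_Suc by meson
qed

lemma std_indisc: "std k a \<Longrightarrow> b \<in> D \<Longrightarrow> \<not> lt a b \<Longrightarrow> \<not> lt b a \<Longrightarrow> std k b"
proof (cases k)
  case 0
  assume "std k a" "b \<in> D" "\<not> lt a b"
  then show "std k b" using 0 zero_indisc by (auto simp: std_0)
next
  case (Suc j)
  assume *: "std k a" "b \<in> D" "\<not> lt a b" "\<not> lt b a"
  then obtain c where c: "c \<in> D" "std j c" "succ c a" "a \<in> D" unfolding Suc std_Suc by blast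
  then have "succ c b" using * unfolding succ_def by (meson lt_split)
  then show "std k b" unfolding Suc std_Suc using c * by blast
qed

lemma std_succ:
  assumes "std k a" "std (Suc k) b"
  shows "succ a b"
proof -
  obtain c where c: "c \<in> D" "std k c" "succ c b" "b \<in> D" using assms(2) unfolding std_Suc by blast
  then have "\<not> lt a c" "\<not> lt c a" using std_not_lt assms(1) by auto
  moreover have "a \<in> D" using assms(1) by (rule std_D)
  ultimately show ?thesis using c unfolding succ_def by (meson lt_split)
qed

lemma std_SucI: "std k a \<Longrightarrow> b \<in> D \<Longrightarrow> succ a b \<Longrightarrow> std (Suc k) b"
  unfolding std_Suc using std_D by blast

text \<open>
  From a standard element below \<open>b\<close> the successor leads to the next one, which cannot be above \<open>b\<close>;
  so \<open>b\<close> is either reached at some stage or stays above.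
\<close>

lemma std_trichotomy: "b \<in> D \<Longrightarrow> (\<exists>j\<le>k. std j b) \<or> (\<exists>a. std k a \<and> lt a b)"
proof (induction k)
  case 0
  obtain z where z: "z \<in> D" "zero z" using zero_ex by blast
  then have "std 0 z" by (simp add: std_0)
  moreover have "\<not> lt b z" using z 0 by (simp add: zero_def)
  ultimately show ?case using std_indisc 0 by blast
next
  case (Suc k)
  show ?case
  proof (cases "\<exists>j\<le>k. std j b")
    case False
    then obtain a where a: "std k a" "lt a b" using Suc by blast
    then obtain c where c: "c \<in> D" "succ a c" using succ_ex Suc.prems std_D by blast
    then have "std (Suc k) c" using a std_SucI by blast
    moreover have "\<not> lt b c" using a c Suc.prems unfolding succ_def by blast
    ultimately show ?thesis using std_indisc Suc.prems by blast
  qed (meson le_SucI)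
qed

lemma std_less: "std i a \<Longrightarrow> std j b \<Longrightarrow> i < j \<Longrightarrow> lt a b"
proof (induction j arbitrary: b)
  case (Suc j)
  then obtain c where c: "c \<in> D" "std j c" "succ c b" "b \<in> D" unfolding std_Suc by blast
  show ?case
  proof (cases "i = j")
    case True
    then show ?thesis using Suc.prems std_succ unfolding succ_def by blast
  next
    case False
    then have "lt a c" using Suc c by simp
    then show ?thesis using c lt_trans Suc.prems(1) std_D unfolding succ_def by blast
  qed
qed simp

lemma std_unique: "std i a \<Longrightarrow> std j a \<Longrightarrow> i = j"
  by (metis lt_irrefl std_less std_D nat_neq_iff)

lemma std_below:
  assumes "std k a" "b \<in> D" "lt b a"
  obtains j where "j < k" "std j b"
proof -
  have "\<not> (\<exists>c. std k c \<and> lt c b)" using assms std_not_lt lt_trans std_D by blast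
  then obtain j where j: "j \<le> k" "std j b" using std_trichotomy[of b k] assms(2) by blast
  have "j \<noteq> k" using j std_not_lt assms by blast
  then show thesis using that[of j] j by simp
qed

lemma std_prefix: "std k a \<Longrightarrow> j \<le> k \<Longrightarrow> \<exists>b. std j b"
proof (induction k arbitrary: a)
  case (Suc k)
  show ?case
  proof (cases "j = Suc k")
    case False
    then show ?thesis using Suc unfolding std_Suc[of k] by auto
  qed (use Suc.prems in blast)
qed auto

lemma std_zero_iff: "std k a \<Longrightarrow> zero a \<longleftrightarrow> k = 0"
  using std_unique std_0 std_D by blast

lemma std_succ_iff: "std i a \<Longrightarrow> std j b \<Longrightarrow> succ a b \<longleftrightarrow> j = Suc i"
  using std_unique std_SucI std_succ std_D by blast

lemma P_std: "std k c \<Longrightarrow> a \<in> D \<Longrightarrow> b \<in> D \<Longrightarrow> P a b c \<longleftrightarrow> std (pfst k) a \<and> std (psnd k) b"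
proof (induction k arbitrary: a b c)
  case 0
  then show ?case using P_zero by (auto simp: std_0)
next
  case (Suc k)
  then obtain c' where c': "c' \<in> D" "std k c'" "succ c' c" "c \<in> D" unfolding std_Suc by blast
  have P': "P m n c' \<longleftrightarrow> std (pfst k) m \<and> std (psnd k) n" if "m \<in> D" "n \<in> D" for m n
    using Suc.IH c' that by blast
  have P: "P a b c \<longleftrightarrow> (\<exists>m\<in>D. \<exists>n\<in>D. std (pfst k) m \<and> std (psnd k) n \<and>
      (zero n \<and> zero a \<and> succ m b \<or> \<not> zero n \<and> succ m a \<and> succ b n))"
    using P_succ[OF Suc.prems(2,3) c'(1,4,3)] P' by blast
  show ?case
  proof (cases "psnd k")
    case 0
    then show ?thesis using zero_ex Suc.prems unfolding P
      by (auto simp: prod_decode_Suc std_0 std_Suc)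
  next
    case (Suc j)
    have "P a b c \<longleftrightarrow> (\<exists>m\<in>D. std (pfst k) m \<and> succ m a) \<and> (\<exists>n\<in>D. std (Suc j) n \<and> succ b n)"
      using std_zero_iff unfolding P Suc by blast
    also have "(\<exists>n\<in>D. std (Suc j) n \<and> succ b n) \<longleftrightarrow> std j b \<and> (\<exists>n. std (Suc j) n)"
    proof (intro iffI conjI)
      assume "\<exists>n\<in>D. std (Suc j) n \<and> succ b n"
      then obtain n where n: "n \<in> D" "std (Suc j) n" "succ b n" by blast
      then obtain i where i: "std i b" using std_below Suc.prems unfolding succ_def by meson
      then show "std j b" using std_succ_iff n by blast
      show "\<exists>n. std (Suc j) n" using n by blast
    next
      assume "std j b \<and> (\<exists>n. std (Suc j) n)"
      then show "\<exists>n\<in>D. std (Suc j) n \<and> succ b n" using std_succ std_D by blast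
    qed
    also have "\<dots> \<longleftrightarrow> std j b"
    proof -
      have "Suc j \<le> k" using Suc components_le(2)[of k] by simp
      then show ?thesis using std_prefix c'(2) by blast
    qed
    finally show ?thesis using Suc Suc.prems by (simp add: prod_decode_Suc std_Suc)
  qed
qed

text \<open>
  By \<open>std_trichotomy\<close>, a code of the pair is either standard, and then decodes correctly, or lies
  above a standard code of the same pair, which the uniqueness of codes forbids.
\<close>

lemma P_std_args:
  assumes "std i a" "std j b" "c \<in> D" "P a b c"
  shows "std (pe i j) c"
proof -
  consider k where "std k c" | a where "std (pe i j) a" "lt a c"
    using std_trichotomy[OF assms(3), of "pe i j"] by blast
  then show ?thesis
  proof cases
    case (1 k)
    then have "std (pfst k) a" "std (psnd k) b" using P_std assms std_D by blast+
    then have "k = pe i j" using assms std_unique by (metis prod.collapse prod_decode_inverse)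
    then show ?thesis using 1 by simp
  next
    case (2 c')
    then have "P a b c'" using P_std assms std_D by simp
    then have "lt a a \<or> lt b b" using P_unique[of a b c' a b c] assms 2 std_D by blast
    then show ?thesis using lt_irrefl assms std_D by blast
  qed
qed

end

locale graph_arith = weak_order_arith +
  fixes F :: "rterm set"
  assumes graph_axiom: "\<And>t a b. t \<in> F \<Longrightarrow> a \<in> D \<Longrightarrow> b \<in> D \<Longrightarrow> G t a b \<longleftrightarrow> clause t a b"
    and subterms: "\<And>t. t \<in> F \<Longrightarrow> set (subterms t) \<subseteq> F"
begin

lemma subterm_self: "t \<in> set (subterms t)"
  by (cases t) auto

lemma F_subterms:
  "RPair f g \<in> F \<Longrightarrow> f \<in> F" "RPair f g \<in> F \<Longrightarrow> g \<in> F"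
  "RComp f g \<in> F \<Longrightarrow> f \<in> F" "RComp f g \<in> F \<Longrightarrow> g \<in> F"
  "RRec f g \<in> F \<Longrightarrow> f \<in> F" "RRec f g \<in> F \<Longrightarrow> g \<in> F"
  "RMin f \<in> F \<Longrightarrow> f \<in> F"
  using subterms subterm_self by fastforce+

text \<open>
  By induction on \<open>t\<close>, even in structures with nonstandard elements: intermediate values are
  standard by the induction hypothesis.  Nothing larger than the true value can be the value of an
  unbounded search, since the search passes the true value first.
\<close>

lemma graph_sound:
  "t \<in> F \<Longrightarrow> regular t \<Longrightarrow> std k a \<Longrightarrow> b \<in> D \<Longrightarrow> G t a b \<Longrightarrow> std (reval t k) b"
proof (induction t arbitrary: k a b)
  case RZero
  then show ?case using graph_axiom std_D by (simp add: std_0)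
next
  case RSucc
  then show ?case using graph_axiom std_D std_SucI by simp
next
  case RFst
  then show ?case using graph_axiom[of RFst] std_D P_std by auto
next
  case RSnd
  then show ?case using graph_axiom[of RSnd] std_D P_std by auto
next
  case (RPair f g)
  then obtain c d where cd: "c \<in> D" "d \<in> D" "G f a c" "G g a d" "P c d b"
    using graph_axiom[of "RPair f g" a b] std_D by auto
  have "std (reval f k) c"
    using RPair.IH(1)[OF F_subterms(1)] RPair.prems cd by simp
  moreover have "std (reval g k) d"
    using RPair.IH(2)[OF F_subterms(2)] RPair.prems cd by simp
  ultimately show ?case using P_std_args cd RPair.prems by simp
next
  case (RComp f g)
  then obtain c where c: "c \<in> D" "G g a c" "G f c b"
    using graph_axiom[of "RComp f g" a b] std_D by auto
  have "std (reval g k) c"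
    using RComp.IH(2)[OF F_subterms(4)] RComp.prems c by simp
  then show ?case using RComp.IH(1)[OF F_subterms(3)] RComp.prems c by simp
next
  case (RRec g h)
  have G: "G (RRec g h) a b \<Longrightarrow> clause (RRec g h) a b" if "a \<in> D" "b \<in> D" for a b
    using graph_axiom RRec.prems(1) that by blast
  have *: "std (rec_nat (reval g p) (\<lambda>v r. reval h (pe v (pe r p))) u) b"
    if "std (pe u p) a" "b \<in> D" "G (RRec g h) a b" for u p a b
    using that
  proof (induction u arbitrary: a b)
    case 0
    then obtain u' p' where up: "u' \<in> D" "p' \<in> D" "P u' p' a" and
      disj: "zero u' \<and> G g p' b \<or> (\<exists>v\<in>D. succ v u')"
      using G std_D by (fastforce simp del: graph_axiom)
    then have std: "std 0 u'" "std p p'" using P_std 0 by fastforce+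
    moreover have "\<not> (\<exists>v\<in>D. succ v u')" using std unfolding std_0 zero_def succ_def by blast
    ultimately have "G g p' b" using disj by blast
    then show ?case using RRec.IH(1)[OF F_subterms(5), of _ p p' b] std RRec.prems(1,2) 0 by simp
  next
    case (Suc u)
    then obtain u' p' where up: "u' \<in> D" "p' \<in> D" "P u' p' a" and
      disj: "zero u' \<or> (\<exists>v\<in>D. \<exists>a'\<in>D. \<exists>r\<in>D. \<exists>w\<in>D. \<exists>w'\<in>D. succ v u' \<and> P v p' a' \<and>
        G (RRec g h) a' r \<and> P r p' w \<and> P v w w' \<and> G h w' b)"
      using G[OF std_D[OF Suc.prems(1)] Suc.prems(2,3)] unfolding clause.simps by blast
    then have std: "std (Suc u) u'" "std p p'" using P_std Suc.prems(1) by fastforce+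
    moreover have "\<not> zero u'" using std std_zero_iff by blast
    ultimately obtain v a' r w w' where v: "v \<in> D" "a' \<in> D" "r \<in> D" "w \<in> D" "w' \<in> D" "succ v u'"
      "P v p' a'" "G (RRec g h) a' r" "P r p' w" "P v w w'" "G h w' b"
      using disj by blast
    have "std u v" using v std std_below std_succ_iff up unfolding succ_def
      by (metis nat.inject succ_def)
    then have a': "std (pe u p) a'" using P_std_args std v by blast
    then have "std (rec_nat (reval g p) (\<lambda>v r. reval h (pe v (pe r p))) u) r" (is "std ?r r")
      using Suc.IH v by blast
    then have "std (pe u (pe ?r p)) w'" using P_std_args std v \<open>std u v\<close> by blast
    then show ?case
      using RRec.IH(2)[OF F_subterms(6)] v(11) Suc.prems(2) RRec.prems(1,2) by simp
  qed
  show ?case using *[of "pfst k" "psnd k" a b] RRec.prems by simp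
next
  case (RMin g)
  have g: "g \<in> F" "regular g" using RMin.prems(2) F_subterms(7)[OF RMin.prems(1)] by simp_all
  define m where "m = (LEAST y. reval g (pe y k) = 0)"
  have m: "reval g (pe m k) = 0" "\<And>y. y < m \<Longrightarrow> reval g (pe y k) \<noteq> 0"
    unfolding m_def using RMin.prems(2) by (auto intro: LeastI_ex dest: not_less_Least)
  have cl: "clause (RMin g) a b" using graph_axiom RMin.prems std_D by blast
  then obtain w z where w: "w \<in> D" "z \<in> D" "P b a w" "zero z" "G g w z" by auto
  have "\<not> lt c b" if c: "std m c" for c
  proof
    assume "lt c b"
    then obtain w v where w: "w \<in> D" "v \<in> D" "P c a w" "\<not> zero v" "G g w v"
      using cl std_D[OF c] unfolding clause.simps by blast
    then have "std (pe m k) w" using P_std_args c RMin.prems by blast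
    then have "std 0 v" using RMin.IH[OF g] m w by metis
    then show False using w by (simp add: std_0)
  qed
  then obtain j where j: "j \<le> m" "std j b" using std_trichotomy[OF RMin.prems(4), of m] by blast
  then have "std (pe j k) w" using P_std_args w RMin.prems by blast
  then have "std (reval g (pe j k)) z" using RMin.IH[OF g] w by blast
  then have "reval g (pe j k) = 0" using w std_zero_iff by blast
  then have "j = m" using m(2) j(1) by (meson le_neq_implies_less)
  then show ?case using j by (simp add: m_def)
qed

text \<open>
  Conversely, when every number has a representative, every computation can be traced in the
  structure, since its intermediate values all exist there.
\<close>

lemma graph_complete:
  assumes inhabited: "\<And>k. \<exists>a. std k a"
  shows "t \<in> F \<Longrightarrow> regular t \<Longrightarrow> std k a \<Longrightarrow> std (reval t k) b \<Longrightarrow> G t a b"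
proof (induction t arbitrary: k a b)
  case RZero
  then show ?case using graph_axiom std_D by (simp add: std_0)
next
  case RSucc
  then show ?case using graph_axiom std_D std_succ by simp
next
  case RFst
  obtain c where "std (psnd k) c" using inhabited by blast
  then have "P b c a" "c \<in> D" using P_std[of k a b c] RFst std_D by auto
  then show ?case using graph_axiom[of RFst a b] RFst std_D by auto
next
  case RSnd
  obtain c where "std (pfst k) c" using inhabited by blast
  then have "P c b a" "c \<in> D" using P_std[of k a c b] RSnd std_D by auto
  then show ?case using graph_axiom[of RSnd a b] RSnd std_D by auto
next
  case (RPair f g)
  obtain c d where cd: "std (reval f k) c" "std (reval g k) d" using inhabited by metis
  then have "P c d b" using P_std[of _ b c d] RPair.prems std_D by simp
  moreover have "G f a c" using RPair.IH(1)[OF F_subterms(1)] RPair.prems cd by simp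
  moreover have "G g a d" using RPair.IH(2)[OF F_subterms(2)] RPair.prems cd by simp
  ultimately show ?case using graph_axiom[of "RPair f g" a b] RPair.prems std_D cd by auto
next
  case (RComp f g)
  obtain c where c: "std (reval g k) c" using inhabited by metis
  have "G g a c" using RComp.IH(2)[OF F_subterms(4)] RComp.prems c by simp
  moreover have "G f c b" using RComp.IH(1)[OF F_subterms(3)] RComp.prems c by simp
  ultimately show ?case using graph_axiom[of "RComp f g" a b] RComp.prems std_D c by auto
next
  case (RRec g h)
  have G: "clause (RRec g h) a b \<Longrightarrow> G (RRec g h) a b" if "a \<in> D" "b \<in> D" for a b
    using graph_axiom RRec.prems(1) that by blast
  have P: "P a b c" if "std i a" "std j b" "std (pe i j) c" for a b c i j
    using P_std that std_D by simp
  have *: "G (RRec g h) a b"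
    if "std (pe u p) a" "std (rec_nat (reval g p) (\<lambda>v r. reval h (pe v (pe r p))) u) b" for u p a b
    using that
  proof (induction u arbitrary: a b)
    case 0
    obtain u' p' where up: "std 0 u'" "std p p'" using inhabited by metis
    then have "G g p' b" using RRec.IH(1)[OF F_subterms(5)] RRec.prems(1,2) 0 by simp
    then have "clause (RRec g h) a b"
      using P[OF up 0(1)] std_D[OF up(1)] std_D[OF up(2)] up(1)[unfolded std_0]
      unfolding clause.simps by blast
    then show ?case using G 0 std_D by blast
  next
    case (Suc u)
    define r where "r = rec_nat (reval g p) (\<lambda>v r. reval h (pe v (pe r p))) u"
    obtain u' v' p' a' r' w x where s: "std (Suc u) u'" "std u v'" "std p p'" "std (pe u p) a'"
      "std r r'" "std (pe r p) w" "std (pe u (pe r p)) x" using inhabited by metis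
    have "G (RRec g h) a' r'" using Suc.IH s by (simp add: r_def)
    moreover have "G h x b" using RRec.IH(2)[OF F_subterms(6)] RRec.prems(1,2) s Suc.prems(2)
      by (simp add: r_def)
    moreover have "succ v' u'" "P u' p' a" "P v' p' a'" "P r' p' w" "P v' w x"
      using std_succ[OF s(2,1)] P[OF s(1,3) Suc.prems(1)] P[OF s(2,3,4)] P[OF s(5,3,6)]
        P[OF s(2,6,7)] by simp_all
    ultimately have "clause (RRec g h) a b" using s[THEN std_D]  unfolding clause.simps by blast
    then show ?case using G Suc.prems std_D by blast
  qed
  show ?case using *[of "pfst k" "psnd k" a b] RRec.prems by simp
next
  case (RMin g)
  have g: "g \<in> F" "regular g" using RMin.prems(2) F_subterms(7)[OF RMin.prems(1)] by simp_all
  define m where "m = (LEAST y. reval g (pe y k) = 0)"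
  have m: "reval g (pe m k) = 0" "\<And>y. y < m \<Longrightarrow> reval g (pe y k) \<noteq> 0"
    unfolding m_def using RMin.prems(2) by (auto intro: LeastI_ex dest: not_less_Least)
  have b: "std m b" using RMin.prems by (simp add: m_def)
  have P: "P a b c" if "std i a" "std j b" "std (pe i j) c" for a b c i j
    using P_std that std_D by simp
  obtain w z where w: "std (pe m k) w" "std 0 z" using inhabited by metis
  then have "G g w z" using RMin.IH[OF g] m by simp
  then have "\<exists>w\<in>D. \<exists>z\<in>D. P b a w \<and> zero z \<and> G g w z"
    using P[OF b RMin.prems(3) w(1)] std_D[OF w(1)] w(2)[unfolded std_0] by blast
  moreover have "\<exists>w\<in>D. \<exists>v\<in>D. P c a w \<and> \<not> zero v \<and> G g w v" if c: "c \<in> D" "lt c b" for c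
  proof -
    obtain j where j: "j < m" "std j c" using std_below b c by blast
    obtain w v where w: "std (pe j k) w" "std (reval g (pe j k)) v" using inhabited by metis
    then have "G g w v" using RMin.IH[OF g] by simp
    moreover have "\<not> zero v" using w m(2) j(1) std_zero_iff by blast
    ultimately show ?thesis
      using P[OF j(2) RMin.prems(3) w(1)] std_D[OF w(1)] std_D[OF w(2)] by blast
  qed
  ultimately show ?case using graph_axiom[of "RMin g" a b] RMin.prems std_D by simp
qed

end


section \<open>Finite models of the arithmetic axioms\<close>

text \<open>
  Evaluation in which no intermediate value exceeds \<open>N\<close>.  Cutting off the true graphs at \<open>N\<close> would
  not do: a value below \<open>N\<close> reached through a larger one violates the graph axioms.
\<close>

inductive bounded_eval :: "nat \<Rightarrow> rterm \<Rightarrow> nat \<Rightarrow> nat \<Rightarrow> bool" for N where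
  zero: "bounded_eval N RZero x 0"
| succ: "bounded_eval N RSucc x (Suc x)"
| fst: "bounded_eval N RFst x (pfst x)"
| snd: "bounded_eval N RSnd x (psnd x)"
| pair: "bounded_eval N f x a \<Longrightarrow> bounded_eval N g x b \<Longrightarrow> a \<le> N \<Longrightarrow> b \<le> N \<Longrightarrow>
    bounded_eval N (RPair f g) x (pe a b)"
| comp: "bounded_eval N g x a \<Longrightarrow> a \<le> N \<Longrightarrow> bounded_eval N f a y \<Longrightarrow>
    bounded_eval N (RComp f g) x y"
| rec_0: "bounded_eval N g p y \<Longrightarrow> bounded_eval N (RRec g h) (pe 0 p) y"
| rec_Suc: "bounded_eval N (RRec g h) (pe v p) r \<Longrightarrow> pe v p \<le> N \<Longrightarrow> r \<le> N \<Longrightarrow>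
    pe v (pe r p) \<le> N \<Longrightarrow> bounded_eval N h (pe v (pe r p)) y \<Longrightarrow>
    bounded_eval N (RRec g h) (pe (Suc v) p) y"
| min: "bounded_eval N g (pe y x) 0 \<Longrightarrow> pe y x \<le> N \<Longrightarrow>
    (\<forall>z<y. \<exists>w\<le>N. pe z x \<le> N \<and> w \<noteq> 0 \<and> bounded_eval N g (pe z x) w) \<Longrightarrow>
    bounded_eval N (RMin g) x y"

lemma bounded_eval_mono:
  "bounded_eval N t x y \<Longrightarrow> N \<le> M \<Longrightarrow> bounded_eval M t x y"
proof (induction rule: bounded_eval.induct)
  case (min g y x)
  then show ?case by (intro bounded_eval.min) (auto intro: order_trans)
qed (auto intro: bounded_eval.intros order_trans)

lemma bounded_eval_total:
  "regular t \<Longrightarrow> \<exists>N. bounded_eval N t x (reval t x)"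
proof (induction t arbitrary: x)
  case (RPair f g)
  then obtain K L where K: "bounded_eval K f x (reval f x)" and L: "bounded_eval L g x (reval g x)"
    by fastforce
  define M where "M = K + L + reval f x + reval g x"
  have "bounded_eval M (RPair f g) x (pe (reval f x) (reval g x))"
    by (rule bounded_eval.pair[OF bounded_eval_mono[OF K] bounded_eval_mono[OF L]])
      (simp_all add: M_def)
  then show ?case by auto
next
  case (RComp f g)
  then obtain K L where K: "bounded_eval K f (reval g x) (reval f (reval g x))"
    and L: "bounded_eval L g x (reval g x)" by fastforce
  define M where "M = K + L + reval g x"
  have "bounded_eval M (RComp f g) x (reval f (reval g x))"
    by (rule bounded_eval.comp[OF bounded_eval_mono[OF L] _ bounded_eval_mono[OF K]])
      (simp_all add: M_def)
  then show ?case by auto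
next
  case (RRec g h)
  define F where "F = rec_nat (reval g (psnd x)) (\<lambda>v r. reval h (pe v (pe r (psnd x))))"
  have "\<exists>N. bounded_eval N (RRec g h) (pe u (psnd x)) (F u)" for u
  proof (induction u)
    case 0
    have "regular g" using RRec.prems by simp
    then show ?case using RRec.IH(1) unfolding F_def by (auto intro: bounded_eval.rec_0)
  next
    case (Suc u)
    then obtain K where K: "bounded_eval K (RRec g h) (pe u (psnd x)) (F u)" by blast
    have "regular h" using RRec.prems by simp
    then obtain L where "bounded_eval L h (pe u (pe (F u) (psnd x))) (reval h (pe u (pe (F u) (psnd x))))"
      using RRec.IH(2) by blast
    then have L: "bounded_eval L h (pe u (pe (F u) (psnd x))) (F (Suc u))"
      by (simp add: F_def)
    define M where "M = K + L + pe u (psnd x) + F u + pe u (pe (F u) (psnd x))"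
    have "bounded_eval M (RRec g h) (pe (Suc u) (psnd x)) (F (Suc u))"
      by (rule bounded_eval.rec_Suc[OF bounded_eval_mono[OF K] _ _ _ bounded_eval_mono[OF L]])
        (simp_all add: M_def)
    then show ?case by blast
  qed
  from this[of "pfst x"] show ?case by (simp add: F_def)
next
  case (RMin g)
  define m where "m = (LEAST y. reval g (pe y x) = 0)"
  have m: "reval g (pe m x) = 0" "\<And>y. y < m \<Longrightarrow> reval g (pe y x) \<noteq> 0"
    unfolding m_def using RMin.prems by (auto intro: LeastI_ex dest: not_less_Least)
  have "\<forall>y. \<exists>N. bounded_eval N g (pe y x) (reval g (pe y x))" using RMin by simp
  then obtain K where K: "\<And>y. bounded_eval (K y) g (pe y x) (reval g (pe y x))" by metis
  define M where "M = (\<Sum>y\<le>m. K y + pe y x + reval g (pe y x))"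
  have M: "K y + pe y x + reval g (pe y x) \<le> M" if "y \<le> m" for y
    unfolding M_def by (rule member_le_sum) (use that in auto)
  have "bounded_eval M (RMin g) x m"
  proof (rule bounded_eval.min)
    show "bounded_eval M g (pe m x) 0"
      using bounded_eval_mono[OF K, of m M] M[of m] m(1) by simp
    show "pe m x \<le> M" using M[of m] by simp
    show "\<forall>z<m. \<exists>w\<le>M. pe z x \<le> M \<and> w \<noteq> 0 \<and> bounded_eval M g (pe z x) w"
    proof (intro allI impI)
      fix z assume z: "z < m"
      have "bounded_eval M g (pe z x) (reval g (pe z x))"
        using bounded_eval_mono[OF K, of z M] M[of z] z by simp
      then show "\<exists>w\<le>M. pe z x \<le> M \<and> w \<noteq> 0 \<and> bounded_eval M g (pe z x) w"
        using m(2)[OF z] M[of z] z by (intro exI[of _ "reval g (pe z x)"]) auto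
    qed
  qed
  then show ?case by (auto simp: m_def)
qed (auto intro: bounded_eval.intros)

text \<open>
  The arity tells the symbols apart, except for the binary ones, where \<open>0\<close> is the order and the
  other indices are codes of terms.
\<close>

fun finite_int :: "rterm \<Rightarrow> nat \<Rightarrow> nat \<Rightarrow> nat list \<Rightarrow> bool" where
  "finite_int d N i [a] \<longleftrightarrow> bounded_eval N d a 0"
| "finite_int d N i [a, b] \<longleftrightarrow> (if i = 0 then a < b else bounded_eval N (from_nat (i - 1)) a b)"
| "finite_int d N i [a, b, c] \<longleftrightarrow> pe a b = c"
| "finite_int d N i xs \<longleftrightarrow> False"

locale finite_arith =
  fixes d :: rterm and N :: nat
begin

sublocale arith "{..N}" "finite_int d N" .

lemma lt [simp]: "lt a b \<longleftrightarrow> a < b"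
  by (simp add: lt_def)

lemma P [simp]: "P a b c \<longleftrightarrow> pe a b = c"
  by (simp add: P_def)

lemma G [simp]: "G t a b \<longleftrightarrow> bounded_eval N t a b"
  by (simp add: G_def)

lemma zero [simp]: "zero a \<longleftrightarrow> a = 0"
  by (auto simp: zero_def)

lemma succ: "b \<le> N \<Longrightarrow> succ a b \<longleftrightarrow> b = Suc a"
  by (auto simp: succ_def)

lemma std [simp]: "a \<le> N \<Longrightarrow> std k a \<longleftrightarrow> k = a"
proof (induction k arbitrary: a)
  case 0
  then show ?case by (auto simp: std_0)
next
  case (Suc k)
  then show ?case by (auto simp: std_Suc succ)
qed

lemma P_succ_iff:
  assumes "a \<le> N" "b \<le> N" "l \<le> N" "succ k l"
  shows "pe a b = l \<longleftrightarrow> (\<exists>m\<in>{..N}. \<exists>n\<in>{..N}. pe m n = k \<and>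
    (n = 0 \<and> a = 0 \<and> succ m b \<or> n \<noteq> 0 \<and> succ m a \<and> succ b n))"
proof -
  have l: "l = Suc k" using assms succ by simp
  have "pe a b = l \<longleftrightarrow> (a, b) = prod_decode (Suc k)"
    unfolding l by (metis prod_decode_inverse prod_encode_inverse)
  also have "\<dots> \<longleftrightarrow> (psnd k = 0 \<and> a = 0 \<and> b = Suc (pfst k) \<or> psnd k \<noteq> 0 \<and> a = Suc (pfst k) \<and> psnd k = Suc b)"
    unfolding prod_decode_Suc by auto
  also have "\<dots> \<longleftrightarrow> (\<exists>m\<in>{..N}. \<exists>n\<in>{..N}. pe m n = k \<and>
    (n = 0 \<and> a = 0 \<and> succ m b \<or> n \<noteq> 0 \<and> succ m a \<and> succ b n))"
  proof -
    have "pfst k \<in> {..N}" "psnd k \<in> {..N}" using components_le[of k] l assms by auto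
    moreover have "pe m n = k \<longleftrightarrow> m = pfst k \<and> n = psnd k" for m n
      by (metis prod.collapse prod_decode_inverse prod_encode_inverse fst_conv snd_conv)
    ultimately show ?thesis using assms succ by auto
  qed
  finally show ?thesis .
qed

sublocale weak_order_arith "{..N}" "finite_int d N" "\<lambda>_. 0"
proof
  have "(\<exists>c\<in>{..N}. succ a c)" if "a < b" "b \<le> N" for a b
    using that succ[of "Suc a"] by (intro bexI[of _ "Suc a"]) auto
  then show "list_all (ssat {..N} (finite_int d N) (\<lambda>_. 0)) order_axioms"
    unfolding ssat_order_axioms by auto
  have "pe a b = 0 \<longleftrightarrow> a = 0 \<and> b = 0" for a b
    by (metis fst_conv prod_decode_0 prod_encode_inverse snd_conv prod_decode_inverse)
  moreover have "(a < a' \<or> a' < a) \<or> (b < b' \<or> b' < b)" if "pe a b < pe a' b'" for a b a' b'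
    using that by (metis less_irrefl nat_neq_iff)
  ultimately show "list_all (ssat {..N} (finite_int d N) (\<lambda>_. 0)) pairing_axioms"
    unfolding ssat_pairing_axioms P zero lt using P_succ_iff by (intro conjI ballI impI) auto
qed

lemma bounded_eval_clause:
  assumes "a \<le> N" "b \<le> N"
  shows "bounded_eval N t a b \<longleftrightarrow> clause t a b"
proof (cases t)
  case RZero
  then show ?thesis by (auto intro: bounded_eval.intros elim: bounded_eval.cases)
next
  case RSucc
  then show ?thesis using assms succ by (auto intro: bounded_eval.intros elim: bounded_eval.cases)
next
  case RFst
  have "psnd a \<in> {..N}" using components_le[of a] assms by simp
  moreover have "bounded_eval N RFst a b \<longleftrightarrow> b = pfst a"
    by (auto intro: bounded_eval.intros elim: bounded_eval.cases)
  moreover have "pe b k = a \<Longrightarrow> b = pfst a" for k by auto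
  ultimately show ?thesis using RFst by (auto intro!: bexI[of _ "psnd a"])
next
  case RSnd
  have "pfst a \<in> {..N}" using components_le[of a] assms by simp
  moreover have "bounded_eval N RSnd a b \<longleftrightarrow> b = psnd a"
    by (auto intro: bounded_eval.intros elim: bounded_eval.cases)
  moreover have "pe k b = a \<Longrightarrow> b = psnd a" for k by auto
  ultimately show ?thesis using RSnd by (auto intro!: bexI[of _ "pfst a"])
next
  case (RPair f g)
  then show ?thesis by (auto intro!: bounded_eval.intros elim: bounded_eval.cases)
next
  case (RComp f g)
  then show ?thesis by (auto intro!: bounded_eval.intros elim: bounded_eval.cases)
next
  case (RRec g h)
  have "clause (RRec g h) a b" if "bounded_eval N (RRec g h) a b"
    using that
  proof (cases rule: bounded_eval.cases)
    case (rec_0 p)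
    have "p \<le> a" using rec_0 le_prod_encode_2[of p 0] by simp
    then show ?thesis unfolding clause.simps using rec_0 assms by (intro bexI[of _ 0] bexI[of _ p]) auto
  next
    case (rec_Suc v p r)
    have le: "p \<le> a" "Suc v \<le> a" using rec_Suc le_prod_encode_2[of p "Suc v"] le_prod_encode_1[of "Suc v" p]
      by simp_all
    have le2: "pe r p \<le> pe v (pe r p)" by (rule le_prod_encode_2)
    have "Suc v \<in> {..N}" "v \<in> {..N}" "p \<in> {..N}" "pe v p \<in> {..N}" "r \<in> {..N}"
      "pe r p \<in> {..N}" "pe v (pe r p) \<in> {..N}"
      using le le2 rec_Suc assms by auto
    moreover have "P (Suc v) p a" "succ v (Suc v)" "P v p (pe v p)" "G (RRec g h) (pe v p) r"
      "P r p (pe r p)" "P v (pe r p) (pe v (pe r p))" "G h (pe v (pe r p)) b"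
      using rec_Suc le assms succ by simp_all
    ultimately show ?thesis unfolding clause.simps by blast
  qed
  moreover have "clause (RRec g h) a b \<Longrightarrow> bounded_eval N (RRec g h) a b"
    using succ by (auto intro: bounded_eval.intros)
  ultimately show ?thesis using RRec by blast
next
  case (RMin g)
  have "bounded_eval N (RMin g) a b \<Longrightarrow> clause (RMin g) a b"
    by (erule bounded_eval.cases) auto
  moreover have "bounded_eval N (RMin g) a b" if cl: "clause (RMin g) a b"
  proof (rule bounded_eval.min)
    obtain w z where "w \<in> {..N}" "P b a w" "zero z" "G g w z"
      using cl unfolding clause.simps by blast
    then show "bounded_eval N g (pe b a) 0" "pe b a \<le> N" by simp_all
    show "\<forall>z<b. \<exists>w\<le>N. pe z a \<le> N \<and> w \<noteq> 0 \<and> bounded_eval N g (pe z a) w"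
    proof (intro allI impI)
      fix z assume "z < b"
      then have "z \<in> {..N}" "lt z b" using assms by auto
      then obtain v w where "v \<in> {..N}" "w \<in> {..N}" "P z a w" "\<not> zero v" "G g w v"
        using cl unfolding clause.simps by blast
      then show "\<exists>w\<le>N. pe z a \<le> N \<and> w \<noteq> 0 \<and> bounded_eval N g (pe z a) w" by auto
    qed
  qed
  ultimately show ?thesis using RMin by blast
qed

end


section \<open>The sentences of the reduction\<close>

definition successor_step :: "sfm \<Rightarrow> sfm" where
  "successor_step q = SAll (SImp (sSucc 1 0) q)"

text \<open>
  \<open>at_numeral k q\<close> says \<open>q\<close> of all elements that stand for \<open>k\<close>; its code is primitive
  recursive in \<open>k\<close>.
\<close>

definition at_numeral :: "nat \<Rightarrow> sfm \<Rightarrow> sfm" where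
  "at_numeral k q = SAll (SImp (sZero 0) ((successor_step ^^ k) q))"

text \<open>
  With index \<open>0\<close> free for \<open>x\<close>, the function denoted by \<open>t\<close> has no zero of the form \<open>pe y x\<close>.
\<close>

definition never_zero :: "rterm \<Rightarrow> sfm" where
  "never_zero t = SAll (SAll (SAll (SImp (sP 2 3 1) (SImp (sZero 0) (SNeg (sG t 1 0))))))"

text \<open>
  The symbol \<open>sU\<close> for the zeros of \<open>d\<close> is the same for all \<open>d\<close>.  This lets a sentence about \<open>d\<close> be
  written down before \<open>d\<close> is chosen, which the diagonal argument needs.
\<close>

definition U_axiom :: "rterm \<Rightarrow> sfm" where
  "U_axiom d = SAll (SIff (sU 0) (SEx (SAnd (sZero 0) (sG d 1 0))))"

definition axioms :: "rterm \<Rightarrow> rterm \<Rightarrow> sfm list" where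
  "axioms d t = order_axioms @ pairing_axioms @ U_axiom d # map graph_axiom (subterms d @ subterms t)"

definition reduction :: "rterm \<Rightarrow> rterm \<Rightarrow> nat \<Rightarrow> sfm" where
  "reduction d t k = foldr SImp (axioms d t) (at_numeral k (never_zero t))"

lemma ssat_foldr_SImp:
  "ssat D I e (foldr SImp ps q) \<longleftrightarrow> (list_all (ssat D I e) ps \<longrightarrow> ssat D I e q)"
  by (induction ps) auto

lemma sfv_foldr_SImp: "sfv (foldr SImp ps q) = (\<Union>p\<in>set ps. sfv p) \<union> sfv q"
  by (induction ps) auto

lemma sfv_symbols [simp]:
  "sfv (sLt x y) = {x, y}" "sfv (sP x y z) = {x, y, z}" "sfv (sG t x y) = {x, y}" "sfv (sU x) = {x}"
  "sfv (sZero x) = {x}" "sfv (sSucc x y) = {x, y}"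
  by (auto simp: sLt_def sP_def sG_def sU_def sZero_def sSucc_def)

lemma sfv_graph_axiom: "sfv (graph_axiom t) = {}"
  by (cases t) (auto simp: graph_axiom_def eval_nat_numeral)

lemma sfv_axioms: "p \<in> set (axioms d t) \<Longrightarrow> sfv p = {}"
  by (auto simp: axioms_def order_axioms_def pairing_axioms_def U_axiom_def sfv_graph_axiom
      eval_nat_numeral)

lemma sfv_at_numeral: "sfv q \<subseteq> {0} \<Longrightarrow> sfv (at_numeral k q) = {}"
proof -
  assume q: "sfv q \<subseteq> {0}"
  have "sfv ((successor_step ^^ k) q) \<subseteq> {0}"
    by (induction k) (use q in \<open>auto simp: successor_step_def\<close>)
  then show ?thesis by (auto simp: at_numeral_def)
qed

lemma sfv_never_zero: "sfv (never_zero t) \<subseteq> {0}"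
  by (auto simp: never_zero_def eval_nat_numeral)

lemma sfv_reduction: "sfv (reduction d t k) = {}"
  by (simp add: reduction_def sfv_foldr_SImp sfv_axioms sfv_at_numeral sfv_never_zero)

context arith
begin

lemma ssat_at_numeral:
  assumes "sfv q \<subseteq> {0}"
  shows "ssat D I e (at_numeral k q) \<longleftrightarrow> (\<forall>a. std k a \<longrightarrow> ssat D I (\<lambda>_. a) q)"
proof -
  let ?S = "\<lambda>a b. a \<in> D \<and> b \<in> D \<and> succ a b"
  have "ssat D I e ((successor_step ^^ k) q) \<longleftrightarrow> (\<forall>a. (?S ^^ k) (e 0) a \<longrightarrow> ssat D I (\<lambda>_. a) q)"
    if "e 0 \<in> D" for e
    using that
  proof (induction k arbitrary: e)
    case 0
    have "ssat D I e q \<longleftrightarrow> ssat D I (\<lambda>_. e 0) q"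
      by (rule ssat_cong) (use assms in auto)
    then show ?case by simp
  next
    case (Suc k)
    have "ssat D I e ((successor_step ^^ Suc k) q) \<longleftrightarrow>
        (\<forall>b\<in>D. succ (e 0) b \<longrightarrow> ssat D I (case_nat b e) ((successor_step ^^ k) q))"
      by (simp add: successor_step_def)
    also have "\<dots> \<longleftrightarrow> (\<forall>b\<in>D. succ (e 0) b \<longrightarrow> (\<forall>a. (?S ^^ k) b a \<longrightarrow> ssat D I (\<lambda>_. a) q))"
      using Suc.IH[of "case_nat _ e"] by simp
    also have "\<dots> \<longleftrightarrow> (\<forall>a. (?S ^^ Suc k) (e 0) a \<longrightarrow> ssat D I (\<lambda>_. a) q)"
    proof -
      have "(?S ^^ Suc k) (e 0) a \<longleftrightarrow> (\<exists>b. ?S (e 0) b \<and> (?S ^^ k) b a)" for a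
        by (blast intro: relpowp_Suc_I2 elim: relpowp_Suc_E2)
      then show ?thesis using Suc.prems by simp blast
    qed
    finally show ?case .
  qed
  note steps = this
  have "a \<in> D" if "z \<in> D" "(?S ^^ k) z a" for z a
    using that by (cases k) auto
  moreover have "ssat D I e (at_numeral k q) \<longleftrightarrow>
      (\<forall>z\<in>D. zero z \<longrightarrow> (\<forall>a. (?S ^^ k) z a \<longrightarrow> ssat D I (\<lambda>_. a) q))"
    using steps[of "case_nat _ e"] by (simp add: at_numeral_def)
  ultimately show ?thesis unfolding std_def by blast
qed

lemma ssat_U_axiom:
  "ssat D I e (U_axiom d) \<longleftrightarrow> (\<forall>a\<in>D. I 0 [a] \<longleftrightarrow> (\<exists>z\<in>D. zero z \<and> G d a z))"
  by (simp add: U_axiom_def eval_nat_numeral)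

lemma ssat_never_zero:
  "ssat D I (\<lambda>_. a) (never_zero t) \<longleftrightarrow>
    (\<forall>y\<in>D. \<forall>w\<in>D. \<forall>z\<in>D. P y a w \<longrightarrow> zero z \<longrightarrow> \<not> G t w z)"
  by (simp add: never_zero_def eval_nat_numeral)

end

lemma subterms_trans: "s \<in> set (subterms t) \<Longrightarrow> set (subterms s) \<subseteq> set (subterms t)"
  by (induction t) auto

text \<open>
  The model is cut off above everything that occurs in the computation showing the zero of \<open>t\<close>.
\<close>

lemma reduction_refuted_finite:
  assumes "regular t" "reval t (pe y k) = 0"
  obtains N where "\<not> ssat {..N} (finite_int d N) (\<lambda>_. 0) (reduction d t k)"
proof -
  obtain K where K: "bounded_eval K t (pe y k) 0" using bounded_eval_total[OF assms(1)] assms(2) by metis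
  define N where "N = K + pe y k"
  interpret finite_arith d N .
  have le: "y \<in> {..N}" "k \<in> {..N}" "pe y k \<in> {..N}"
    using le_prod_encode_1[of y k] le_prod_encode_2[of k y] by (auto simp: N_def)
  have "bounded_eval N t (pe y k) 0" using bounded_eval_mono[OF K] by (simp add: N_def)
  then have "\<not> ssat {..N} (finite_int d N) (\<lambda>_. k) (never_zero t)"
    unfolding ssat_never_zero using le by auto
  moreover have "std k k" using le by simp
  ultimately have "\<not> ssat {..N} (finite_int d N) (\<lambda>_. 0) (at_numeral k (never_zero t))"
    unfolding ssat_at_numeral[OF sfv_never_zero] by blast
  moreover have "list_all (ssat {..N} (finite_int d N) (\<lambda>_. 0)) (axioms d t)"
  proof -
    have "ssat {..N} (finite_int d N) e (graph_axiom s)" for e s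
      unfolding ssat_graph_axiom using bounded_eval_clause by simp
    moreover have "ssat {..N} (finite_int d N) e (U_axiom d)" for e
      unfolding ssat_U_axiom by auto
    ultimately show ?thesis
      unfolding axioms_def using order_axioms pairing_axioms by (auto simp: list_all_iff)
  qed
  ultimately show thesis using that unfolding reduction_def ssat_foldr_SImp by blast
qed

text \<open>
  If there is no zero, every structure that refutes the sentence has a nonstandard element where
  the zero should be; hence it has elements for all the numbers, and the predicate \<open>sU\<close> in it
  defines the zeros of the function denoted by \<open>d\<close>.
\<close>

lemma reduction_refuted_infinite:
  assumes "regular t" "regular d" "\<And>y. reval t (pe y k) \<noteq> 0"
    and refuted: "\<not> ssat D I e (reduction d t k)"
  shows "ssat D I e' (at_numeral j (sU 0)) \<longleftrightarrow> reval d j = 0"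
proof -
  interpret arith D I .
  define F where "F = set (subterms d @ subterms t)"
  have ax: "list_all (ssat D I e) (axioms d t)"
    and concl: "\<not> ssat D I e (at_numeral k (never_zero t))"
    using refuted unfolding reduction_def ssat_foldr_SImp by auto
  interpret graph_arith D I e F
  proof
    show "list_all (ssat D I e) order_axioms" "list_all (ssat D I e) pairing_axioms"
      using ax by (auto simp: axioms_def)
    show "G s a b = clause s a b" if "s \<in> F" "a \<in> D" "b \<in> D" for s a b
    proof -
      have "ssat D I e (graph_axiom s)" using ax that by (auto simp: axioms_def F_def list_all_iff)
      then show ?thesis using that unfolding ssat_graph_axiom by blast
    qed
    show "set (subterms s) \<subseteq> F" if "s \<in> F" for s
      using that subterms_trans unfolding F_def by fastforce
  qed
  have F: "d \<in> F" "t \<in> F" using subterm_self by (auto simp: F_def)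
  obtain a y w z where a: "std k a" and y: "y \<in> D" "w \<in> D" "z \<in> D" "P y a w" "zero z" "G t w z"
    using concl unfolding ssat_at_numeral[OF sfv_never_zero] ssat_never_zero by blast
  have nonstd: "\<not> std i y" for i
  proof
    assume "std i y"
    then have "std (reval t (pe i k)) z"
      using graph_sound[OF F(2) assms(1)] P_std_args a y by blast
    then show False using std_zero_iff y(5) assms(3) by blast
  qed
  have inhabited: "\<exists>b. std i b" for i
    using std_trichotomy[OF y(1), of i] nonstd by blast
  have U: "I 0 [b] \<longleftrightarrow> reval d j = 0" if b: "std j b" for b
  proof -
    have "I 0 [b] \<longleftrightarrow> (\<exists>z\<in>D. zero z \<and> G d b z)"
      using ax std_D[OF b] unfolding axioms_def by (simp add: ssat_U_axiom)
    also have "\<dots> \<longleftrightarrow> reval d j = 0"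
      using graph_sound[OF F(1) assms(2) b] graph_complete[OF inhabited F(1) assms(2) b] std_zero_iff
      by (metis std_D inhabited std_0)
    finally show ?thesis .
  qed
  have "ssat D I e' (at_numeral j (sU 0)) \<longleftrightarrow> (\<forall>b. std j b \<longrightarrow> I 0 [b])"
    by (subst ssat_at_numeral) auto
  then show ?thesis using U inhabited by blast
qed

section \<open>Renaming, substitution and blocks of quantifiers\<close>

lemma val_rename_tm: "val M e (rename_tm r t) = val M (\<lambda>n. e (r n)) t"
proof (induction t)
  case (Fn f ts)
  then have "map (val M e) (map (rename_tm r) ts) = map (val M (\<lambda>n. e (r n))) ts" by simp
  then show ?case by (simp del: map_map map_eq_conv)
qed simp

lemma sat_rename: "sat M e (rename r p) \<longleftrightarrow> sat M (\<lambda>n. e (r n)) p"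
proof (induction p arbitrary: r e)
  case (Rel R ts)
  have "map (val M e) (map (rename_tm r) ts) = map (val M (\<lambda>n. e (r n))) ts"
    by (simp add: val_rename_tm)
  then show ?case by (simp del: map_map map_eq_conv)
next
  case (All p)
  have "(\<lambda>n. case_nat x e (case_nat 0 (\<lambda>n. Suc (r n)) n)) = case_nat x (\<lambda>n. e (r n))" for x
    by (auto split: nat.split)
  then show ?case using All by simp
qed (simp_all add: val_rename_tm)

lemma wf_rename_tm: "wf_tm L (rename_tm r t) = wf_tm L t"
  by (induction t) (auto simp: list_all_iff)

lemma wf_rename [simp]: "wf_fm L (rename r p) = wf_fm L p"
  by (induction p arbitrary: r) (auto simp: list_all_iff wf_rename_tm)

lemma fv_rename_tm: "fv_tm (rename_tm r t) = r ` fv_tm t"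
  by (induction t) auto

lemma fv_rename: "fv (rename r p) = r ` fv p"
proof (induction p arbitrary: r)
  case (All p)
  have "fv (rename r (All p)) = {n. Suc n \<in> (case_nat 0 (\<lambda>n. Suc (r n))) ` fv p}"
    by (simp add: All)
  also have "\<dots> = r ` {n. Suc n \<in> fv p}"
  proof -
    have "Suc n \<in> case_nat 0 (\<lambda>n. Suc (r n)) ` A \<longleftrightarrow> n \<in> r ` {n. Suc n \<in> A}" for n A
    proof
      assume "Suc n \<in> case_nat 0 (\<lambda>n. Suc (r n)) ` A"
      then obtain m where "m \<in> A" "Suc n = case_nat 0 (\<lambda>n. Suc (r n)) m" by blast
      then show "n \<in> r ` {n. Suc n \<in> A}" by (cases m) auto
    next
      assume "n \<in> r ` {n. Suc n \<in> A}"
      then obtain m where "Suc m \<in> A" "n = r m" by blast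
      then show "Suc n \<in> case_nat 0 (\<lambda>n. Suc (r n)) ` A" by (intro image_eqI[of _ _ "Suc m"]) auto
    qed
    then show ?thesis by blast
  qed
  finally show ?case by simp
qed (auto simp: fv_rename_tm)

lemma rename_tm_cong: "(\<And>n. n \<in> fv_tm t \<Longrightarrow> r n = r' n) \<Longrightarrow> rename_tm r t = rename_tm r' t"
  by (induction t) auto

lemma rename_cong: "(\<And>n. n \<in> fv p \<Longrightarrow> r n = r' n) \<Longrightarrow> rename r p = rename r' p"
proof (induction p arbitrary: r r')
  case (Eq s t)
  then show ?case using rename_tm_cong by (metis UnCI fv.simps(2) rename.simps(2))
next
  case (Rel R ts)
  then show ?case by (auto intro!: rename_tm_cong)
next
  case (Imp p q)
  then show ?case by (metis UnCI fv.simps(4) rename.simps(4))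
next
  case (All p)
  have "rename (case_nat 0 (\<lambda>n. Suc (r n))) p = rename (case_nat 0 (\<lambda>n. Suc (r' n))) p"
    using All.prems by (intro All.IH) (auto split: nat.split)
  then show ?case by simp
qed simp

primrec subst_tm :: "(nat \<Rightarrow> tm) \<Rightarrow> tm \<Rightarrow> tm" where
  "subst_tm s (Var n) = s n"
| "subst_tm s (Fn f ts) = Fn f (map (subst_tm s) ts)"

primrec subst :: "(nat \<Rightarrow> tm) \<Rightarrow> fm \<Rightarrow> fm" where
  "subst s Bot = Bot"
| "subst s (Eq t u) = Eq (subst_tm s t) (subst_tm s u)"
| "subst s (Rel R ts) = Rel R (map (subst_tm s) ts)"
| "subst s (Imp p q) = Imp (subst s p) (subst s q)"
| "subst s (All p) = All (subst (case_nat (Var 0) (\<lambda>n. rename_tm Suc (s n))) p)"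

lemma val_subst_tm: "val M e (subst_tm s t) = val M (\<lambda>n. val M e (s n)) t"
proof (induction t)
  case (Fn f ts)
  then have "map (val M e) (map (subst_tm s) ts) = map (val M (\<lambda>n. val M e (s n))) ts" by simp
  then show ?case by (simp del: map_map map_eq_conv)
qed simp

lemma sat_subst: "sat M e (subst s p) \<longleftrightarrow> sat M (\<lambda>n. val M e (s n)) p"
proof (induction p arbitrary: s e)
  case (Rel R ts)
  have "map (val M e) (map (subst_tm s) ts) = map (val M (\<lambda>n. val M e (s n))) ts"
    by (simp add: val_subst_tm)
  then show ?case by (simp del: map_map map_eq_conv)
next
  case (All p)
  have "(\<lambda>n. val M (case_nat x e) (case_nat (Var 0) (\<lambda>n. rename_tm Suc (s n)) n)) =
      case_nat x (\<lambda>n. val M e (s n))" for x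
    by (auto split: nat.split simp: val_rename_tm)
  then show ?case using All by simp
qed (simp_all add: val_subst_tm)

lemma wf_subst_tm: "(\<And>n. wf_tm L (s n)) \<Longrightarrow> wf_tm L t \<Longrightarrow> wf_tm L (subst_tm s t)"
  by (induction t) (auto simp: list_all_iff)

lemma wf_subst: "(\<And>n. wf_tm L (s n)) \<Longrightarrow> wf_fm L p \<Longrightarrow> wf_fm L (subst s p)"
proof (induction p arbitrary: s)
  case (All p)
  then show ?case by (auto split: nat.split simp: wf_rename_tm)
qed (auto simp: list_all_iff wf_subst_tm)

definition push :: "'a list \<Rightarrow> (nat \<Rightarrow> 'a) \<Rightarrow> nat \<Rightarrow> 'a" where
  "push as e k = (if k < length as then as ! k else e (k - length as))"

lemma push_Nil [simp]: "push [] e = e"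
  by (auto simp: push_def)

lemma push_snoc: "push as (case_nat x e) = push (as @ [x]) e"
proof
  fix k
  consider "k < length as" | "k = length as" | j where "k = Suc (length as + j)"
    by (metis less_iff_Suc_add linorder_neqE_nat)
  then show "push as (case_nat x e) k = push (as @ [x]) e k"
    by cases (auto simp: push_def nth_append)
qed

lemma range_push: "set as \<subseteq> A \<Longrightarrow> range e \<subseteq> A \<Longrightarrow> range (push as e) \<subseteq> A"
  by (auto simp: push_def)

definition tuples :: "nat \<Rightarrow> 'a set \<Rightarrow> 'a list set" where
  "tuples n A = {as. length as = n \<and> set as \<subseteq> A}"

lemma tuples_0: "tuples 0 A = {[]}"
  by (auto simp: tuples_def)

lemma tuples_Suc: "tuples (Suc n) A = (\<Union>x\<in>A. (\<lambda>as. as @ [x]) ` tuples n A)"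
proof -
  have "as \<in> tuples (Suc n) A \<longleftrightarrow> as \<in> (\<Union>x\<in>A. (\<lambda>as. as @ [x]) ` tuples n A)" for as
    unfolding tuples_def by (cases as rule: rev_cases) auto
  then show ?thesis by blast
qed

lemma sat_Alls:
  "sat M e ((All ^^ n) p) \<longleftrightarrow> (\<forall>as\<in>tuples n (carrier M). sat M (push as e) p)"
proof (induction n arbitrary: e)
  case (Suc n)
  then have "sat M e ((All ^^ Suc n) p) \<longleftrightarrow>
      (\<forall>x\<in>carrier M. \<forall>as\<in>tuples n (carrier M). sat M (push (as @ [x]) e) p)"
    by (simp add: push_snoc)
  also have "\<dots> \<longleftrightarrow> (\<forall>as\<in>tuples (Suc n) (carrier M). sat M (push as e) p)"
    by (simp add: tuples_Suc)
  finally show ?case .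
qed (simp add: tuples_0)

lemma ssat_SAlls:
  "ssat D I e ((SAll ^^ n) p) \<longleftrightarrow> (\<forall>as\<in>tuples n D. ssat D I (push as e) p)"
proof (induction n arbitrary: e)
  case (Suc n)
  then have "ssat D I e ((SAll ^^ Suc n) p) \<longleftrightarrow>
      (\<forall>x\<in>D. \<forall>as\<in>tuples n D. ssat D I (push (as @ [x]) e) p)"
    by (simp add: push_snoc)
  also have "\<dots> \<longleftrightarrow> (\<forall>as\<in>tuples (Suc n) D. ssat D I (push as e) p)"
    by (simp add: tuples_Suc)
  finally show ?case .
qed (simp add: tuples_0)

lemma wf_Alls [simp]: "wf_fm L ((All ^^ n) p) = wf_fm L p"
  by (induction n) auto

lemma fv_Alls: "fv ((All ^^ n) p) = {k. k + n \<in> fv p}"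
  by (induction n arbitrary: p) (auto simp: add.commute)

lemma sfv_SAlls: "sfv ((SAll ^^ n) p) = {k. k + n \<in> sfv p}"
  by (induction n arbitrary: p) (auto simp: add.commute)

abbreviation lenv :: "'a list \<Rightarrow> nat \<Rightarrow> 'a" where
  "lenv as \<equiv> (\<lambda>m. as ! m)"

definition formulas :: "language \<Rightarrow> nat \<Rightarrow> fm set" where
  "formulas L n = {p. wf_fm L p \<and> fv p \<subseteq> {..<n}}"

lemma formulas_Alls: "(All ^^ n) p \<in> sentences L \<longleftrightarrow> p \<in> formulas L n"
proof -
  have "{k. k + n \<in> fv p} = {} \<longleftrightarrow> fv p \<subseteq> {..<n}"
  proof
    assume *: "{k. k + n \<in> fv p} = {}"
    show "fv p \<subseteq> {..<n}"
    proof
      fix m assume "m \<in> fv p"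
      then have "\<not> n \<le> m" using * le_add_diff_inverse2[of n m] by (metis empty_iff mem_Collect_eq)
      then show "m \<in> {..<n}" by simp
    qed
  qed auto
  then show ?thesis by (auto simp: sentences_def formulas_def fv_Alls)
qed

lemma sentences_formulas: "sentences L = formulas L 0"
  by (auto simp: sentences_def formulas_def)

lemma sat_sentence:
  assumes "p \<in> sentences L" "wf_struct L M"
  shows "satisfies M p \<longleftrightarrow> sat M e p"
proof -
  obtain a where "a \<in> carrier M" using assms(2) by (auto simp: wf_struct_def)
  then have "range (\<lambda>_::nat. a) \<subseteq> carrier M" by auto
  moreover have "sat M e' p = sat M e p" for e' e
    using assms(1) by (intro sat_cong) (auto simp: sentences_def)
  ultimately show ?thesis unfolding satisfies_def by blast
qed

lemma complete_theory_model:
  assumes "is_theory L T" "complete_theory L T" "model L T M" "p \<in> sentences L"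
  shows "p \<in> T \<longleftrightarrow> satisfies M p"
proof
  assume "satisfies M p"
  show "p \<in> T"
  proof (rule ccontr)
    assume "p \<notin> T"
    then have "Neg p \<in> T" using assms(2,4) by (auto simp: complete_theory_def)
    then have "satisfies M (Neg p)" using assms(3) by (auto simp: model_def)
    moreover have wf: "wf_struct L M" using assms(3) by (simp add: model_def)
    moreover have "Neg p \<in> sentences L" using assms(4) by (simp add: sentences_def)
    ultimately show False
      using \<open>satisfies M p\<close> sat_sentence[OF _ wf, of _ undefined] assms(4) by fastforce
  qed
qed (use assms(3) in \<open>auto simp: model_def\<close>)

section \<open>Substitution instances\<close>

text \<open>
  Substitution of formulas amounts to interpreting the symbols by the relations they define.
\<close>

lemma sat_instance:
  assumes "\<And>j i. (j, i) \<in> ssyms \<phi> \<Longrightarrow> fv (\<psi> j i) \<subseteq> {..<j}"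
  shows "sat M e (instance_of \<psi> \<phi>) \<longleftrightarrow>
    ssat (carrier M) (\<lambda>i as. sat M (lenv as) (\<psi> (length as) i)) e \<phi>"
  using assms
proof (induction \<phi> arbitrary: e)
  case (SRel i vs)
  then have "fv (\<psi> (length vs) i) \<subseteq> {..<length vs}" by simp
  then have "sat M (\<lambda>m. e (vs ! m)) (\<psi> (length vs) i) \<longleftrightarrow> sat M (lenv (map e vs)) (\<psi> (length vs) i)"
    by (intro sat_cong) auto
  then show ?case by (simp add: sat_rename)
qed auto

lemma wf_instance:
  assumes "\<And>j i. (j, i) \<in> ssyms \<phi> \<Longrightarrow> wf_fm L (\<psi> j i)"
  shows "wf_fm L (instance_of \<psi> \<phi>)"
  using assms by (induction \<phi>) auto

lemma fv_instance_subset: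
  assumes "\<And>j i. (j, i) \<in> ssyms \<phi> \<Longrightarrow> fv (\<psi> j i) \<subseteq> {..<j}"
  shows "fv (instance_of \<psi> \<phi>) \<subseteq> sfv \<phi>"
  using assms
proof (induction \<phi>)
  case (SRel i vs)
  then show ?case by (fastforce simp: fv_rename)
qed fastforce+

lemma fv_instance:
  assumes "\<And>j i. (j, i) \<in> ssyms \<phi> \<Longrightarrow> fv (\<psi> j i) = {..<j}"
  shows "fv (instance_of \<psi> \<phi>) = sfv \<phi>"
  using assms
proof (induction \<phi>)
  case (SRel i vs)
  then show ?case by (auto simp: fv_rename set_conv_nth)
qed auto

lemma instance_sentence:
  assumes "sfv \<phi> = {}" "\<And>j i. (j, i) \<in> ssyms \<phi> \<Longrightarrow> \<psi> j i \<in> formulas L j"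
  shows "instance_of \<psi> \<phi> \<in> sentences L"
  using assms fv_instance_subset[of \<phi> \<psi>] wf_instance[of \<phi> L \<psi>]
  by (auto simp: sentences_def formulas_def)

section \<open>Replacing elements by tuples\<close>

text \<open>
  Variable \<open>v\<close> becomes the block of variables from \<open>n * v\<close> on.  With de Bruijn indices a block of
  \<open>n\<close> quantifiers shifts these blocks by exactly one.
\<close>

primrec tuple_fm :: "nat \<Rightarrow> sfm \<Rightarrow> sfm" where
  "tuple_fm n SBot = SBot"
| "tuple_fm n (SRel i vs) = SRel i (concat (map (\<lambda>v. [n * v..<n * v + n]) vs))"
| "tuple_fm n (SImp p q) = SImp (tuple_fm n p) (tuple_fm n q)"
| "tuple_fm n (SAll p) = (SAll ^^ n) (tuple_fm n p)"

lemma ssat_tuple_fm: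
  "ssat D I e (tuple_fm n p) \<longleftrightarrow>
     ssat (tuples n D) (\<lambda>i as. I i (concat as)) (\<lambda>v. map e [n * v..<n * v + n]) p"
proof (induction p arbitrary: e)
  case (SRel i vs)
  have "map e (concat (map (\<lambda>v. [n * v..<n * v + n]) vs)) =
      concat (map (\<lambda>v. map e [n * v..<n * v + n]) vs)"
    by (simp add: map_concat comp_def)
  then show ?case by simp
next
  case (SAll p)
  have "(\<lambda>v. map (push as e) [n * v..<n * v + n]) = case_nat as (\<lambda>v. map e [n * v..<n * v + n])"
    if "as \<in> tuples n D" for as
  proof
    fix v
    show "map (push as e) [n * v..<n * v + n] = case_nat as (\<lambda>v. map e [n * v..<n * v + n]) v"
      using that by (cases v) (auto simp: push_def tuples_def intro!: nth_equalityI)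
  qed
  then show ?case by (simp add: ssat_SAlls SAll)
qed auto

lemma sfv_tuple_fm: "k \<in> sfv (tuple_fm n p) \<Longrightarrow> 0 < n \<Longrightarrow> k div n \<in> sfv p"
proof (induction p arbitrary: k)
  case (SRel i vs)
  then obtain v where v: "v \<in> set vs" "n * v \<le> k" "k < n * v + n" by auto
  then have "k div n = v" by (intro div_nat_eqI) (auto simp: algebra_simps)
  then show ?case using v by simp
next
  case (SAll p)
  then have "k + n \<in> sfv (tuple_fm n p)" by (simp add: sfv_SAlls)
  then have "(k + n) div n \<in> sfv p" using SAll by blast
  then show ?case using SAll.prems by simp
qed auto

lemma instance_SAlls [simp]: "instance_of \<psi> ((SAll ^^ n) p) = (All ^^ n) (instance_of \<psi> p)"
  by (induction n) auto

lemma ssyms_SAlls [simp]: "ssyms ((SAll ^^ n) p) = ssyms p"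
  by (induction n) auto

section \<open>Countable categoricity and the number of formulas\<close>

lemma range_case_nat: "x \<in> A \<Longrightarrow> range e \<subseteq> A \<Longrightarrow> range (case_nat x e) \<subseteq> A"
  by (auto split: nat.splits simp: range_subsetD)

text \<open>
  The truth values that the formulas in a list take together: the classes of the partition
  of the assignments by these formulas.
\<close>

definition patterns :: "'a struct \<Rightarrow> fm list \<Rightarrow> bool list set" where
  "patterns M \<Delta> = (\<lambda>e. map (sat M e) \<Delta>) ` {e. range e \<subseteq> carrier M}"

definition unbounded_patterns :: "language \<Rightarrow> 'a struct \<Rightarrow> nat \<Rightarrow> bool" where
  "unbounded_patterns L M n \<longleftrightarrow> (\<forall>K. \<exists>\<Delta>. set \<Delta> \<subseteq> formulas L n \<and> K < card (patterns M \<Delta>))"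

lemma finite_patterns: "finite (patterns M \<Delta>)"
proof (rule finite_subset)
  show "patterns M \<Delta> \<subseteq> {bs. set bs \<subseteq> UNIV \<and> length bs = length \<Delta>}"
    by (auto simp: patterns_def)
qed (rule finite_lists_length_eq, simp)

text \<open>
  If the number of patterns is bounded, a list with the greatest number of them partitions the
  assignments so finely that no further formula separates two in the same class.
\<close>

lemma bounded_patterns_determine:
  assumes "\<not> unbounded_patterns L M n"
  obtains \<Delta> where "set \<Delta> \<subseteq> formulas L n"
    "\<And>e e' p. range e \<subseteq> carrier M \<Longrightarrow> range e' \<subseteq> carrier M \<Longrightarrow>
      map (sat M e) \<Delta> = map (sat M e') \<Delta> \<Longrightarrow> p \<in> formulas L n \<Longrightarrow> sat M e p \<longleftrightarrow> sat M e' p"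
proof -
  obtain K where K: "\<And>\<Delta>. set \<Delta> \<subseteq> formulas L n \<Longrightarrow> card (patterns M \<Delta>) \<le> K"
    using assms unfolding unbounded_patterns_def by (meson not_le)
  define c where "c = (GREATEST c. \<exists>\<Delta>. set \<Delta> \<subseteq> formulas L n \<and> card (patterns M \<Delta>) = c)"
  have "\<exists>\<Delta>. set \<Delta> \<subseteq> formulas L n \<and> card (patterns M \<Delta>) = c"
    unfolding c_def by (rule GreatestI_ex_nat[where b = K]) (use K in \<open>auto intro: exI[of _ "[]"]\<close>)
  then obtain \<Delta> where \<Delta>: "set \<Delta> \<subseteq> formulas L n" "card (patterns M \<Delta>) = c" by blast
  have max: "card (patterns M \<Gamma>) \<le> c" if "set \<Gamma> \<subseteq> formulas L n" for \<Gamma>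
    unfolding c_def by (rule Greatest_le_nat[where b = K]) (use K that in auto)
  have "sat M e p \<longleftrightarrow> sat M e' p"
    if e: "range e \<subseteq> carrier M" "range e' \<subseteq> carrier M" "map (sat M e) \<Delta> = map (sat M e') \<Delta>"
      and p: "p \<in> formulas L n" for e e' p
  proof (rule ccontr)
    assume neq: "sat M e p \<noteq> sat M e' p"
    \<comment> \<open>A formula separating the two assignments would refine the partition.\<close>
    have im: "tl ` patterns M (p # \<Delta>) = patterns M \<Delta>"
      unfolding patterns_def image_image by simp
    have "map (sat M e) (p # \<Delta>) \<in> patterns M (p # \<Delta>)" "map (sat M e') (p # \<Delta>) \<in> patterns M (p # \<Delta>)"
      using e unfolding patterns_def by blast+
    then have "\<not> inj_on tl (patterns M (p # \<Delta>))"
      using e(3) neq unfolding inj_on_def by force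
    then have "card (tl ` patterns M (p # \<Delta>)) < card (patterns M (p # \<Delta>))"
      using finite_patterns card_image_le eq_card_imp_inj_on by (metis le_neq_implies_less)
    moreover have "card (patterns M (p # \<Delta>)) \<le> c" using max \<Delta> p by simp
    ultimately show False using im \<Delta> by simp
  qed
  then show thesis using that \<Delta> by blast
qed

definition same_type :: "language \<Rightarrow> 'a struct \<Rightarrow> 'b struct \<Rightarrow> nat \<Rightarrow> (nat \<Rightarrow> 'a) \<Rightarrow> (nat \<Rightarrow> 'b) \<Rightarrow> bool" where
  "same_type L M N k e e' \<longleftrightarrow> (\<forall>p\<in>formulas L k. sat M e p \<longleftrightarrow> sat N e' p)"

lemma same_type_sym: "same_type L M N k e e' \<longleftrightarrow> same_type L N M k e' e"
  by (auto simp: same_type_def)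

definition conjunction :: "fm list \<Rightarrow> fm" where
  "conjunction ps = Neg (foldr (\<lambda>p q. Imp p q) ps Bot)"

lemma sat_conjunction: "sat M e (conjunction ps) \<longleftrightarrow> (\<forall>p\<in>set ps. sat M e p)"
  by (induction ps) (auto simp: conjunction_def)

lemma formulas_connectives [simp]:
  "Bot \<in> formulas L n" "Imp p q \<in> formulas L n \<longleftrightarrow> p \<in> formulas L n \<and> q \<in> formulas L n"
  by (auto simp: formulas_def)

lemma conjunction_formula: "set ps \<subseteq> formulas L n \<Longrightarrow> conjunction ps \<in> formulas L n"
  by (induction ps) (auto simp: conjunction_def)

lemma All_formula: "p \<in> formulas L (Suc n) \<Longrightarrow> All p \<in> formulas L n"
  by (auto simp: formulas_def)

text \<open>
  When finitely many formulas determine all the others, the type of a tuple with one more element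
  is isolated by a formula, and a partial matching of elements extends.
\<close>

lemma same_type_extend:
  assumes elem: "\<And>p. p \<in> sentences L \<Longrightarrow> satisfies M p \<longleftrightarrow> satisfies N p"
    and wf: "wf_struct L M" "wf_struct L N"
    and bounded: "\<not> unbounded_patterns L M (Suc k)"
    and e: "range e \<subseteq> carrier M" "range e' \<subseteq> carrier N" "same_type L M N k e e'"
    and a: "a \<in> carrier M"
  shows "\<exists>b\<in>carrier N. same_type L M N (Suc k) (case_nat a e) (case_nat b e')"
proof -
  obtain \<Delta> where \<Delta>: "set \<Delta> \<subseteq> formulas L (Suc k)"
    "\<And>e e' p. range e \<subseteq> carrier M \<Longrightarrow> range e' \<subseteq> carrier M \<Longrightarrow>
      map (sat M e) \<Delta> = map (sat M e') \<Delta> \<Longrightarrow> p \<in> formulas L (Suc k) \<Longrightarrow> sat M e p \<longleftrightarrow> sat M e' p"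
    by (rule bounded_patterns_determine[OF bounded]) blast
  define ae where "ae = case_nat a e"
  have ae: "range ae \<subseteq> carrier M" unfolding ae_def using a e(1) by (rule range_case_nat)
  define \<chi> where "\<chi> = conjunction (map (\<lambda>p. if sat M ae p then p else Neg p) \<Delta>)"
  have \<chi>: "\<chi> \<in> formulas L (Suc k)"
    unfolding \<chi>_def using \<Delta>(1) by (intro conjunction_formula) auto
  have sat_\<chi>: "sat M f \<chi> \<longleftrightarrow> map (sat M f) \<Delta> = map (sat M ae) \<Delta>" for f
    unfolding \<chi>_def sat_conjunction list.set_map ball_simps map_eq_conv
    by (intro ball_cong) auto
  have "sat M ae \<chi>" by (simp add: sat_\<chi>)
  then have "\<not> sat M e (All (Neg \<chi>))" using a by (auto simp: ae_def)
  moreover have "All (Neg \<chi>) \<in> formulas L k" using \<chi> by (intro All_formula) simp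
  ultimately have "\<not> sat N e' (All (Neg \<chi>))" using e(3) unfolding same_type_def by blast
  then obtain b where b: "b \<in> carrier N" "sat N (case_nat b e') \<chi>" by auto
  have isolated: "sat N (case_nat b e') p" if p: "p \<in> formulas L (Suc k)" "sat M ae p" for p
  proof -
    have sen: "(All ^^ Suc k) (Imp \<chi> p) \<in> sentences L" using \<chi> p unfolding formulas_Alls by simp
    have "sat M (push as e) (Imp \<chi> p)" if "as \<in> tuples (Suc k) (carrier M)" for as
    proof -
      have "range (push as e) \<subseteq> carrier M" using that e(1) by (intro range_push) (auto simp: tuples_def)
      then show ?thesis using \<Delta>(2)[of "push as e" ae p] sat_\<chi> p ae by simp
    qed
    then have "sat M e ((All ^^ Suc k) (Imp \<chi> p))" unfolding sat_Alls by blast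
    then have "satisfies N ((All ^^ Suc k) (Imp \<chi> p))"
      using elem sen sat_sentence[OF sen] wf by blast
    then have sat: "sat N f ((All ^^ Suc k) (Imp \<chi> p))" for f
      using sat_sentence[OF sen] wf by blast
    define bs where "bs = map (case_nat b e') [0..<Suc k]"
    have "bs \<in> tuples (Suc k) (carrier N)"
      using range_case_nat[OF b(1) e(2)] by (auto simp: bs_def tuples_def simp del: upt_Suc)
    then have "sat N (push bs e') (Imp \<chi> p)" using sat unfolding sat_Alls by blast
    moreover have "sat N (push bs e') q = sat N (case_nat b e') q" if "q \<in> formulas L (Suc k)" for q
      by (rule sat_cong) (use that in \<open>auto simp: bs_def push_def formulas_def simp del: upt_Suc\<close>)
    ultimately show ?thesis using b \<chi> p by simp
  qed
  have "same_type L M N (Suc k) ae (case_nat b e')"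
    unfolding same_type_def
  proof
    fix p assume p: "p \<in> formulas L (Suc k)"
    show "sat M ae p \<longleftrightarrow> sat N (case_nat b e') p"
      using isolated[of p] isolated[of "Neg p"] p by auto
  qed
  then show ?thesis using b by (auto simp: ae_def)
qed

text \<open>
  At even steps the next element of \<open>M\<close> is matched, at odd steps the next element of \<open>N\<close>.  The newest
  elements are at the front of the assignments, where \<open>All\<close> binds; read backwards, they are the
  enumerations.
\<close>

lemma back_and_forth:
  fixes M N :: "nat struct"
  assumes elem: "\<And>p. p \<in> sentences L \<Longrightarrow> satisfies M p \<longleftrightarrow> satisfies N p"
    and wf: "wf_struct L M" "wf_struct L N"
    and bounded: "\<And>k. \<not> unbounded_patterns L M k" "\<And>k. \<not> unbounded_patterns L N k"
  obtains \<alpha> \<beta> where "range \<alpha> = carrier M" "range \<beta> = carrier N"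
    "\<And>p. wf_fm L p \<Longrightarrow> sat M \<alpha> p \<longleftrightarrow> sat N \<beta> p"
proof -
  have ne: "carrier M \<noteq> {}" "carrier N \<noteq> {}" using wf by (auto simp: wf_struct_def)
  define u where "u = from_nat_into (carrier M)"
  define v where "v = from_nat_into (carrier N)"
  have u: "range u = carrier M" and v: "range v = carrier N"
    using ne by (auto simp: u_def v_def)
  define P where "P = (\<lambda>k s. range (fst s) \<subseteq> carrier M \<and> range (snd s) \<subseteq> carrier N \<and>
    same_type L M N k (fst s) (snd s))"
  define Q where "Q = (\<lambda>k s s'. \<exists>a b. fst s' = case_nat a (fst s) \<and> snd s' = case_nat b (snd s) \<and>
    (even k \<longrightarrow> a = u (k div 2)) \<and> (odd k \<longrightarrow> b = v (k div 2)))"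
  have "\<exists>s. \<forall>k. P k (s k) \<and> Q k (s k) (s (Suc k))"
  proof (rule dependent_nat_choice)
    have "same_type L M N 0 u v"
      unfolding same_type_def sentences_formulas[symmetric]
      using elem sat_sentence[OF _ wf(1)] sat_sentence[OF _ wf(2)] by metis
    then show "\<exists>s. P 0 s" using u v unfolding P_def by (intro exI[of _ "(u, v)"]) auto
  next
    fix s k assume P: "P k s"
    then have Pk: "range (fst s) \<subseteq> carrier M" "range (snd s) \<subseteq> carrier N"
      "same_type L M N k (fst s) (snd s)" by (auto simp: P_def)
    show "\<exists>s'. P (Suc k) s' \<and> Q k s s'"
    proof (cases "even k")
      case True
      have a: "u (k div 2) \<in> carrier M" using u by auto
      obtain b where "b \<in> carrier N"
        "same_type L M N (Suc k) (case_nat (u (k div 2)) (fst s)) (case_nat b (snd s))"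
        using same_type_extend[OF elem wf bounded(1) Pk a] by blast
      moreover from this have "range (case_nat (u (k div 2)) (fst s)) \<subseteq> carrier M"
        "range (case_nat b (snd s)) \<subseteq> carrier N"
        using Pk a by (simp_all add: range_case_nat)
      ultimately show ?thesis using True unfolding P_def Q_def
        by (intro exI[of _ "(case_nat (u (k div 2)) (fst s), case_nat b (snd s))"]) auto
    next
      case False
      have b: "v (k div 2) \<in> carrier N" using v by auto
      obtain a where "a \<in> carrier M"
        "same_type L N M (Suc k) (case_nat (v (k div 2)) (snd s)) (case_nat a (fst s))"
        using same_type_extend[OF elem[symmetric] wf(2,1) bounded(2) Pk(2,1)] Pk(3) b
        unfolding same_type_sym[of L N] by blast
      moreover from this have "range (case_nat a (fst s)) \<subseteq> carrier M"
        "range (case_nat (v (k div 2)) (snd s)) \<subseteq> carrier N"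
        using Pk b by (simp_all add: range_case_nat)
      ultimately show ?thesis using False unfolding P_def Q_def same_type_sym[of L N]
        by (intro exI[of _ "(case_nat a (fst s), case_nat (v (k div 2)) (snd s))"]) auto
    qed
  qed
  then obtain s where s: "\<And>k. P k (s k)" "\<And>k. Q k (s k) (s (Suc k))" by blast
  define \<alpha> where "\<alpha> k = fst (s (Suc k)) 0" for k
  define \<beta> where "\<beta> k = snd (s (Suc k)) 0" for k
  have stack: "fst (s k) m = \<alpha> (k - Suc m) \<and> snd (s k) m = \<beta> (k - Suc m)" if "m < k" for k m
    using that
  proof (induction k arbitrary: m)
    case (Suc k)
    then show ?case using s(2)[of k] unfolding Q_def by (cases m) (auto simp: \<alpha>_def \<beta>_def)
  qed simp
  have "range \<alpha> = carrier M"
  proof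
    show "range \<alpha> \<subseteq> carrier M" using s(1) unfolding P_def \<alpha>_def by blast
    have "u j = \<alpha> (2 * j)" for j using s(2)[of "2 * j"] by (auto simp: Q_def \<alpha>_def)
    then show "carrier M \<subseteq> range \<alpha>" unfolding u[symmetric] by auto
  qed
  moreover have "range \<beta> = carrier N"
  proof
    show "range \<beta> \<subseteq> carrier N" using s(1) unfolding P_def \<beta>_def by blast
    have "v j = \<beta> (2 * j + 1)" for j using s(2)[of "2 * j + 1"] by (auto simp: Q_def \<beta>_def)
    then show "carrier N \<subseteq> range \<beta>" unfolding v[symmetric] by auto
  qed
  moreover have "sat M \<alpha> p \<longleftrightarrow> sat N \<beta> p" if "wf_fm L p" for p
  proof -
    obtain k where k: "fv p \<subseteq> {..<k}" using finite_fv[of p] finite_nat_iff_bounded by auto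
    define r where "r m = k - Suc m" for m
    have r: "fst (s k) (r m) = \<alpha> m" "snd (s k) (r m) = \<beta> m" if "m \<in> fv p" for m
      using stack[of "r m" k] that k by (auto simp: r_def)
    have "sat M \<alpha> p \<longleftrightarrow> sat M (fst (s k)) (rename r p)"
      unfolding sat_rename by (rule sat_cong) (simp add: r)
    also have "\<dots> \<longleftrightarrow> sat N (snd (s k)) (rename r p)"
    proof -
      have "rename r p \<in> formulas L k"
        using that k by (auto simp: formulas_def fv_rename r_def)
      then show ?thesis using s(1)[of k] unfolding P_def same_type_def by blast
    qed
    also have "\<dots> \<longleftrightarrow> sat N \<beta> p"
      unfolding sat_rename by (rule sat_cong) (simp add: r)
    finally show ?thesis .
  qed
  ultimately show thesis using that by blast
qed

locale equal_enumerations =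
  fixes L :: language and M :: "'a struct" and N :: "'b struct" and \<alpha> \<beta>
  assumes wf: "wf_struct L M" "wf_struct L N"
    and range: "range \<alpha> = carrier M" "range \<beta> = carrier N"
    and sat_iff: "\<And>p. wf_fm L p \<Longrightarrow> sat M \<alpha> p \<longleftrightarrow> sat N \<beta> p"
begin

text \<open>
  Without identity, matching only the enumerated pairs would not give a correspondence, because the
  value of a function at matched arguments need only be indiscernible from the matched element.
  So all pairs of elements that behave alike over the enumerations are related.
\<close>

definition alike :: "'a \<Rightarrow> 'b \<Rightarrow> bool" where
  "alike x y \<longleftrightarrow> x \<in> carrier M \<and> y \<in> carrier N \<and>
    (\<forall>p. wf_fm L p \<longrightarrow> sat M (case_nat x \<alpha>) p = sat N (case_nat y \<beta>) p)"

definition indiscernible :: "'b \<Rightarrow> 'b \<Rightarrow> bool" where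
  "indiscernible y z \<longleftrightarrow> (\<forall>p e. wf_fm L p \<longrightarrow> range e \<subseteq> carrier N \<longrightarrow>
    sat N (case_nat y e) p = sat N (case_nat z e) p)"

lemma alike_carrier: "alike x y \<Longrightarrow> x \<in> carrier M \<and> y \<in> carrier N"
  by (simp add: alike_def)

lemma alike_enumerated: "alike (\<alpha> i) (\<beta> i)"
proof -
  have "sat M (case_nat (\<alpha> i) \<alpha>) p = sat N (case_nat (\<beta> i) \<beta>) p" if "wf_fm L p" for p
  proof -
    have "(\<lambda>n. \<gamma> (case_nat i (\<lambda>n. n) n)) = case_nat (\<gamma> i) \<gamma>" for \<gamma> :: "nat \<Rightarrow> 'c"
      by (auto split: nat.split)
    note eq = this
    show ?thesis
      using sat_iff[of "rename (case_nat i (\<lambda>n. n)) p"] that unfolding sat_rename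
      by (simp add: comp_def eq[of \<alpha>] eq[of \<beta>] split: nat.split)
  qed
  then show ?thesis using range by (auto simp: alike_def)
qed

lemma alike_indiscernible:
  assumes "alike (\<alpha> i) y"
  shows "indiscernible y (\<beta> i)"
  unfolding indiscernible_def
proof (intro allI impI)
  fix p and e :: "nat \<Rightarrow> 'b" assume p: "wf_fm L p" and e: "range e \<subseteq> carrier N"
  then have "\<forall>n. \<exists>k. e n = \<beta> k" using range by (metis image_iff range_subsetD)
  then obtain r where r: "\<And>n. e n = \<beta> (r n)" by metis
  define s where "s = case_nat 0 (\<lambda>n. Suc (r n))"
  have eq: "(\<lambda>n. case_nat z \<beta> (s n)) = case_nat z e" for z
    by (auto simp: s_def r split: nat.split)
  have "sat N (case_nat z \<beta>) (rename s p) \<longleftrightarrow> sat M (case_nat (\<alpha> i) \<alpha>) (rename s p)"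
    if "alike (\<alpha> i) z" for z
    using that p unfolding alike_def by simp
  from this[OF assms] this[OF alike_enumerated] show "sat N (case_nat y e) p = sat N (case_nat (\<beta> i) e) p"
    unfolding sat_rename eq by simp
qed

lemma indiscernible_sat:
  assumes p: "wf_fm L p" and e: "range e \<subseteq> carrier N" "range e' \<subseteq> carrier N"
    and ind: "\<And>m. indiscernible (e m) (e' m)"
  shows "sat N e p \<longleftrightarrow> sat N e' p"
proof -
  define E where "E k m = (if m < k then e' m else e m)" for k m :: nat
  have E: "range (E k) \<subseteq> carrier N" for k using e by (auto simp: E_def)
  have "sat N (E k) p \<longleftrightarrow> sat N e p" for k
  proof (induction k)
    case (Suc k)
    define s where "s m = (if m = k then 0 else Suc m)" for m
    have "(\<lambda>m. case_nat (e k) (E k) (s m)) = E k" "(\<lambda>m. case_nat (e' k) (E k) (s m)) = E (Suc k)"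
      by (auto simp: s_def E_def)
    moreover have "sat N (case_nat (e k) (E k)) (rename s p) = sat N (case_nat (e' k) (E k)) (rename s p)"
      using ind[of k] E p unfolding indiscernible_def by simp
    ultimately show ?case using Suc unfolding sat_rename by simp
  qed (simp add: E_def)
  moreover obtain k where k: "fv p \<subseteq> {..<k}" using finite_fv[of p] finite_nat_iff_bounded by auto
  moreover have "sat N (E k) p \<longleftrightarrow> sat N e' p"
    by (rule sat_cong) (use k in \<open>auto simp: E_def\<close>)
  ultimately show ?thesis by blast
qed

lemma indiscernible_list:
  assumes "list_all2 alike xs ys"
  obtains r where "xs = map \<alpha> r"
    "\<And>p. wf_fm L p \<Longrightarrow> sat N (push ys \<beta>) p \<longleftrightarrow> sat N (push (map \<beta> r) \<beta>) p"
proof -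
  have "\<forall>x\<in>set xs. \<exists>i. x = \<alpha> i"
  proof
    fix x assume "x \<in> set xs"
    then obtain k where "k < length xs" "x = xs ! k" by (auto simp: in_set_conv_nth)
    then have "alike x (ys ! k)" using assms list_all2_nthD by blast
    then show "\<exists>i. x = \<alpha> i" using range unfolding alike_def by blast
  qed
  then obtain r where r: "xs = map \<alpha> r" by (metis ex_map_conv)
  have len: "length r = length ys" using assms r by (auto dest: list_all2_lengthD)
  have ys: "alike (\<alpha> (r ! i)) (ys ! i)" if "i < length ys" for i
    using assms that len unfolding r list_all2_conv_all_nth by simp
  have "set ys \<subseteq> carrier N"
    using ys unfolding alike_def in_set_conv_nth subset_iff by blast
  moreover have "indiscernible (push ys \<beta> m) (push (map \<beta> r) \<beta> m)" for m
    using alike_indiscernible[OF ys] len by (auto simp: push_def indiscernible_def)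
  ultimately have "sat N (push ys \<beta>) p \<longleftrightarrow> sat N (push (map \<beta> r) \<beta>) p" if "wf_fm L p" for p
    using range that by (intro indiscernible_sat range_push) auto
  then show thesis using that r by blast
qed

text \<open>
  A formula about the value of \<open>f\<close> becomes a formula about its arguments by substituting the
  term; indiscernible arguments cannot be told apart by it.
\<close>

lemma alike_fun:
  assumes f: "(length xs, f) \<in> funs L" and xs: "list_all2 alike xs ys"
  shows "alike (fun_int M f xs) (fun_int N f ys)"
proof -
  obtain r where r: "xs = map \<alpha> r"
    "\<And>p. wf_fm L p \<Longrightarrow> sat N (push ys \<beta>) p \<longleftrightarrow> sat N (push (map \<beta> r) \<beta>) p"
    using indiscernible_list[OF xs] by blast
  have len: "length xs = length ys" "length r = length ys" using xs r by (auto dest: list_all2_lengthD)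
  have "set xs \<subseteq> carrier M" "set ys \<subseteq> carrier N"
    using xs unfolding list_all2_conv_all_nth alike_def in_set_conv_nth subset_iff by metis+
  then have carrier: "fun_int M f xs \<in> carrier M" "fun_int N f ys \<in> carrier N"
    using wf f len by (auto intro: wf_structD)
  have "sat M (case_nat (fun_int M f xs) \<alpha>) p = sat N (case_nat (fun_int N f ys) \<beta>) p"
    if p: "wf_fm L p" for p
  proof -
    define s where "s = case_nat (Fn f (map Var r)) Var"
    define s' where "s' = case_nat (Fn f (map Var [0..<length ys])) (\<lambda>m. Var (length ys + m))"
    have "wf_tm L (s n)" "wf_tm L (s' n)" for n
      using f len by (auto simp: s_def s'_def list_all_iff split: nat.split)
    then have wf: "wf_fm L (subst s p)" "wf_fm L (subst s' p)" using p by (auto intro: wf_subst)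
    have "(\<lambda>n. val M \<alpha> (s n)) = case_nat (fun_int M f xs) \<alpha>"
      by (auto simp: s_def r comp_def split: nat.split)
    then have "sat M (case_nat (fun_int M f xs) \<alpha>) p \<longleftrightarrow> sat M \<alpha> (subst s p)" by (simp add: sat_subst)
    also have "\<dots> \<longleftrightarrow> sat N \<beta> (subst s p)" using sat_iff wf by blast
    also have "(\<lambda>n. val N \<beta> (s n)) = case_nat (fun_int N f (map \<beta> r)) \<beta>"
      by (auto simp: s_def comp_def split: nat.split)
    then have "sat N \<beta> (subst s p) \<longleftrightarrow> sat N (case_nat (fun_int N f (map \<beta> r)) \<beta>) p"
      by (simp add: sat_subst)
    also have "\<dots> \<longleftrightarrow> sat N (push (map \<beta> r) \<beta>) (subst s' p)"
    proof -
      have "map (\<lambda>k. push (map \<beta> r) \<beta> k) [0..<length ys] = map \<beta> r"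
        using len by (auto simp: push_def intro!: nth_equalityI)
      then have "(\<lambda>n. val N (push (map \<beta> r) \<beta>) (s' n)) = case_nat (fun_int N f (map \<beta> r)) \<beta>"
        using len by (auto simp: s'_def push_def comp_def split: nat.split)
      then show ?thesis by (simp add: sat_subst)
    qed
    also have "\<dots> \<longleftrightarrow> sat N (push ys \<beta>) (subst s' p)" using r(2) wf by blast
    also have "\<dots> \<longleftrightarrow> sat N (case_nat (fun_int N f ys) \<beta>) p"
    proof -
      have "map (\<lambda>k. push ys \<beta> k) [0..<length ys] = ys"
        by (auto simp: push_def intro!: nth_equalityI)
      then have "(\<lambda>n. val N (push ys \<beta>) (s' n)) = case_nat (fun_int N f ys) \<beta>"
        by (auto simp: s'_def push_def comp_def split: nat.split)
      then show ?thesis by (simp add: sat_subst)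
    qed
    finally show ?thesis .
  qed
  then show ?thesis using carrier by (simp add: alike_def)
qed

lemma alike_rel:
  assumes R: "(length xs, R) \<in> rels L" and xs: "list_all2 alike xs ys"
  shows "rel_int M R xs \<longleftrightarrow> rel_int N R ys"
proof -
  obtain r where r: "xs = map \<alpha> r"
    "\<And>p. wf_fm L p \<Longrightarrow> sat N (push ys \<beta>) p \<longleftrightarrow> sat N (push (map \<beta> r) \<beta>) p"
    using indiscernible_list[OF xs] by blast
  have len: "length xs = length ys" "length r = length ys" using xs r by (auto dest: list_all2_lengthD)
  have "rel_int M R xs \<longleftrightarrow> sat M \<alpha> (Rel R (map Var r))" by (simp add: r comp_def)
  also have "\<dots> \<longleftrightarrow> sat N \<beta> (Rel R (map Var r))" 
    using sat_iff[of "Rel R (map Var r)"] R len by (simp add: list_all_iff del: sat.simps)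
  also have "\<dots> \<longleftrightarrow> rel_int N R (map \<beta> r)" by (simp add: comp_def)
  also have "\<dots> \<longleftrightarrow> sat N (push (map \<beta> r) \<beta>) (Rel R (map Var [0..<length ys]))"
  proof -
    have "map (val N (push (map \<beta> r) \<beta>)) (map Var [0..<length ys]) = map \<beta> r"
      using len by (auto simp: push_def intro!: nth_equalityI)
    then show ?thesis by (simp only: sat.simps)
  qed
  also have "\<dots> \<longleftrightarrow> sat N (push ys \<beta>) (Rel R (map Var [0..<length ys]))"
    using r(2) R len by (simp add: list_all_iff del: sat.simps)
  also have "\<dots> \<longleftrightarrow> rel_int N R ys"
  proof -
    have "map (val N (push ys \<beta>)) (map Var [0..<length ys]) = ys"
      by (auto simp: push_def intro!: nth_equalityI)
    then show ?thesis by (simp only: sat.simps)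
  qed
  finally show ?thesis .
qed

lemma correspondence_alike: "correspondence L M N alike"
proof -
  have "\<exists>y. alike x y" if "x \<in> carrier M" for x
  proof -
    obtain i where "x = \<alpha> i" using \<open>x \<in> carrier M\<close> range by (metis imageE)
    then show ?thesis using alike_enumerated by blast
  qed
  moreover have "\<exists>x. alike x y" if "y \<in> carrier N" for y
  proof -
    obtain i where "y = \<beta> i" using \<open>y \<in> carrier N\<close> range by (metis imageE)
    then show ?thesis using alike_enumerated by blast
  qed
  ultimately show ?thesis
    unfolding correspondence_def using alike_fun alike_rel alike_carrier by blast
qed

lemma alike_unique:
  assumes "identity L" "alike (\<alpha> i) y"
  shows "y = \<beta> i"
proof -
  have "range (\<lambda>_::nat. \<beta> i) \<subseteq> carrier N" using range by auto
  moreover have "wf_fm L (Eq (Var 0) (Var 1))" using assms by simp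
  ultimately have "sat N (case_nat y (\<lambda>_. \<beta> i)) (Eq (Var 0) (Var 1)) =
      sat N (case_nat (\<beta> i) (\<lambda>_. \<beta> i)) (Eq (Var 0) (Var 1))"
    using alike_indiscernible[OF assms(2)] unfolding indiscernible_def by blast
  then show ?thesis by simp
qed

end

context equal_enumerations
begin

interpretation swap: equal_enumerations L N M \<beta> \<alpha>
  using wf range sat_iff by unfold_locales auto

lemma isomorphism_alike:
  assumes "identity L"
  obtains h where "isomorphism L M N h"
proof -
  define h where "h x = (SOME y. alike x y)" for x
  have h: "alike x (h x)" if "x \<in> carrier M" for x
  proof -
    obtain i where "x = \<alpha> i" using \<open>x \<in> carrier M\<close> range by (metis imageE)
    then show ?thesis unfolding h_def using alike_enumerated by (metis someI_ex)
  qed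
  have h\<alpha>: "h (\<alpha> i) = \<beta> i" for i using h alike_unique[OF assms] range by blast
  have swap: "swap.alike y x \<longleftrightarrow> alike x y" for x y
    unfolding alike_def swap.alike_def by auto
  have h_eq: "h x = y" if xy: "alike x y" for x y
  proof -
    obtain i where "x = \<alpha> i" using xy range unfolding alike_def by (metis imageE)
    then show ?thesis using h\<alpha> alike_unique[OF assms] xy by blast
  qed
  have list: "list_all2 alike xs (map h xs)" if "xs \<in> lists (carrier M)" for xs
    using that h by (auto simp: list_all2_conv_all_nth in_lists_conv_set)
  have "bij_betw h (carrier M) (carrier N)"
    unfolding bij_betw_def
  proof
    show "inj_on h (carrier M)"
    proof (rule inj_onI)
      fix x x' assume x: "x \<in> carrier M" "x' \<in> carrier M" "h x = h x'"
      then obtain i where i: "h x = \<beta> i" using h\<alpha> range by (metis imageE)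
      then have "alike x (\<beta> i)" "alike x' (\<beta> i)" using h x by metis+
      then show "x = x'" using swap.alike_unique[OF assms] swap by metis
    qed
    show "h ` carrier M = carrier N"
      using range h\<alpha> by (metis image_cong image_image)
  qed
  moreover have "h (fun_int M f xs) = fun_int N f (map h xs)"
    if "(length xs, f) \<in> funs L" "xs \<in> lists (carrier M)" for f xs
    using h_eq alike_fun list that by blast
  moreover have "rel_int M R xs = rel_int N R (map h xs)"
    if "(length xs, R) \<in> rels L" "xs \<in> lists (carrier M)" for R xs
    using alike_rel list that by blast
  ultimately have "isomorphism L M N h" unfolding isomorphism_def by auto
  then show thesis using that by blast
qed

lemma isomorphic: "isomorphic L M N"
  unfolding isomorphic_def using correspondence_alike isomorphism_alike by auto

end

text \<open>
  One half of the Ryll-Nardzewski theorem: if the patterns were bounded in two models for all \<open>n\<close>,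
  the back-and-forth enumerations would make the models isomorphic.
\<close>

theorem not_categorical_unbounded:
  assumes "is_theory L T" "complete_theory L T" "\<not> aleph0_categorical L T"
  obtains M :: "nat struct" and n where "model L T M" "unbounded_patterns L M n"
proof -
  obtain M N :: "nat struct" where MN: "model L T M" "model L T N" "\<not> isomorphic L M N"
    using assms(3) unfolding aleph0_categorical_def by blast
  have wf: "wf_struct L M" "wf_struct L N" using MN by (auto simp: model_def)
  have elem: "satisfies M p \<longleftrightarrow> satisfies N p" if "p \<in> sentences L" for p
    using complete_theory_model[OF assms(1,2) _ that] MN by blast
  show thesis
  proof (rule ccontr)
    assume *: "\<not> thesis"
    then have "\<not> unbounded_patterns L M k" "\<not> unbounded_patterns L N k" for k
      using that MN by blast+
    then obtain \<alpha> \<beta> where "range \<alpha> = carrier M" "range \<beta> = carrier N"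
      "\<And>p. wf_fm L p \<Longrightarrow> sat M \<alpha> p \<longleftrightarrow> sat N \<beta> p"
      using back_and_forth[OF elem wf] by blast
    then interpret equal_enumerations L M N \<alpha> \<beta> using wf by unfold_locales auto
    show False using isomorphic MN by blast
  qed
qed

section \<open>Formulas in which all variables occur\<close>

lemma wf_replicate_Var: "list_all (wf_tm L) (replicate m (Var j))"
  by (simp add: list_all_iff)

lemma recfn_replicate:
  "recfn n F \<Longrightarrow> recfn n (\<lambda>xs. list_encode (replicate m (F xs)))"
  by (induction m) (auto intro: rec_intro)

text \<open>
  A formula with a free variable contains an atomic one with a variable; so there are atomic formulas in which
  exactly one given variable occurs.
\<close>

lemma atoms_exist:
  assumes "wf_fm L p" "fv p \<noteq> {}"
  obtains A where "\<And>j. wf_fm L (A j)" "\<And>j. fv (A j) = {j}" "computable_fun (\<lambda>j. code_fm (A j))"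
proof -
  have "identity L \<or> (\<exists>m R. (Suc m, R) \<in> rels L)"
    using assms
  proof (induction p)
    case (Rel R ts)
    then obtain t ts' where "ts = t # ts'" by (cases ts) auto
    then show ?case using Rel by auto
  qed auto
  then consider "identity L" | m R where "(Suc m, R) \<in> rels L" by blast
  then show thesis
  proof cases
    case 1
    have "recfn 1 (\<lambda>xs. code_fm (Eq (Var (xs ! 0)) (Var (xs ! 0))))"
      by (simp, intro rec_intro) simp_all
    then have "computable_fun (\<lambda>j. code_fm (Eq (Var j) (Var j)))"
      unfolding recfn_computable_fun .
    then show thesis using that[of "\<lambda>j. Eq (Var j) (Var j)"] 1 by simp
  next
    case 2
    have "recfn 1 (\<lambda>xs. code_fm (Rel R (replicate (Suc m) (Var (xs ! 0)))))"
      unfolding code_fm.simps map_replicate code_tm.simps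
      by (intro rec_intro recfn_replicate) simp_all
    then have "computable_fun (\<lambda>j. code_fm (Rel R (replicate (Suc m) (Var j))))"
      unfolding recfn_computable_fun .
    then show thesis
      using that[of "\<lambda>j. Rel R (replicate (Suc m) (Var j))"] 2 wf_replicate_Var[of L "Suc m"]
      by (simp add: set_replicate_conv_if)
  qed
qed

text \<open>
  The formulas substituted in a validity must contain all the displayed variables.  Prefixing
  tautologies achieves this without a change of meaning.
\<close>

primrec pad :: "(nat \<Rightarrow> fm) \<Rightarrow> nat \<Rightarrow> fm \<Rightarrow> fm" where
  "pad A 0 p = p"
| "pad A (Suc j) p = Imp (Imp (A j) (A j)) (pad A j p)"

lemma sat_pad [simp]: "sat M e (pad A j p) = sat M e p"
  by (induction j) auto

lemma wf_pad: "(\<And>j. wf_fm L (A j)) \<Longrightarrow> wf_fm L p \<Longrightarrow> wf_fm L (pad A j p)"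
  by (induction j) auto

lemma fv_pad: "(\<And>j. fv (A j) = {j}) \<Longrightarrow> fv (pad A j p) = {..<j} \<union> fv p"
  by (induction j) auto

section \<open>Renaming on codes\<close>

lemma recfn_drop2:
  assumes "recfn n F"
  shows "recfn (Suc (Suc n)) (\<lambda>zs. F (drop 2 zs))"
proof -
  define ps :: "(nat list \<Rightarrow> nat) list" where "ps = map (\<lambda>i zs. zs ! (2 + i)) [0..<n]"
  have "recfn (Suc (Suc n)) (\<lambda>zs. F (map (\<lambda>h. h zs) ps))"
    by (rule recfn_comp) (use assms in \<open>auto simp: ps_def intro: recfn_proj\<close>)
  moreover have "map (\<lambda>h. h zs) ps = drop 2 zs" if "length zs = Suc (Suc n)" for zs
    using that by (auto simp: ps_def intro!: nth_equalityI)
  ultimately show ?thesis using recfn_cong by (metis (no_types, lifting))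
qed

lemma pe_tag: "0 < k \<Longrightarrow> k + y < pe k y"
proof -
  have "n \<le> triangle n" for n by (induction n) auto
  from this[of "k + y"] show "0 < k \<Longrightarrow> ?thesis" by (simp add: prod_encode_def)
qed

definition rename_step_tm :: "nat \<Rightarrow> nat \<Rightarrow> nat \<Rightarrow> nat \<Rightarrow> nat" where
  "rename_step_tm d v z h =
    (if pfst z = 0 then
       (if pfst (psnd z) = 0
        then pe 0 (if psnd (psnd z) < d then psnd (psnd z) else lnth v (psnd (psnd z) - d) + d)
        else pe 1 (pe (pfst (psnd (psnd z))) (lnth h (z - Suc (pe 1 (psnd (psnd (psnd z))))))))
     else
       (if psnd z = 0 then 0
        else Suc (pe (lnth h (z - Suc (pe 0 (pfst (psnd z - 1)))))
                     (lnth h (z - Suc (pe 1 (psnd (psnd z - 1))))))))"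

text \<open>
  The argument is tagged: \<open>0\<close> for the code of a term, \<open>1\<close> for the code of a list of terms.  The list
  \<open>v\<close> gives the renaming outside of \<open>d\<close> quantifiers.
\<close>

definition rename_code_tm :: "nat \<Rightarrow> nat \<Rightarrow> nat \<Rightarrow> nat" where
  "rename_code_tm d v = cov (rename_step_tm d v)"

definition shift :: "nat \<Rightarrow> nat \<Rightarrow> nat \<Rightarrow> nat" where
  "shift d v n = (if n < d then n else lnth v (n - d) + d)"

lemma shift_Suc: "case_nat 0 (\<lambda>n. Suc (shift d v n)) = shift (Suc d) v"
  by (auto simp: shift_def split: nat.split)

lemma rename_code_tm_list:
  assumes "\<And>t. t \<in> set ts \<Longrightarrow> rename_code_tm d v (pe 0 (code_tm t)) = code_tm (rename_tm (shift d v) t)"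
  shows "rename_code_tm d v (pe 1 (list_encode (map code_tm ts))) =
    list_encode (map code_tm (map (rename_tm (shift d v)) ts))"
  using assms
proof (induction ts)
  case Nil
  show ?case by (simp add: rename_code_tm_def cov_def rename_step_tm_def)
next
  case (Cons t ts)
  define c where "c = list_encode (map code_tm ts)"
  have "pe 0 (code_tm t) < pe 1 (Suc (pe (code_tm t) c))" "pe 1 c < pe 1 (Suc (pe (code_tm t) c))"
    using le_prod_encode_1[of "code_tm t" c] le_prod_encode_2[of c "code_tm t"]
    by (auto intro!: pe_less)
  note less = this
  have "rename_code_tm d v (pe 1 (Suc (pe (code_tm t) c))) =
      Suc (pe (rename_code_tm d v (pe 0 (code_tm t))) (rename_code_tm d v (pe 1 c)))"
    unfolding rename_code_tm_def
    by (subst cov_def, subst rename_step_tm_def) (simp add: lnth_cov_history less del: One_nat_def)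
  then show ?case using Cons by (simp add: c_def)
qed

lemma rename_code_tm: "rename_code_tm d v (pe 0 (code_tm t)) = code_tm (rename_tm (shift d v) t)"
proof (induction t)
  case (Var n)
  show ?case by (simp add: rename_code_tm_def cov_def rename_step_tm_def shift_def)
next
  case (Fn f ts)
  define c where "c = list_encode (map code_tm ts)"
  have less: "pe 1 c < pe 0 (pe 1 (pe f c))"
    using pe_tag[of 1 "pe f c"] le_prod_encode_2[of c f] by (intro pe_less) simp
  have "rename_code_tm d v (pe 0 (pe 1 (pe f c))) = pe 1 (pe f (rename_code_tm d v (pe 1 c)))"
    unfolding rename_code_tm_def
    by (subst cov_def, subst rename_step_tm_def) (simp add: lnth_cov_history less del: One_nat_def)
  then show ?case using rename_code_tm_list[OF Fn.IH] by (simp add: c_def)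
qed

lemma recfn_rename_code_tm [rec_intro]:
  assumes "recfn n F" "recfn n G" "recfn n H"
  shows "recfn n (\<lambda>xs. rename_code_tm (F xs) (G xs) (H xs))"
  unfolding rename_code_tm_def
  by (rule recfn_cov, unfold rename_step_tm_def)
    (intro rec_intro recfn_drop2 assms; simp)+

definition rename_step :: "nat \<Rightarrow> nat \<Rightarrow> nat \<Rightarrow> nat" where
  "rename_step v z h =
    (if pfst (psnd z) = 0 then 0
     else if pfst (psnd z) = 1 then
       pe 1 (pe (rename_code_tm (pfst z) v (pe 0 (pfst (psnd (psnd z)))))
                (rename_code_tm (pfst z) v (pe 0 (psnd (psnd (psnd z))))))
     else if pfst (psnd z) = 2 then
       pe 2 (pe (pfst (psnd (psnd z))) (rename_code_tm (pfst z) v (pe 1 (psnd (psnd (psnd z))))))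
     else if pfst (psnd z) = 3 then
       pe 3 (pe (lnth h (z - Suc (pe (pfst z) (pfst (psnd (psnd z))))))
                (lnth h (z - Suc (pe (pfst z) (psnd (psnd (psnd z)))))))
     else pe 4 (lnth h (z - Suc (pe (Suc (pfst z)) (psnd (psnd z))))))"

text \<open>
  The depth \<open>d\<close> grows during the recursion, so it is paired with the code of the formula.  The pair
  still gets smaller, because the code of \<open>All p\<close> exceeds that of \<open>p\<close> by more than one.
\<close>

definition rename_code :: "nat \<Rightarrow> nat \<Rightarrow> nat" where
  "rename_code v = cov (rename_step v)"

lemma rename_code: "rename_code v (pe d (code_fm p)) = code_fm (rename (shift d v) p)"
proof (induction p arbitrary: d)
  case Bot
  show ?case 
  proof -
    have "pe 0 0 = 0" by (simp add: prod_encode_def)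
    then show ?thesis by (simp add: rename_code_def cov_def rename_step_def)
  qed
next
  case (Eq s t)
  show ?case by (simp add: rename_code_def cov_def rename_step_def rename_code_tm)
next
  case (Rel R ts)
  show ?case
    using rename_code_tm_list[OF rename_code_tm]
    by (simp add: rename_code_def cov_def rename_step_def del: map_map)
next
  case (Imp p q)
  define a b where "a = code_fm p" and "b = code_fm q"
  have "pe d a < pe d (pe 3 (pe a b))" "pe d b < pe d (pe 3 (pe a b))"
    using pe_tag[of 3 "pe a b"] le_prod_encode_1[of a b] le_prod_encode_2[of b a]
    by (auto intro!: pe_less)
  note less = this
  have "rename_code v (pe d (pe 3 (pe a b))) = pe 3 (pe (rename_code v (pe d a)) (rename_code v (pe d b)))"
    unfolding rename_code_def
    by (subst cov_def, subst rename_step_def) (simp add: lnth_cov_history less)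
  then show ?case using Imp by (simp add: a_def b_def)
next
  case (All p)
  define a where "a = code_fm p"
  have less: "pe (Suc d) a < pe d (pe 4 a)"
    using pe_tag[of 4 a] by (intro pe_less) simp
  have "rename_code v (pe d (pe 4 a)) = pe 4 (rename_code v (pe (Suc d) a))"
    unfolding rename_code_def
    by (subst cov_def, subst rename_step_def) (simp add: lnth_cov_history less)
  then show ?case using All by (simp add: a_def shift_Suc)
qed

lemma recfn_rename_code [rec_intro]:
  assumes "recfn n F" "recfn n G"
  shows "recfn n (\<lambda>xs. rename_code (F xs) (G xs))"
  unfolding rename_code_def
  by (rule recfn_cov, unfold rename_step_def)
    (intro rec_intro recfn_drop2 assms; simp)+

definition Alls_code :: "nat \<Rightarrow> nat \<Rightarrow> nat" where
  "Alls_code n c = rec_nat c (\<lambda>_ r. pe 4 r) n"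

lemma Alls_code: "Alls_code n (code_fm p) = code_fm ((All ^^ n) p)"
  by (induction n) (auto simp: Alls_code_def)

lemma Alls_code_eq: "Alls_code n c = code_fm q \<Longrightarrow> \<exists>p. q = (All ^^ n) p \<and> code_fm p = c"
proof (induction n arbitrary: q)
  case (Suc n)
  then obtain q' where "q = All q'" "Alls_code n c = code_fm q'"
    by (cases q) (auto simp: Alls_code_def)
  then show ?case using Suc.IH by auto
qed (simp add: Alls_code_def)

lemma recfn_Alls_code [rec_intro]:
  "recfn n F \<Longrightarrow> recfn n G \<Longrightarrow> recfn n (\<lambda>xs. Alls_code (F xs) (G xs))"
  unfolding Alls_code_def by (intro rec_intro) simp_all

section \<open>Validities form a \<open>\<Pi>\<^sub>1\<close> set\<close>

lemma sat_instance_cong: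
  assumes "\<And>j i e. (j, i) \<in> ssyms \<phi> \<Longrightarrow> sat M e (\<psi> j i) = sat M e (\<psi>' j i)"
  shows "sat M e (instance_of \<psi> \<phi>) = sat M e (instance_of \<psi>' \<phi>)"
  using assms by (induction \<phi> arbitrary: e) (auto simp: sat_rename)

locale theory_with_atoms =
  fixes L :: language and T :: "fm set" and M :: "nat struct" and A :: "nat \<Rightarrow> fm"
  assumes is_theory: "is_theory L T" and complete: "complete_theory L T" and
    decidable: "decidable_theory T" and model: "model L T M" and
    atom: "\<And>j. wf_fm L (A j)" "\<And>j. fv (A j) = {j}" "computable_fun (\<lambda>j. code_fm (A j))"
begin

lemma wf: "wf_struct L M"
  using model by (simp add: model_def)

lemma T_iff: "p \<in> sentences L \<Longrightarrow> p \<in> T \<longleftrightarrow> sat M e p"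
  using complete_theory_model[OF is_theory complete model] sat_sentence wf by blast

lemma T_sentences: "T \<subseteq> sentences L"
  using is_theory by (simp add: is_theory_def)

text \<open>
  The members of \<open>T\<close> of the form \<open>Imp p p\<close> are exactly those with a sentence \<open>p\<close>.  So the decision
  procedure for \<open>T\<close> recognizes the codes of sentences, and by way of universal closures the codes
  of formulas in \<open>j\<close> variables, without an analysis of their syntax.
\<close>

definition legit :: "nat \<Rightarrow> nat \<Rightarrow> bool" where
  "legit j c \<longleftrightarrow> pe 3 (pe (Alls_code j c) (Alls_code j c)) \<in> code_fm ` T"

lemma legit_iff: "legit j c \<longleftrightarrow> (\<exists>p\<in>formulas L j. code_fm p = c)"
proof
  assume "legit j c"
  then obtain q where q: "q \<in> T" "code_fm q = pe 3 (pe (Alls_code j c) (Alls_code j c))"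
    unfolding legit_def by (metis imageE)
  then obtain q1 q2 where q12: "q = Imp q1 q2" "Alls_code j c = code_fm q1"
    by (cases q) auto
  then obtain p where p: "q1 = (All ^^ j) p" "code_fm p = c" using Alls_code_eq by blast
  have "q1 \<in> sentences L" using q q12 T_sentences by (auto simp: sentences_def)
  then show "\<exists>p\<in>formulas L j. code_fm p = c" using p formulas_Alls by blast
next
  assume "\<exists>p\<in>formulas L j. code_fm p = c"
  then obtain p where p: "p \<in> formulas L j" "code_fm p = c" by blast
  define q where "q = (All ^^ j) p"
  have "q \<in> sentences L" using p formulas_Alls by (simp add: q_def)
  then have "Imp q q \<in> sentences L" by (simp add: sentences_def)
  then have "Imp q q \<in> T" using T_iff[of "Imp q q" undefined] by simp
  moreover have "code_fm (Imp q q) = pe 3 (pe (Alls_code j c) (Alls_code j c))"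
    using p Alls_code[of j p] by (simp add: q_def)
  ultimately show "legit j c" unfolding legit_def by (metis imageI)
qed

text \<open>
  Every number \<open>y\<close> codes an assignment of formulas to the symbols: the entry at \<open>pe j i\<close> of the
  list \<open>y\<close> is used where it is the code of a formula in \<open>j\<close> variables, and \<open>Bot\<close> elsewhere.
\<close>

definition assigned :: "nat \<Rightarrow> nat \<Rightarrow> nat \<Rightarrow> fm" where
  "assigned y j i = pad A j (if legit j (lnth y (pe j i)) then inv code_fm (lnth y (pe j i)) else Bot)"

definition pad_code :: "nat \<Rightarrow> nat \<Rightarrow> nat" where
  "pad_code j c = rec_nat c (\<lambda>k r. pe 3 (pe (pe 3 (pe (code_fm (A k)) (code_fm (A k)))) r)) j"

lemma pad_code: "pad_code j (code_fm p) = code_fm (pad A j p)"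
  by (induction j) (auto simp: pad_code_def)

definition assigned_code :: "nat \<Rightarrow> nat \<Rightarrow> nat \<Rightarrow> nat" where
  "assigned_code y j i = pad_code j (if legit j (lnth y (pe j i)) then lnth y (pe j i) else 0)"

lemma assigned_code: "assigned_code y j i = code_fm (assigned y j i)"
proof (cases "legit j (lnth y (pe j i))")
  case True
  then obtain p where p: "lnth y (pe j i) = code_fm p" unfolding legit_iff by metis
  then have "legit j (code_fm p)" using True by simp
  then show ?thesis
    unfolding assigned_def assigned_code_def p by (simp add: inv_f_f[OF inj_code_fm] pad_code)
next
  case False
  have "code_fm Bot = 0" by (simp add: prod_encode_def)
  then show ?thesis using False pad_code[of j Bot] by (simp add: assigned_def assigned_code_def)
qed

lemma assigned_formula: "wf_fm L (assigned y j i)" "fv (assigned y j i) = {..<j}"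
proof -
  define p where "p = (if legit j (lnth y (pe j i)) then inv code_fm (lnth y (pe j i)) else Bot)"
  have "p \<in> formulas L j"
  proof (cases "legit j (lnth y (pe j i))")
    case True
    then obtain q where "q \<in> formulas L j" "lnth y (pe j i) = code_fm q" unfolding legit_iff by metis
    then show ?thesis using True by (simp add: p_def inv_f_f[OF inj_code_fm])
  qed (simp add: p_def)
  then show "wf_fm L (assigned y j i)" "fv (assigned y j i) = {..<j}"
    unfolding assigned_def p_def[symmetric] using atom by (auto simp: formulas_def fv_pad intro: wf_pad)
qed

definition instance_step :: "nat \<Rightarrow> nat \<Rightarrow> nat \<Rightarrow> nat" where
  "instance_step y z h =
    (if pfst z = 0 then (if psnd z = 0 then 0 else pe 5 0)
     else if pfst z = 1 then
       rename_code (psnd (psnd z)) (pe 0 (assigned_code y (llen (psnd (psnd z))) (pfst (psnd z))))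
     else if pfst z = 2 then
       pe 3 (pe (lnth h (z - Suc (pfst (psnd z)))) (lnth h (z - Suc (psnd (psnd z)))))
     else if pfst z = 3 then pe 4 (lnth h (z - Suc (psnd z)))
     else pe 5 0)"

text \<open>The value \<open>pe 5 0\<close> is not the code of a formula; it marks the arguments that are no codes.\<close>

definition instance_code :: "nat \<Rightarrow> nat \<Rightarrow> nat" where
  "instance_code y = cov (instance_step y)"

lemma instance_code_SImp:
  "instance_code y (pe 2 (pe a b)) = pe 3 (pe (instance_code y a) (instance_code y b))"
proof -
  have "a < pe 2 (pe a b)" "b < pe 2 (pe a b)"
    using pe_tag[of 2 "pe a b"] le_prod_encode_1[of a b] le_prod_encode_2[of b a] by auto
  note less = this
  show ?thesis unfolding instance_code_def
    by (subst cov_def, subst instance_step_def) (simp add: lnth_cov_history less)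
qed

lemma instance_code_SAll: "instance_code y (pe 3 a) = pe 4 (instance_code y a)"
proof -
  have less: "a < pe 3 a" using pe_tag[of 3 a] by simp
  show ?thesis unfolding instance_code_def
    by (subst cov_def, subst instance_step_def) (simp add: lnth_cov_history less)
qed

lemma instance_code: "instance_code y (code_sfm \<phi>) = code_fm (instance_of (assigned y) \<phi>)"
proof (induction \<phi>)
  case SBot
  show ?case by (simp add: instance_code_def cov_def instance_step_def prod_encode_def)
next
  case (SRel i vs)
  have "rename (shift 0 (list_encode vs)) (assigned y (length vs) i) =
      rename (\<lambda>m. vs ! m) (assigned y (length vs) i)"
    by (rule rename_cong) (auto simp: assigned_formula shift_def lnth_list_encode)
  then show ?case
    by (simp add: instance_code_def cov_def instance_step_def assigned_code rename_code)
qed (simp_all add: instance_code_SImp instance_code_SAll)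

lemma instance_code_codes: "instance_code y z \<in> range code_fm \<Longrightarrow> z \<in> range code_sfm"
proof (induction z rule: less_induct)
  case (less z)
  obtain t b where z: "z = pe t b" by (metis prod_decode_inverse surj_pair)
  have junk: "pe 5 0 \<noteq> code_fm q" for q by (cases q) auto
  consider "t = 0" | "t = 1" | "t = 2" | "t = 3" | "t > 3" by linarith
  then show ?case
  proof cases
    case 1
    then have "b = 0" using less.prems junk
      by (auto simp: z instance_code_def cov_def instance_step_def split: if_splits)
    then have "z = code_sfm SBot" using 1 z by simp
    then show ?thesis by blast
  next
    case 2
    have "z = code_sfm (SRel (pfst b) (list_decode (psnd b)))" using 2 by (simp add: z)
    then show ?thesis by blast
  next
    case 3
    obtain c d where b: "b = pe c d" by (metis prod_decode_inverse surj_pair)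
    obtain q where "pe 3 (pe (instance_code y c) (instance_code y d)) = code_fm q"
      using less.prems unfolding z b 3 instance_code_SImp by blast
    then have "instance_code y c \<in> range code_fm" "instance_code y d \<in> range code_fm"
      by (cases q; auto)+
    moreover have "c < z" "d < z"
      using pe_tag[of 2 "pe c d"] le_prod_encode_1[of c d] le_prod_encode_2[of d c]
      unfolding z b 3 by (auto simp: numeral_2_eq_2)
    ultimately obtain \<phi> \<chi> where "c = code_sfm \<phi>" "d = code_sfm \<chi>" using less.IH by blast
    then have "z = code_sfm (SImp \<phi> \<chi>)" by (simp add: z b 3)
    then show ?thesis by blast
  next
    case 4
    obtain q where "pe 4 (instance_code y b) = code_fm q"
      using less.prems unfolding z 4 instance_code_SAll by blast
    then have "instance_code y b \<in> range code_fm" by (cases q) auto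
    moreover have "b < z" using pe_tag[of 3 b] by (simp add: z 4)
    ultimately obtain \<phi> where "b = code_sfm \<phi>" using less.IH by blast
    then have "z = code_sfm (SAll \<phi>)" by (simp add: z 4)
    then show ?thesis by blast
  next
    case 5
    then have "instance_code y z = pe 5 0"
      by (simp add: z instance_code_def cov_def instance_step_def)
    then show ?thesis using less.prems junk by auto
  qed
qed

text \<open>
  Only finitely many symbols occur in \<open>\<phi>\<close>, so each choice of formulas for them agrees, up to padding,
  with the assignment coded by some \<open>y\<close>.  As all variables occur in the padded formulas, an instance
  can be a sentence only if \<open>\<phi>\<close> is one.
\<close>

lemma validities_iff: "\<phi> \<in> validities L T \<longleftrightarrow> (\<forall>y. instance_of (assigned y) \<phi> \<in> T)"
proof
  assume "\<phi> \<in> validities L T"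
  then show "\<forall>y. instance_of (assigned y) \<phi> \<in> T"
    using assigned_formula unfolding validities_def by blast
next
  assume inst: "\<forall>y. instance_of (assigned y) \<phi> \<in> T"
  have closed: "sfv \<phi> = {}"
  proof -
    have "fv (instance_of (assigned 0) \<phi>) = {}"
      using inst T_sentences by (auto simp: sentences_def)
    then show ?thesis using fv_instance[of \<phi> "assigned 0"] assigned_formula by simp
  qed
  have "instance_of \<psi> \<phi> \<in> T" if \<psi>: "\<And>j i. (j, i) \<in> ssyms \<phi> \<Longrightarrow> wf_fm L (\<psi> j i) \<and> fv (\<psi> j i) = {..<j}" for \<psi>
  proof -
    have "finite (ssyms \<phi>)" by (induction \<phi>) auto
    then obtain B where B: "prod_encode ` ssyms \<phi> \<subseteq> {..<B}"
      using finite_nat_iff_bounded by blast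
    define y where "y = list_encode (map (\<lambda>k. code_fm (\<psi> (pfst k) (psnd k))) [0..<B])"
    have "assigned y j i = pad A j (\<psi> j i)" if ji: "(j, i) \<in> ssyms \<phi>" for j i
    proof -
      have "pe j i < B" using B ji by auto
      then have "lnth y (pe j i) = code_fm (\<psi> j i)" by (simp add: y_def lnth_list_encode)
      moreover have "\<psi> j i \<in> formulas L j" using \<psi>[OF ji] by (auto simp: formulas_def)
      ultimately have "legit j (lnth y (pe j i))" "inv code_fm (lnth y (pe j i)) = \<psi> j i"
        unfolding legit_iff by (auto simp: inv_f_f[OF inj_code_fm])
      then show ?thesis by (simp add: assigned_def)
    qed
    then have "sat M e (instance_of (assigned y) \<phi>) = sat M e (instance_of \<psi> \<phi>)" for e
      by (intro sat_instance_cong) simp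
    moreover have "instance_of \<psi> \<phi> \<in> sentences L"
      using closed \<psi> by (intro instance_sentence) (auto simp: formulas_def)
    ultimately show ?thesis using inst T_iff T_sentences by blast
  qed
  then show "\<phi> \<in> validities L T" using closed unfolding validities_def by blast
qed

lemma recpred_T:
  assumes "recfn n F"
  shows "recpred n (\<lambda>xs. F xs \<in> code_fm ` T)"
  using recpred_computable_set[OF _ assms] decidable unfolding decidable_theory_def by blast

lemma recfn_assigned_code:
  assumes "recfn n F" "recfn n G" "recfn n H"
  shows "recfn n (\<lambda>xs. assigned_code (F xs) (G xs) (H xs))"
proof -
  have A: "recfn m K \<Longrightarrow> recfn m (\<lambda>xs. code_fm (A (K xs)))" for m K
    using recfn_app1[of "\<lambda>k. code_fm (A k)"] atom(3) unfolding recfn_computable_fun by blast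
  have pad: "recfn m K \<Longrightarrow> recfn m K' \<Longrightarrow> recfn m (\<lambda>xs. pad_code (K xs) (K' xs))" for m K K'
    unfolding pad_code_def by (intro rec_intro A) simp_all
  show ?thesis
    unfolding assigned_code_def legit_def by (intro rec_intro pad recpred_T assms)
qed

lemma Pi1_validities: "Pi1 (code_sfm ` validities L T)"
proof -
  have "recfn 2 (\<lambda>xs. instance_code (xs ! 1) (xs ! 0))"
    unfolding instance_code_def
    by (rule recfn_cov, unfold instance_step_def) (intro rec_intro recfn_assigned_code; simp)+
  then have "computable_rel (\<lambda>x y. instance_code y x \<in> code_fm ` T)"
    unfolding computable_rel_iff by (rule recpred_T)
  moreover have "x \<in> code_sfm ` validities L T \<longleftrightarrow> (\<forall>y. instance_code y x \<in> code_fm ` T)" for x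
  proof (cases "x \<in> range code_sfm")
    case True
    then obtain \<phi> where "x = code_sfm \<phi>" by blast
    then show ?thesis
      using validities_iff inj_code_sfm inj_code_fm by (simp add: instance_code inj_image_mem_iff)
  next
    case False
    then show ?thesis using instance_code_codes[of _ x] by blast
  qed
  ultimately show ?thesis unfolding Pi1_def by blast
qed

end

section \<open>Finite structures interpreted on tuples\<close>

context theory_with_atoms
begin

definition definable :: "nat \<Rightarrow> (nat list \<Rightarrow> bool) \<Rightarrow> bool" where
  "definable m P \<longleftrightarrow> (\<exists>p\<in>formulas L m. \<forall>as\<in>tuples m (carrier M). sat M (lenv as) p \<longleftrightarrow> P as)"

lemma definable_const: "definable m (\<lambda>_. b)"
  unfolding definable_def by (intro bexI[of _ "if b then Neg Bot else Bot"]) auto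

lemma definable_imp: "definable m P \<Longrightarrow> definable m Q \<Longrightarrow> definable m (\<lambda>as. P as \<longrightarrow> Q as)"
  unfolding definable_def
proof (elim bexE)
  fix p q assume "p \<in> formulas L m" "q \<in> formulas L m"
    "\<forall>as\<in>tuples m (carrier M). sat M (lenv as) p \<longleftrightarrow> P as"
    "\<forall>as\<in>tuples m (carrier M). sat M (lenv as) q \<longleftrightarrow> Q as"
  then show "\<exists>p\<in>formulas L m. \<forall>as\<in>tuples m (carrier M). sat M (lenv as) p \<longleftrightarrow> (P as \<longrightarrow> Q as)"
    by (intro bexI[of _ "Imp p q"]) auto
qed

lemma definable_not: "definable m P \<Longrightarrow> definable m (\<lambda>as. \<not> P as)"
  using definable_imp[OF _ definable_const[of m False]] by simp

lemma definable_conj: "definable m P \<Longrightarrow> definable m Q \<Longrightarrow> definable m (\<lambda>as. P as \<and> Q as)"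
  using definable_not[OF definable_imp[OF _ definable_not]] by simp

lemma definable_Ball:
  "finite S \<Longrightarrow> (\<And>c. c \<in> S \<Longrightarrow> definable m (P c)) \<Longrightarrow> definable m (\<lambda>as. \<forall>c\<in>S. P c as)"
  by (induction S rule: finite_induct) (auto intro: definable_const definable_conj)

lemma definable_Bex:
  "finite S \<Longrightarrow> (\<And>c. c \<in> S \<Longrightarrow> definable m (P c)) \<Longrightarrow> definable m (\<lambda>as. \<exists>c\<in>S. P c as)"
proof -
  assume "finite S" "\<And>c. c \<in> S \<Longrightarrow> definable m (P c)"
  then have "definable m (\<lambda>as. \<not> (\<forall>c\<in>S. \<not> P c as))"
    by (intro definable_not definable_Ball)
  then show ?thesis by simp
qed

lemma definable_block:
  assumes "definable n P" "k + n \<le> m"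
  shows "definable m (\<lambda>as. P (take n (drop k as)))"
proof -
  obtain p where p: "p \<in> formulas L n" "\<And>as. as \<in> tuples n (carrier M) \<Longrightarrow> sat M (lenv as) p \<longleftrightarrow> P as"
    using assms(1) unfolding definable_def by blast
  have "rename (\<lambda>i. k + i) p \<in> formulas L m"
    using p(1) assms(2) by (fastforce simp: formulas_def fv_rename)
  moreover have "sat M (lenv as) (rename (\<lambda>i. k + i) p) \<longleftrightarrow> P (take n (drop k as))"
    if as: "as \<in> tuples m (carrier M)" for as
  proof -
    have "take n (drop k as) \<in> tuples n (carrier M)"
      using as assms(2) set_take_subset[of n "drop k as"] set_drop_subset[of k as]
      by (auto simp: tuples_def)
    moreover have "sat M (\<lambda>i. as ! (k + i)) p \<longleftrightarrow> sat M (lenv (take n (drop k as))) p"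
      by (rule sat_cong) (use p(1) as assms(2) in \<open>auto simp: formulas_def tuples_def\<close>)
    ultimately show ?thesis using p(2) by (simp add: sat_rename)
  qed
  ultimately show ?thesis unfolding definable_def by blast
qed

lemma definable_pattern:
  "set \<Delta> \<subseteq> formulas L n \<Longrightarrow> definable n (\<lambda>as. map (sat M (lenv as)) \<Delta> = bs)"
proof (induction \<Delta> arbitrary: bs)
  case Nil
  show ?case by (simp add: definable_const)
next
  case (Cons p \<Delta>)
  show ?case
  proof (cases bs)
    case Nil
    then show ?thesis using definable_const[of n False] by simp
  next
    case (Cons b bs')
    have "definable n (\<lambda>as. sat M (lenv as) p)"
      using Cons.prems unfolding definable_def by (intro bexI[of _ p]) auto
    then have "definable n (\<lambda>as. sat M (lenv as) p = b)"
      using definable_not by (cases b) auto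
    then show ?thesis using Cons.IH[of bs'] Cons.prems definable_conj \<open>bs = b # bs'\<close> by simp
  qed
qed

text \<open>
  If there are more than \<open>N\<close> patterns, the classes of tuples with equal patterns, some of them
  merged, are the fibres of a map onto \<open>{..N}\<close>.
\<close>

lemma definable_partition:
  assumes "unbounded_patterns L M n"
  obtains h where "h ` tuples n (carrier M) = {..N::nat}" "\<And>c. definable n (\<lambda>as. h as = c)"
proof -
  obtain \<Delta> where \<Delta>: "set \<Delta> \<subseteq> formulas L n" "N < card (patterns M \<Delta>)"
    using assms unfolding unbounded_patterns_def by blast
  obtain g where g: "bij_betw g (patterns M \<Delta>) {0..<card (patterns M \<Delta>)}"
    using ex_bij_betw_finite_nat[OF finite_patterns] by blast
  define f where "f bs = (if g bs \<le> N then g bs else 0)" for bs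
  define h where "h as = f (map (sat M (lenv as)) \<Delta>)" for as
  obtain a where a: "a \<in> carrier M" using wf by (auto simp: wf_struct_def)
  have pattern: "map (sat M (lenv as)) \<Delta> \<in> patterns M \<Delta>" if as: "as \<in> tuples n (carrier M)" for as
  proof -
    have "sat M (push as (\<lambda>_. a)) p = sat M (lenv as) p" if "p \<in> set \<Delta>" for p
      by (rule sat_cong) (use that \<Delta>(1) as in \<open>fastforce simp: formulas_def push_def tuples_def\<close>)
    then have "map (sat M (lenv as)) \<Delta> = map (sat M (push as (\<lambda>_. a))) \<Delta>" by simp
    moreover have "range (push as (\<lambda>_. a)) \<subseteq> carrier M"
      using as a by (intro range_push) (auto simp: tuples_def)
    ultimately show ?thesis unfolding patterns_def by blast
  qed
  have "h ` tuples n (carrier M) = {..N}"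
  proof
    show "h ` tuples n (carrier M) \<subseteq> {..N}" by (auto simp: h_def f_def)
    show "{..N} \<subseteq> h ` tuples n (carrier M)"
    proof
      fix c assume c: "c \<in> {..N}"
      then have "c \<in> g ` patterns M \<Delta>" using g \<Delta>(2) by (simp add: bij_betw_def)
      then obtain e where e: "range e \<subseteq> carrier M" "g (map (sat M e) \<Delta>) = c"
        unfolding patterns_def by blast
      define as where "as = map e [0..<n]"
      have "as \<in> tuples n (carrier M)" using e(1) by (auto simp: as_def tuples_def)
      moreover have "sat M (lenv as) p = sat M e p" if "p \<in> set \<Delta>" for p
        by (rule sat_cong) (use that \<Delta>(1) in \<open>fastforce simp: formulas_def as_def\<close>)
      then have "map (sat M (lenv as)) \<Delta> = map (sat M e) \<Delta>" by simp
      then have "h as = f (map (sat M e) \<Delta>)" unfolding h_def by (rule arg_cong)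
      then have "h as = c" using e(2) c by (simp add: f_def)
      ultimately show "c \<in> h ` tuples n (carrier M)" by blast
    qed
  qed
  moreover have "definable n (\<lambda>as. h as = c)" for c
  proof -
    have "definable n (\<lambda>as. \<exists>bs\<in>{bs \<in> patterns M \<Delta>. f bs = c}. map (sat M (lenv as)) \<Delta> = bs)"
      by (intro definable_Bex definable_pattern \<Delta>(1)) (simp add: finite_patterns)
    then show ?thesis using pattern unfolding definable_def h_def by auto
  qed
  ultimately show thesis using that by blast
qed

definition blocks :: "nat \<Rightarrow> nat \<Rightarrow> nat list \<Rightarrow> nat list list" where
  "blocks n j as = map (\<lambda>l. take n (drop (n * l) as)) [0..<j]"

lemma blocks_concat: "set ass \<subseteq> tuples n B \<Longrightarrow> blocks n (length ass) (concat ass) = ass"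
proof (induction ass)
  case (Cons as ass)
  have "blocks n (Suc (length ass)) (as @ concat ass) = as # blocks n (length ass) (concat ass)"
    using Cons.prems unfolding blocks_def
    by (auto simp: tuples_def map_upt_Suc simp del: upt_Suc)
  then show ?case using Cons by simp
qed (simp add: blocks_def)

lemma definable_blocks:
  assumes h: "\<And>as. h as \<le> (N::nat)" "\<And>c. definable n (\<lambda>as. h as = c)" and le: "n * j \<le> m"
  shows "definable m (\<lambda>as. Q (map h (blocks n j as)))"
proof -
  define S where "S = {cs. set cs \<subseteq> {..N} \<and> length cs = j \<and> Q cs}"
  have "finite S"
    by (rule finite_subset[OF _ finite_lists_length_eq[of "{..N}" j]]) (auto simp: S_def)
  moreover have "definable m (\<lambda>as. \<forall>l\<in>{..<j}. h (take n (drop (n * l) as)) = cs ! l)" for cs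
  proof (rule definable_Ball)
    fix l assume "l \<in> {..<j}"
    then have "n * l + n \<le> n * j" using mult_le_mono2[of "Suc l" j n] by simp
    then show "definable m (\<lambda>as. h (take n (drop (n * l) as)) = cs ! l)"
      using definable_block[OF h(2)] le by simp
  qed simp
  ultimately have "definable m (\<lambda>as. \<exists>cs\<in>S. \<forall>l\<in>{..<j}. h (take n (drop (n * l) as)) = cs ! l)"
    by (rule definable_Bex)
  moreover have "(\<exists>cs\<in>S. \<forall>l\<in>{..<j}. h (take n (drop (n * l) as)) = cs ! l) \<longleftrightarrow>
      Q (map h (blocks n j as))" for as
  proof
    assume "\<exists>cs\<in>S. \<forall>l\<in>{..<j}. h (take n (drop (n * l) as)) = cs ! l"
    then obtain cs where cs: "cs \<in> S" "\<forall>l\<in>{..<j}. h (take n (drop (n * l) as)) = cs ! l" by blast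
    then have "map h (blocks n j as) = cs"
      by (intro nth_equalityI) (auto simp: S_def blocks_def)
    then show "Q (map h (blocks n j as))" using cs by (simp add: S_def)
  next
    assume "Q (map h (blocks n j as))"
    then show "\<exists>cs\<in>S. \<forall>l\<in>{..<j}. h (take n (drop (n * l) as)) = cs ! l"
      using h(1) by (intro bexI[of _ "map h (blocks n j as)"]) (auto simp: S_def blocks_def)
  qed
  ultimately show ?thesis by simp
qed

text \<open>
  The relations of a structure on \<open>{..N}\<close> are pulled back along the map of \<open>definable_partition\<close>.  They
  stay definable since there are finitely many tuples over \<open>{..N}\<close>.
\<close>

lemma interpret_finite:
  assumes "unbounded_patterns L M n" and n: "0 < n"
  obtains \<psi> h where "\<And>j i. wf_fm L (\<psi> j i) \<and> fv (\<psi> j i) = {..<j}"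
    "\<And>e \<phi>. range e \<subseteq> carrier M \<Longrightarrow> sat M e (instance_of \<psi> (tuple_fm n \<phi>)) \<longleftrightarrow>
      ssat {..N::nat} I (\<lambda>v. h (map e [n * v..<n * v + n])) \<phi>"
proof -
  obtain h' where h': "h' ` tuples n (carrier M) = {..N}" "\<And>c. definable n (\<lambda>as. h' as = c)"
    by (rule definable_partition[OF assms(1), where N = N]) blast
  define h where "h as = (if as \<in> tuples n (carrier M) then h' as else 0)" for as
  have h: "h ` tuples n (carrier M) = {..N}" "h as \<le> N" "definable n (\<lambda>as. h as = c)" for as c
    using h' by (auto simp: h_def definable_def)
  have "n * (m div n) \<le> m" for m by simp
  then have "definable m (\<lambda>as. I i (map h (blocks n (m div n) as)))" for m i
    using definable_blocks h by blast
  then have ex: "\<exists>p. p \<in> formulas L m \<and> (\<forall>as\<in>tuples m (carrier M).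
      sat M (lenv as) p \<longleftrightarrow> I i (map h (blocks n (m div n) as)))" for m i
    unfolding definable_def by blast
  define \<psi>' where "\<psi>' m i = (SOME p. p \<in> formulas L m \<and> (\<forall>as\<in>tuples m (carrier M).
      sat M (lenv as) p \<longleftrightarrow> I i (map h (blocks n (m div n) as))))" for m i
  have \<psi>': "\<psi>' m i \<in> formulas L m"
    "as \<in> tuples m (carrier M) \<Longrightarrow>
      sat M (lenv as) (\<psi>' m i) \<longleftrightarrow> I i (map h (blocks n (m div n) as))" for m i as
    using someI_ex[OF ex[of m i]] unfolding \<psi>'_def by blast+
  define \<psi> where "\<psi> m i = pad A m (\<psi>' m i)" for m i
  have legit: "wf_fm L (\<psi> j i) \<and> fv (\<psi> j i) = {..<j}" for j i
    using \<psi>'(1)[of j i] atom by (auto simp: \<psi>_def fv_pad formulas_def intro: wf_pad)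
  moreover have "sat M e (instance_of \<psi> (tuple_fm n \<phi>)) \<longleftrightarrow>
      ssat {..N} I (\<lambda>v. h (map e [n * v..<n * v + n])) \<phi>" if e: "range e \<subseteq> carrier M" for e \<phi>
  proof -
    have "sat M e (instance_of \<psi> (tuple_fm n \<phi>)) \<longleftrightarrow>
        ssat (tuples n (carrier M)) (\<lambda>i ass. sat M (lenv (concat ass)) (\<psi> (length (concat ass)) i))
          (\<lambda>v. map e [n * v..<n * v + n]) \<phi>"
      using legit by (simp add: sat_instance ssat_tuple_fm)
    also have "\<dots> \<longleftrightarrow> ssat {..N} I (h \<circ> (\<lambda>v. map e [n * v..<n * v + n])) \<phi>"
    proof (rule ssat_surj[OF h(1)])
      fix i ass assume ass: "set ass \<subseteq> tuples n (carrier M)"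
      have len: "length (concat ass) = n * length ass"
        using ass by (induction ass) (auto simp: tuples_def)
      have "concat ass \<in> tuples (n * length ass) (carrier M)"
        using ass len by (auto simp: tuples_def)
      then show "sat M (lenv (concat ass)) (\<psi> (length (concat ass)) i) \<longleftrightarrow> I i (map h ass)"
        using \<psi>'(2) n blocks_concat[OF ass] by (simp add: \<psi>_def len)
    next
      show "range (\<lambda>v. map e [n * v..<n * v + n]) \<subseteq> tuples n (carrier M)"
        using e by (auto simp: tuples_def range_subsetD)
    qed
    finally show ?thesis by (simp add: comp_def)
  qed
  ultimately show thesis using that by blast
qed

end

section \<open>Hardness for \<open>\<Pi>\<^sub>1\<close>\<close>

definition SAlls_code :: "nat \<Rightarrow> nat \<Rightarrow> nat" where
  "SAlls_code n c = rec_nat c (\<lambda>_ r. pe 3 r) n"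

lemma SAlls_code: "SAlls_code n (code_sfm p) = code_sfm ((SAll ^^ n) p)"
  by (induction n) (auto simp: SAlls_code_def)

lemma recfn_SAlls_code: "recfn m F \<Longrightarrow> recfn m (\<lambda>xs. SAlls_code n (F xs))"
  unfolding SAlls_code_def by (intro rec_intro) simp_all

lemma tuple_successor_step:
  "tuple_fm n (successor_step q) = (SAll ^^ n) (SImp (tuple_fm n (sSucc 1 0)) (tuple_fm n q))"
  by (simp add: successor_step_def)

lemma tuple_at_numeral:
  "tuple_fm n (at_numeral k q) =
    (SAll ^^ n) (SImp (tuple_fm n (sZero 0)) (tuple_fm n ((successor_step ^^ k) q)))"
  by (simp add: at_numeral_def)

lemma computable_reduction:
  "computable_fun (\<lambda>k. code_sfm (tuple_fm n (reduction d t k)))"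
proof -
  let ?c = "\<lambda>p. code_sfm (tuple_fm n p)"
  have steps: "?c ((successor_step ^^ k) q) =
      rec_nat (?c q) (\<lambda>_ r. SAlls_code n (pe 2 (pe (?c (sSucc 1 0)) r))) k" for k q
  proof (induction k)
    case (Suc k)
    then show ?case
      using SAlls_code[of n "SImp (tuple_fm n (sSucc 1 0)) (tuple_fm n ((successor_step ^^ k) q))"]
      by (simp add: tuple_successor_step)
  qed simp
  have "?c (at_numeral k q) = SAlls_code n (pe 2 (pe (?c (sZero 0)) (?c ((successor_step ^^ k) q))))" for k q
    using SAlls_code[of n "SImp (tuple_fm n (sZero 0)) (tuple_fm n ((successor_step ^^ k) q))"]
    by (simp add: tuple_at_numeral)
  then have numeral: "recfn 1 (\<lambda>xs. ?c (at_numeral (xs ! 0) q))" for q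
    unfolding steps by (simp, intro rec_intro recfn_SAlls_code) simp_all
  have "recfn 1 (\<lambda>xs. ?c (foldr SImp ps (at_numeral (xs ! 0) q)))" for ps q
  proof (induction ps)
    case (Cons p ps)
    then show ?case by simp (intro rec_intro)
  qed (simp add: numeral[simplified])
  then show ?thesis unfolding recfn_computable_fun reduction_def .
qed

lemma ssyms_tuple_fm:
  "(m, i) \<in> ssyms (tuple_fm n p) \<longleftrightarrow> (\<exists>j. m = n * j \<and> (j, i) \<in> ssyms p)"
proof (induction p)
  case (SRel i' vs)
  have "length (concat (map (\<lambda>v. [n * v..<n * v + n]) vs)) = n * length vs"
    by (simp add: length_concat comp_def sum_list_triv)
  then show ?case by auto
qed auto

lemma ssyms_foldr_SImp: "ssyms (foldr SImp ps q) = (\<Union>p\<in>set ps. ssyms p) \<union> ssyms q"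
  by (induction ps) auto

lemma ssyms_at_numeral_U: "ssyms (at_numeral k (sU 0)) \<subseteq> {(2, 0), (1, 0)}"
proof -
  have "ssyms ((successor_step ^^ k) (sU 0)) \<subseteq> {(2, 0), (1, 0)}"
    by (induction k) (auto simp: successor_step_def sSucc_def sLt_def sU_def SAnd_def)
  then show ?thesis by (auto simp: at_numeral_def sZero_def sLt_def)
qed

lemma ssyms_reduction: "{(2, 0), (1, 0)} \<subseteq> ssyms (reduction d t k)"
  by (auto simp: reduction_def ssyms_foldr_SImp axioms_def order_axioms_def U_axiom_def sLt_def
      sU_def SIff_def SAnd_def)

context theory_with_atoms
begin

text \<open>
  \<open>diagonal n (pe a (pe b c))\<close> is the code of the instance, on \<open>n\<close>-tuples, of \<open>at_numeral k (sU 0)\<close> for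
  this very number \<open>k = pe a (pe b c)\<close>, when \<open>a\<close>, \<open>b\<close> and \<open>c\<close> are
  the codes of the instances of \<open>sZero\<close>, \<open>sSucc\<close> and \<open>sU\<close>.
\<close>

definition diagonal :: "nat \<Rightarrow> nat \<Rightarrow> nat" where
  "diagonal n k = Alls_code n (pe 3 (pe (pfst k)
    (rec_nat (psnd (psnd k)) (\<lambda>_ r. Alls_code n (pe 3 (pe (pfst (psnd k)) r))) k)))"

lemma instance_at_numeral:
  "code_fm (instance_of \<psi> (tuple_fm n (at_numeral k (sU 0)))) =
    Alls_code n (pe 3 (pe (code_fm (instance_of \<psi> (tuple_fm n (sZero 0))))
      (rec_nat (code_fm (instance_of \<psi> (tuple_fm n (sU 0))))
        (\<lambda>_ r. Alls_code n (pe 3 (pe (code_fm (instance_of \<psi> (tuple_fm n (sSucc 1 0)))) r))) k)))"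
proof -
  let ?c = "\<lambda>p. code_fm (instance_of \<psi> (tuple_fm n p))"
  have "?c ((successor_step ^^ k) (sU 0)) =
      rec_nat (?c (sU 0)) (\<lambda>_ r. Alls_code n (pe 3 (pe (?c (sSucc 1 0)) r))) k"
  proof (induction k)
    case (Suc k)
    then show ?case
      using Alls_code[of n "instance_of \<psi> (tuple_fm n (SImp (sSucc 1 0) ((successor_step ^^ k) (sU 0))))"]
      by (simp add: tuple_successor_step)
  qed simp
  then show ?thesis
    using Alls_code[of n "instance_of \<psi> (tuple_fm n (SImp (sZero 0) ((successor_step ^^ k) (sU 0))))"]
    by (simp add: tuple_at_numeral)
qed

lemma diagonal_term:
  obtains d where "regular d" "\<And>k. reval d k = 0 \<longleftrightarrow> diagonal n k \<notin> code_fm ` T"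
proof -
  have "recfn 1 (\<lambda>xs. if diagonal n (xs ! 0) \<in> code_fm ` T then 1 else 0)"
    unfolding diagonal_def by (intro rec_intro recpred_T) simp_all
  then obtain d where "regular d" "\<And>k. reval d k = (if diagonal n k \<in> code_fm ` T then 1 else 0)"
    using recfn_imp_rterm[of "\<lambda>k. if diagonal n k \<in> code_fm ` T then 1 else 0"] by blast
  then show thesis using that[of d] by simp
qed

text \<open>
  In the case \<open>x \<in> B\<close>, for any instance outside \<open>T\<close> let \<open>k\<close> code the instances of \<open>sZero\<close>, \<open>sSucc\<close> and
  \<open>sU\<close>.  Then \<open>\<theta> k\<close>, which says that the zeros of \<open>d\<close> include \<open>k\<close>, belongs to \<open>T\<close> iff \<open>d\<close> has the zero \<open>k\<close>,
  which by the choice of \<open>d\<close> means that \<open>\<theta> k\<close> does not belong to \<open>T\<close>.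
\<close>

lemma Pi1_hard_validities:
  assumes unbounded: "unbounded_patterns L M n" and "0 < n" and "Pi1 B"
  shows "many_one_reducible B (code_sfm ` validities L T)"
proof -
  obtain R where R: "computable_rel R" "B = {x. \<forall>y. R x y}"
    using \<open>Pi1 B\<close> unfolding Pi1_def by blast
  have "recfn 1 (\<lambda>xs. if R (psnd (xs ! 0)) (pfst (xs ! 0)) then 1 else 0)"
    using R(1) unfolding computable_rel_iff recpred_def
    by (rule recfn_app2[where f = "\<lambda>x y. if R x y then 1 else 0"]) (intro rec_intro; simp)+
  then obtain t where t: "regular t" "\<And>z. reval t z = (if R (psnd z) (pfst z) then 1 else 0)"
    using recfn_imp_rterm[of "\<lambda>z. if R (psnd z) (pfst z) then 1 else 0"] by blast
  obtain d where d: "regular d" "\<And>k. reval d k = 0 \<longleftrightarrow> diagonal n k \<notin> code_fm ` T"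
    using diagonal_term by blast
  define \<phi> where "\<phi> x = tuple_fm n (reduction d t x)" for x
  have closed: "sfv (\<phi> x) = {}" for x
    using sfv_tuple_fm[OF _ \<open>0 < n\<close>] sfv_reduction unfolding \<phi>_def by blast
  have "\<phi> x \<in> validities L T" if "x \<in> B" for x
  proof -
    have inst: "instance_of \<psi> (\<phi> x) \<in> T"
      if \<psi>: "\<And>j i. (j, i) \<in> ssyms (\<phi> x) \<Longrightarrow> wf_fm L (\<psi> j i) \<and> fv (\<psi> j i) = {..<j}" for \<psi>
    proof (rule ccontr)
      assume notin: "instance_of \<psi> (\<phi> x) \<notin> T"
      have \<psi>_formula: "\<psi> j i \<in> formulas L j" if "(j, i) \<in> ssyms (\<phi> x)" for j i
        using \<psi>[OF that] by (simp add: formulas_def)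
      define I where "I i as = sat M (lenv (concat as)) (\<psi> (length (concat as)) i)" for i as
      have sat: "sat M e (instance_of \<psi> (tuple_fm n \<chi>)) \<longleftrightarrow>
          ssat (tuples n (carrier M)) I (\<lambda>v. map e [n * v..<n * v + n]) \<chi>"
        if "ssyms (tuple_fm n \<chi>) \<subseteq> ssyms (\<phi> x)" for e \<chi>
      proof -
        have "fv (\<psi> j i) \<subseteq> {..<j}" if "(j, i) \<in> ssyms (tuple_fm n \<chi>)" for j i
          using \<psi> that \<open>ssyms (tuple_fm n \<chi>) \<subseteq> ssyms (\<phi> x)\<close> by blast
        then show ?thesis unfolding I_def by (subst sat_instance) (auto simp: ssat_tuple_fm)
      qed
      have "instance_of \<psi> (\<phi> x) \<in> sentences L" using instance_sentence closed \<psi>_formula by blast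
      then have "\<not> sat M undefined (instance_of \<psi> (\<phi> x))" using notin T_iff by blast
      then obtain e where refuted: "\<not> ssat (tuples n (carrier M)) I e (reduction d t x)"
        using sat[of "reduction d t x"] unfolding \<phi>_def by blast
      define \<theta> where "\<theta> k = instance_of \<psi> (tuple_fm n (at_numeral k (sU 0)))" for k
      have \<theta>_syms: "ssyms (tuple_fm n (at_numeral k (sU 0))) \<subseteq> ssyms (\<phi> x)" for k
      proof -
        have "ssyms (at_numeral k (sU 0)) \<subseteq> ssyms (reduction d t x)"
          by (rule order_trans[OF ssyms_at_numeral_U ssyms_reduction])
        then show ?thesis unfolding \<phi>_def by (fastforce simp: ssyms_tuple_fm)
      qed
      have "\<theta> k \<in> T \<longleftrightarrow> reval d k = 0" for k
      proof -
        have "sfv (tuple_fm n (at_numeral k (sU 0))) = {}"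
          using sfv_tuple_fm[OF _ \<open>0 < n\<close>] sfv_at_numeral[of "sU 0" k] by fastforce
        then have "\<theta> k \<in> sentences L"
          unfolding \<theta>_def using instance_sentence \<psi>_formula \<theta>_syms by blast
        then have "\<theta> k \<in> T \<longleftrightarrow> sat M undefined (\<theta> k)" by (rule T_iff)
        also have "\<dots> \<longleftrightarrow> reval d k = 0"
          unfolding \<theta>_def sat[OF \<theta>_syms]
          using reduction_refuted_infinite[OF t(1) d(1) _ refuted] t(2) R(2) \<open>x \<in> B\<close> by simp
        finally show ?thesis .
      qed
      moreover have "reval d k = 0 \<longleftrightarrow> \<theta> k \<notin> T"
        if "k = pe (code_fm (instance_of \<psi> (tuple_fm n (sZero 0))))
          (pe (code_fm (instance_of \<psi> (tuple_fm n (sSucc 1 0)))) (code_fm (instance_of \<psi> (tuple_fm n (sU 0)))))"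
        for k
      proof -
        have "code_fm (\<theta> k) = diagonal n k"
          unfolding \<theta>_def instance_at_numeral diagonal_def by (simp add: that)
        then show ?thesis using d(2)[of k] inj_image_mem_iff[OF inj_code_fm, of "\<theta> k" T] by simp
      qed
      ultimately show False by blast
    qed
    show ?thesis
      unfolding validities_def mem_Collect_eq
    proof (intro conjI allI impI)
      show "sfv (\<phi> x) = {}" by (rule closed)
      fix \<psi> assume "\<forall>(j, i)\<in>ssyms (\<phi> x). wf_fm L (\<psi> j i) \<and> fv (\<psi> j i) = {..<j}"
      then show "instance_of \<psi> (\<phi> x) \<in> T" by (intro inst) blast
    qed
  qed
  moreover have "x \<in> B" if valid: "\<phi> x \<in> validities L T" for x
  proof (rule ccontr)
    assume "x \<notin> B"
    then obtain y where "reval t (pe y x) = 0" using t(2) R(2) by auto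
    then obtain N where N: "\<not> ssat {..N} (finite_int d N) (\<lambda>_. 0) (reduction d t x)"
      using reduction_refuted_finite[OF t(1)] by blast
    obtain \<psi> h where \<psi>: "\<And>j i. wf_fm L (\<psi> j i) \<and> fv (\<psi> j i) = {..<j}"
      "\<And>e \<phi>. range e \<subseteq> carrier M \<Longrightarrow> sat M e (instance_of \<psi> (tuple_fm n \<phi>)) \<longleftrightarrow>
        ssat {..N} (finite_int d N) (\<lambda>v. h (map e [n * v..<n * v + n])) \<phi>"
      by (rule interpret_finite[OF unbounded \<open>0 < n\<close>, where N = N and I = "finite_int d N"]) blast
    obtain a where "a \<in> carrier M" using wf by (auto simp: wf_struct_def)
    then have a: "range (\<lambda>_::nat. a) \<subseteq> carrier M" by auto
    have "instance_of \<psi> (\<phi> x) \<in> T" using valid \<psi>(1) unfolding validities_def by blast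
    then have "sat M (\<lambda>_. a) (instance_of \<psi> (\<phi> x))" using T_iff T_sentences by blast
    then have "ssat {..N} (finite_int d N) (\<lambda>v. h (map (\<lambda>_. a) [n * v..<n * v + n])) (reduction d t x)"
      using \<psi>(2)[OF a] unfolding \<phi>_def by blast
    moreover have "ssat {..N} (finite_int d N) e (reduction d t x) =
        ssat {..N} (finite_int d N) (\<lambda>_. 0) (reduction d t x)" for e
      by (rule ssat_cong) (simp add: sfv_reduction)
    ultimately show False using N by blast
  qed
  ultimately have "x \<in> B \<longleftrightarrow> code_sfm (\<phi> x) \<in> code_sfm ` validities L T" for x
    unfolding inj_image_mem_iff[OF inj_code_sfm] by blast
  then show ?thesis
    unfolding many_one_reducible_def using computable_reduction[of n d t] unfolding \<phi>_def by blast
qed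

end

text \<open>
  Sentences have the same truth value under all assignments and give a single pattern.
\<close>

lemma unbounded_patterns_free_variable:
  assumes "unbounded_patterns L M n"
  obtains p where "p \<in> formulas L n" "fv p \<noteq> {}"
proof -
  obtain \<Delta> where \<Delta>: "set \<Delta> \<subseteq> formulas L n" "1 < card (patterns M \<Delta>)"
    using assms unfolding unbounded_patterns_def by blast
  have "\<exists>p\<in>set \<Delta>. fv p \<noteq> {}"
  proof (rule ccontr)
    assume closed: "\<not> (\<exists>p\<in>set \<Delta>. fv p \<noteq> {})"
    have "sat M e p = sat M undefined p" if "p \<in> set \<Delta>" for e p
      by (rule sat_cong) (use closed that in auto)
    then have "map (sat M e) \<Delta> = map (sat M undefined) \<Delta>" for e by (intro map_cong refl)
    then have "patterns M \<Delta> \<subseteq> {map (sat M undefined) \<Delta>}" unfolding patterns_def by blast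
    then have "card (patterns M \<Delta>) \<le> card {map (sat M undefined) \<Delta>}"
      by (intro card_mono) auto
    then show False using \<Delta> by simp
  qed
  then show thesis using that \<Delta> by blast
qed

theorem theorem3p13:
  fixes L :: language and T :: "fm set"
  assumes "effective L"
    and "is_theory L T"
    and "complete_theory L T"
    and "decidable_theory T"
    and "has_infinite_models L T"
    and "\<not> aleph0_categorical L T"
  shows "Pi1_complete (code_sfm ` validities L T)"
proof -
  obtain M :: "nat struct" and n where M: "model L T M" "unbounded_patterns L M n"
    using not_categorical_unbounded assms by blast
  obtain p where p: "p \<in> formulas L n" "fv p \<noteq> {}"
    using unbounded_patterns_free_variable[OF M(2)] by blast
  then have "0 < n" "wf_fm L p" by (auto simp: formulas_def)
  then obtain A where "\<And>j. wf_fm L (A j)" "\<And>j. fv (A j) = {j}" "computable_fun (\<lambda>j. code_fm (A j))"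
    using atoms_exist p(2) by blast
  then interpret theory_with_atoms L T M A
    using assms M by unfold_locales
  show ?thesis
    unfolding Pi1_complete_def using Pi1_validities Pi1_hard_validities[OF M(2) \<open>0 < n\<close>] by blast
qed

end
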